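(* Let $\mu\in T(\mathbb R)$ with Thorin family $\{\tau_+,\tau_-\}$, canonical function $k$ and probability density function $f$, and let $\gamma_\pm=\inf_{[0,\infty)}\operatorname{supp}\tau_\pm$. If $\tau_+\ne0$, $\int_{\mathbb R}e^{\gamma_+x}\mu(dx)<\infty$ and $x\mapsto\tau_+([0,\gamma_++x])$ is regularly varying at $0$ from the right, then $$f(x)\sim\left(\int_{\mathbb R}e^{\gamma_+y}\mu(dy)\right)\frac{k(x)}{|x|},\qquad x\to+\infty.$$ If $\tau_-\ne0$, $\int_{\mathbb R}e^{-\gamma_-x}\mu(dx)<\infty$ and $x\mapsto\tau_-([0,\gamma_-+x])$ is regularly varying at $0$ from the right, then $$f(x)\sim\left(\int_{\mathbb R}e^{-\gamma_-y}\mu(dy)\right)\frac{k(x)}{|x|},\qquad x\to-\infty.$$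
   Context: $T(\mathbb R)$ is the set of weak limits of finite convolutions of laws of $Vx$, $V$ a gamma random variable, $x\in\mathbb R\setminus\{0\}$. Each $\mu\in T(\mathbb R)$ is infinitely divisible with Lévy measure $\nu(dx)=\frac{k(x)}{|x|}dx$, where the canonical function is $k(x)=\int_0^\infty e^{-s|x|}\tau_\pm(ds)$ for $\pm x>0$ and $\tau_+,\tau_-$ (the Thorin family) are measures on $(0,\infty)$ with $\int_{(0,1]}(1+|\log s|)\tau_\pm(ds)+\int_{(1,\infty)}s^{-2}\tau_\pm(ds)<\infty$; $\mu$ may have a Gaussian component and arbitrary drift. $F$ is regularly varying at $0$ if $F(\lambda x)/F(x)\to\lambda^\rho$ as $x\to0^+$ for all $\lambda>0$ and some $\rho\in\mathbb R$. $f\sim g$ means $f/g\to1$. Non-degenerate laws in $T(\mathbb R)$ are absolutely continuous and unimodal, so $f$ may be taken monotone in each tail. *)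

theory Defs
  imports
    "HOL-Probability.Probability"
    "HOL-Probability.Convolution"
    "HOL-Library.Landau_Symbols"
begin

definition gamma_density :: "real \<Rightarrow> real \<Rightarrow> real \<Rightarrow> real" where
  "gamma_density a b v =
     (if v > 0 then b powr a / Gamma a * v powr (a - 1) * exp (- b * v) else 0)"

definition gamma_law :: "real \<Rightarrow> real \<Rightarrow> real measure" where
  "gamma_law a b = density lborel (\<lambda>v. ennreal (gamma_density a b v))"

inductive_set gamma_convolutions :: "real measure set" where
  elementary: "0 < a \<Longrightarrow> 0 < b \<Longrightarrow> x \<noteq> 0 \<Longrightarrow>
    distr (gamma_law a b) borel (\<lambda>v. v * x) \<in> gamma_convolutions"
| convolve: "M \<in> gamma_convolutions \<Longrightarrow> N \<in> gamma_convolutions \<Longrightarrow>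
    convolution M N \<in> gamma_convolutions"

(* Sequential limits give the full weak closure, since the weak topology on the
   Borel probability measures of the line is metrizable. *)
definition thorin_class :: "real measure set" where
  "thorin_class = {\<mu>. real_distribution \<mu> \<and>
     (\<exists>M. (\<forall>n. M n \<in> gamma_convolutions) \<and> weak_conv_m M \<mu>)}"

(* \<nu> is the Levy measure of \<mu>: the Levy-Khintchine formula holds with some drift c
   and some Gaussian variance v (truncation function: indicator of [-1,1]). *)
definition levy_measure_of :: "real measure \<Rightarrow> real measure \<Rightarrow> bool" where
  "levy_measure_of \<mu> \<nu> \<longleftrightarrow>
     sets \<nu> = sets borel \<and> emeasure \<nu> {0} = 0 \<and>
     (\<integral>\<^sup>+x. ennreal (min 1 (x\<^sup>2)) \<partial>\<nu>) < \<infinity> \<and>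
     (\<exists>c v. v \<ge> 0 \<and> (\<forall>t. char \<mu> t =
        exp (\<i> * of_real (c * t) - of_real (v * t\<^sup>2 / 2)
             + (CLINT x|\<nu>. iexp (t * x) - 1 - \<i> * of_real (t * x * indicator {-1..1} x)))))"

(* A measure on (0,\<infinity>) is represented as a Borel measure on the line without mass on
   (-\<infinity>,0]. *)
definition thorin_measure :: "real measure \<Rightarrow> bool" where
  "thorin_measure \<tau> \<longleftrightarrow>
     sets \<tau> = sets borel \<and> emeasure \<tau> {..0} = 0 \<and>
     (\<integral>\<^sup>+s\<in>{0<..1}. ennreal (1 + \<bar>ln s\<bar>) \<partial>\<tau>) + (\<integral>\<^sup>+s\<in>{1<..}. ennreal (1 / s\<^sup>2) \<partial>\<tau>) < \<infinity>"

(* The value at 0 is irrelevant. *)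
definition canonical_fun :: "real measure \<Rightarrow> real measure \<Rightarrow> real \<Rightarrow> real" where
  "canonical_fun \<tau>p \<tau>m x =
     (if x > 0 then LINT s:{0<..}|\<tau>p. exp (- s * \<bar>x\<bar>)
      else if x < 0 then LINT s:{0<..}|\<tau>m. exp (- s * \<bar>x\<bar>)
      else 0)"

definition thorin_family :: "real measure \<Rightarrow> real measure \<Rightarrow> real measure \<Rightarrow> bool" where
  "thorin_family \<mu> \<tau>p \<tau>m \<longleftrightarrow>
     thorin_measure \<tau>p \<and> thorin_measure \<tau>m \<and>
     levy_measure_of \<mu> (density lborel (\<lambda>x. ennreal (canonical_fun \<tau>p \<tau>m x / \<bar>x\<bar>)))"

definition measure_support :: "'a::topological_space measure \<Rightarrow> 'a set" where
  "measure_support M = {x. \<forall>U. open U \<longrightarrow> x \<in> U \<longrightarrow> emeasure M U > 0}"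

(* Only meaningful for a nonzero \<tau>: the real infimum of the empty set is unspecified. *)
definition thorin_edge :: "real measure \<Rightarrow> real" where
  "thorin_edge \<tau> = Inf (measure_support \<tau> \<inter> {0..})"

definition regularly_varying_at_0 :: "(real \<Rightarrow> real) \<Rightarrow> bool" where
  "regularly_varying_at_0 F \<longleftrightarrow>
     (\<exists>\<rho>. \<forall>l>0. ((\<lambda>x. F (l * x) / F x) \<longlongrightarrow> l powr \<rho>) (at_right 0))"

(* A density is determined only up to null sets; pointwise tail asymptotics refer to a
   version that is monotone in each tail. *)
definition tail_monotone_density :: "real measure \<Rightarrow> (real \<Rightarrow> real) \<Rightarrow> bool" where
  "tail_monotone_density \<mu> f \<longleftrightarrow>
     f \<in> borel_measurable borel \<and> (\<forall>x. f x \<ge> 0) \<and>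
     \<mu> = density lborel (\<lambda>x. ennreal (f x)) \<and>
     (\<exists>a. antimono_on {a..} f) \<and> (\<exists>a. mono_on {..a} f)"

end

theory Submission
  imports Defs "HOL-Real_Asymp.Real_Asymp"
begin

text \<open>
  The jumps larger than \<open>1\<close> have finite intensity \<open>w1 x = k x / x\<close>, so \<open>\<mu>\<close> is a Poisson mixture of the
  measures \<open>Q * w1 * \<dots> * w1\<close>, where the remaining factor \<open>Q\<close> has exponential moments of every
  nonnegative order. Tilting by \<open>exp (\<gamma> * x)\<close> with \<open>\<gamma> = thorin_edge \<tau>p\<close> turns \<open>w1\<close> into \<open>g x = L x / x\<close>, where \<open>L\<close> is the
  Laplace transform of \<open>\<tau>p\<close> shifted to have left edge \<open>0\<close>. Such an \<open>L\<close> is long-tailed and heavier than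
  every exponential, and regular variation makes it dominatedly varying; hence \<open>g\<close> is a
  subexponential density, and the tilted mixture has density asymptotic to
  \<open>(\<integral> exp (\<gamma> * y) \<partial>\<mu>) * g x\<close>, up to the light part coming from \<open>Q\<close>. Monotonicity of \<open>f\<close> turns this
  statement about masses of short intervals into the pointwise one. The left tail follows by reflection.
\<close>

section \<open>Compound Poisson laws\<close>

text \<open>The obstacle is that nothing pointwise is known about \<open>Q\<close>. It is therefore
  kept as a measure throughout: every term with at least one large jump has a density because
  \<open>w1\<close> does, and the jump-free term enters only through its mass. That mass decays
  exponentially even after tilting, since \<open>Q\<close> has moments of order above \<gamma>, and
  so it is lost against \<open>g\<close>. The constant arises as follows. A sum of
  \<open>n + 1\<close> tilted jumps is large because one of them is, which gives a factor
  \<open>n + 1\<close> and the product of the masses of the others. Division by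
  \<open>(n + 1)!\<close> turns the resulting series into an exponential series, and its sum times
  the moment of \<open>Q\<close> is the exponential moment of \<mu>. Finiteness of that moment also
  makes \<open>g\<close> integrable, because the term with a single jump is dominated by the whole
  mixture.\<close>

primrec conv_iter :: "real measure \<Rightarrow> real measure \<Rightarrow> nat \<Rightarrow> real measure" where
  "conv_iter Q D 0 = Q"
| "conv_iter Q D (Suc n) = convolution (conv_iter Q D n) D"

lemma sets_conv_iter [simp, measurable_cong]:
  "sets Q = sets borel \<Longrightarrow> sets (conv_iter Q D n) = sets borel"
  by (cases n) simp_all

lemma finite_measure_conv_iter:
  assumes "finite_measure Q" "finite_measure D" "sets Q = sets borel" "sets D = sets borel"
  shows "finite_measure (conv_iter Q D n)"
  by (induction n) (simp_all add: assms convolution_finite)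

lemma char_convolution:
  assumes "finite_measure M" "finite_measure N"
  assumes [measurable_cong]: "sets M = sets borel" "sets N = sets borel"
  shows "char (convolution M N) t = char M t * char N t"
proof -
  interpret M: finite_measure M by fact
  interpret N: finite_measure N by fact
  interpret pair_sigma_finite M N ..
  have fin: "finite_measure (M \<Otimes>\<^sub>M N)"
    by (rule finite_measure_pair_measure) fact+
  have int: "integrable (M \<Otimes>\<^sub>M N) (\<lambda>p. iexp (t * (fst p + snd p)))"
    by (rule finite_measure.integrable_const_bound[OF fin, of _ 1]) auto
  have "char (convolution M N) t = (CLINT p|M \<Otimes>\<^sub>M N. iexp (t * (fst p + snd p)))"
    unfolding char_def convolution_def
    by (subst integral_distr) (auto simp: case_prod_beta' intro!: Bochner_Integration.integral_cong)
  also have "\<dots> = (CLINT x|M. CLINT y|N. iexp (t * (x + y)))"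
    using integral_fst'[OF int] by simp
  also have "\<dots> = (CLINT x|M. iexp (t * x) * (CLINT y|N. iexp (t * y)))"
    by (simp add: algebra_simps exp_add)
  also have "\<dots> = char M t * char N t"
    unfolding char_def by simp
  finally show ?thesis .
qed

lemma char_conv_iter:
  assumes "finite_measure Q" "finite_measure D" "sets Q = sets borel" "sets D = sets borel"
  shows "char (conv_iter Q D n) t = char Q t * char D t ^ n"
  by (induction n) (simp_all add: char_convolution finite_measure_conv_iter assms)

lemma emeasure_convolution_UNIV:
  assumes "finite_measure M" "finite_measure N" "sets M = sets borel" "sets N = sets borel"
  shows "emeasure (convolution M N) UNIV = emeasure M UNIV * emeasure N UNIV"
  using assms sets_eq_imp_space_eq[of M borel] sets_eq_imp_space_eq[of N borel]
  by (simp add: convolution_emeasure' mult.commute)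

lemma finite_measure_density_real:
  fixes w :: "real \<Rightarrow> real"
  assumes "integrable lborel w"
  shows "finite_measure (density lborel (\<lambda>x. ennreal (w x)))"
proof (rule finite_measureI)
  have "(\<integral>\<^sup>+x. ennreal (w x) \<partial>lborel) \<le> (\<integral>\<^sup>+x. ennreal \<bar>w x\<bar> \<partial>lborel)"
    by (intro nn_integral_mono ennreal_leI) auto
  also have "\<dots> < \<infinity>" using assms by (auto simp: integrable_iff_bounded)
  finally show "emeasure (density lborel (\<lambda>x. ennreal (w x))) (space (density lborel (\<lambda>x. ennreal (w x)))) \<noteq> \<infinity>"
    using assms by (auto simp: emeasure_density)
qed

lemma char_density:
  fixes w :: "real \<Rightarrow> real"
  assumes [measurable]: "w \<in> borel_measurable borel" and "\<And>x. 0 \<le> w x"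
  shows "char (density lborel (\<lambda>x. ennreal (w x))) t = (CLINT x|lborel. w x * iexp (t * x))"
  unfolding char_def by (subst integral_density) (auto simp: assms scaleR_conv_of_real)

text \<open>Each factor \<open>w\<close> gives up one factor \<open>c\<close>. This allows the
  mixture to be built from jump measures of mass at most 1, as a kernel into subprobability measures
  requires, while its terms are still read off for \<open>w\<close> itself.\<close>

lemma nn_integral_conv_iter_scale:
  fixes w :: "real \<Rightarrow> real"
  assumes Q: "finite_measure Q" "sets Q = sets borel" and w: "integrable lborel w"
    and w0: "\<And>x. 0 \<le> w x" and c: "c > 0" and [measurable]: "f \<in> borel_measurable borel"
  shows "(\<integral>\<^sup>+x. f x \<partial>conv_iter Q (density lborel (\<lambda>x. ennreal (w x))) n)
    = ennreal (c ^ n) * (\<integral>\<^sup>+x. f x \<partial>conv_iter Q (density lborel (\<lambda>x. ennreal (w x / c))) n)"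
  using \<open>f \<in> borel_measurable borel\<close>
proof (induction n arbitrary: f)
  case 0
  then show ?case by simp
next
  case (Suc n)
  let ?D = "density lborel (\<lambda>x. ennreal (w x))" and ?D' = "density lborel (\<lambda>x. ennreal (w x / c))"
  have [measurable]: "f \<in> borel_measurable borel" "w \<in> borel_measurable borel" using Suc.prems w by auto
  have fin: "finite_measure ?D" "finite_measure ?D'"
    using finite_measure_density_real w by auto
  have inner: "(\<integral>\<^sup>+y. f (x + y) \<partial>?D) = ennreal c * (\<integral>\<^sup>+y. f (x + y) \<partial>?D')" for x
  proof -
    have "ennreal (w y) = ennreal c * ennreal (w y / c)" for y
      using c w0[of y] by (subst ennreal_mult'[symmetric]) auto
    then show ?thesis
      by (simp add: nn_integral_density nn_integral_cmult mult.assoc)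
  qed
  interpret D': finite_measure ?D' by (rule fin)
  have "(\<integral>\<^sup>+x. f x \<partial>conv_iter Q ?D (Suc n)) = (\<integral>\<^sup>+x. (\<integral>\<^sup>+y. f (x + y) \<partial>?D) \<partial>conv_iter Q ?D n)"
    by (simp add: nn_integral_convolution finite_measure_conv_iter Q fin)
  also have "\<dots> = (\<integral>\<^sup>+x. ennreal c * (\<integral>\<^sup>+y. f (x + y) \<partial>?D') \<partial>conv_iter Q ?D n)"
    unfolding inner ..
  also have "\<dots> = ennreal (c ^ n) * (\<integral>\<^sup>+x. ennreal c * (\<integral>\<^sup>+y. f (x + y) \<partial>?D') \<partial>conv_iter Q ?D' n)"
    by (rule Suc.IH) measurable
  also have "\<dots> = ennreal (c ^ Suc n) * (\<integral>\<^sup>+x. (\<integral>\<^sup>+y. f (x + y) \<partial>?D') \<partial>conv_iter Q ?D' n)"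
    using c by (subst nn_integral_cmult)
      (auto simp: Q ennreal_mult' mult_ac cong: measurable_cong_sets)
  also have "(\<integral>\<^sup>+x. (\<integral>\<^sup>+y. f (x + y) \<partial>?D') \<partial>conv_iter Q ?D' n) = (\<integral>\<^sup>+x. f x \<partial>conv_iter Q ?D' (Suc n))"
    by (simp add: nn_integral_convolution finite_measure_conv_iter Q fin)
  finally show ?case .
qed


lemma emeasure_conv_iter_UNIV:
  assumes "finite_measure Q" "finite_measure D" "sets Q = sets borel" "sets D = sets borel"
  shows "emeasure (conv_iter Q D n) UNIV = emeasure Q UNIV * emeasure D UNIV ^ n"
  by (induction n)
    (simp_all add: emeasure_convolution_UNIV finite_measure_conv_iter assms mult_ac)

lemma exp_sums_divide_fact: "(\<lambda>n. x ^ n / fact n) sums exp (x :: real)"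
  using exp_converges[of x] by (simp add: divide_inverse mult.commute)

text \<open>
  The Poisson mixture is built with jump laws of mass at most 1 by moving the scaling into weights
  with parameter \<open>lam + 1\<close>, which also covers \<open>lam = 0\<close>.
\<close>

lemma compound_poisson_exists:
  fixes w :: "real \<Rightarrow> real"
  assumes Q: "real_distribution Q" and w: "integrable lborel w" and w0: "\<And>x. 0 \<le> w x"
  obtains P where "real_distribution P"
    "\<And>f. f \<in> borel_measurable borel \<Longrightarrow> (\<integral>\<^sup>+x. f x \<partial>P) =
       (\<Sum>n. ennreal (exp (- (LINT x|lborel. w x)) / fact n) *
         (\<integral>\<^sup>+x. f x \<partial>conv_iter Q (density lborel (\<lambda>x. ennreal (w x))) n))"
    "\<And>t. char P t = char Q t * exp (CLINT x|lborel. w x * (iexp (t * x) - 1))"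
proof -
  interpret Q: real_distribution Q by fact
  define lam where "lam = (LINT x|lborel. w x)"
  define c where "c = lam + 1"
  define D where "D = density lborel (\<lambda>x. ennreal (w x))"
  define D' where "D' = density lborel (\<lambda>x. ennreal (w x / c))"
  define N where "N = conv_iter Q D'"
  define p where "p n = exp (- lam) * c ^ n / fact n" for n
  \<comment> \<open>\<open>M\<close> has mass \<open>exp 1\<close>, not 1: the weights are Poisson
    with parameter \<open>c\<close> but normalised by \<open>exp (- lam)\<close>. The masses
    \<open>(lam / c) ^ n\<close> of \<open>N n\<close> restore total mass 1.\<close>
  define M where "M = density (count_space UNIV) (\<lambda>n. ennreal (p n))"
  define P where "P = bind M N"
  have [measurable]: "w \<in> borel_measurable borel" using w by auto
  have lam: "lam \<ge> 0" unfolding lam_def by (simp add: w0)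
  then have c: "c > 0" by (simp add: c_def)
  have Qs: "finite_measure Q" "sets Q = sets borel" by unfold_locales simp
  have Ds: "finite_measure D" "sets D = sets borel" "finite_measure D'" "sets D' = sets borel"
    unfolding D_def D'_def using finite_measure_density_real w by auto
  have DU: "emeasure D UNIV = ennreal lam"
    unfolding D_def lam_def using w w0 by (simp add: emeasure_density nn_integral_eq_integral)
  have D'U: "emeasure D' UNIV = ennreal (lam / c)"
    unfolding D'_def lam_def using w w0 c by (simp add: emeasure_density nn_integral_eq_integral)
  have QU: "emeasure Q UNIV = 1" using Q.emeasure_space_1 by simp
  have NU: "emeasure (N n) UNIV = ennreal ((lam / c) ^ n)" for n
    unfolding N_def using lam c by (simp add: emeasure_conv_iter_UNIV Qs Ds QU D'U ennreal_power)
  have [simp]: "space (N n) = UNIV" "sets (N n) = sets borel" for n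
    using sets_eq_imp_space_eq[of "N n" borel] by (auto simp: N_def Qs)
  have [measurable_cong]: "sets (N n) = sets borel" for n by simp
  have fN: "finite_measure (N n)" for n
    unfolding N_def by (rule finite_measure_conv_iter[OF Qs(1) Ds(3) Qs(2) Ds(4)])
  have N1: "emeasure (N n) UNIV \<le> 1" for n
  proof -
    have "(lam / c) ^ n \<le> 1" using lam c by (intro power_le_one) (auto simp: c_def)
    then show ?thesis by (simp add: NU ennreal_le_1)
  qed
  have Nsp: "N n \<in> space (subprob_algebra borel)" for n
    using N1[of n] by (auto simp: space_subprob_algebra intro!: subprob_spaceI)
  have NM: "N \<in> measurable M (subprob_algebra borel)"
    unfolding M_def using Nsp by (simp add: measurable_density_eq1 measurable_count_space_eq1)
  have setsP [simp]: "sets P = sets borel"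
    unfolding P_def by (rule sets_bind) (auto simp: M_def)
  then have [simp]: "space P = UNIV" using sets_eq_imp_space_eq by fastforce
  have p0: "p n \<ge> 0" for n unfolding p_def using c by auto
  have nnP: "(\<integral>\<^sup>+x. f x \<partial>P) = (\<Sum>n. ennreal (p n) * (\<integral>\<^sup>+x. f x \<partial>N n))"
    if [measurable]: "f \<in> borel_measurable borel" for f
    unfolding P_def by (subst nn_integral_bind[OF that NM])
      (simp add: M_def nn_integral_density nn_integral_count_space_nat)
  have scale: "ennreal (p n) * (\<integral>\<^sup>+x. f x \<partial>N n) =
      ennreal (exp (- lam) / fact n) * (\<integral>\<^sup>+x. f x \<partial>conv_iter Q D n)"
    if "f \<in> borel_measurable borel" for f n
  proof -
    have "ennreal (p n) = ennreal (exp (- lam) / fact n) * ennreal (c ^ n)"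
      unfolding p_def using c by (subst ennreal_mult'[symmetric]) auto
    then show ?thesis
      unfolding N_def D'_def D_def nn_integral_conv_iter_scale[OF Qs w w0 c that]
      by (simp only: mult.assoc)
  qed
  have nnP': "(\<integral>\<^sup>+x. f x \<partial>P) =
      (\<Sum>n. ennreal (exp (- lam) / fact n) * (\<integral>\<^sup>+x. f x \<partial>conv_iter Q D n))"
    if "f \<in> borel_measurable borel" for f
    unfolding nnP[OF that] scale[OF that] ..
  have "emeasure P UNIV = 1"
  proof -
    have "emeasure P UNIV = (\<integral>\<^sup>+x. 1 \<partial>P)" by simp
    also have "\<dots> = (\<Sum>n. ennreal (exp (- lam) * (lam ^ n / fact n)))"
      using lam
      by (subst nnP', simp, intro suminf_cong)
        (simp add: emeasure_conv_iter_UNIV Qs Ds QU DU ennreal_power ennreal_mult'[symmetric]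
          sets_eq_imp_space_eq[of "conv_iter Q D _" borel])
    also have "\<dots> = ennreal (exp (- lam) * exp lam)"
      using lam by (intro sums_unique[symmetric] sums_ennreal[THEN iffD2] sums_mult exp_sums_divide_fact) auto
    also have "\<dots> = 1" by (simp add: exp_minus)
    finally show ?thesis .
  qed
  then have P: "real_distribution P"
    by (auto intro!: real_distribution.intro prob_spaceI simp: real_distribution_axioms_def)
  have fM: "finite_measure M"
  proof (rule finite_measureI)
    have "emeasure M (space M) = (\<Sum>n. ennreal (exp (- lam) * (c ^ n / fact n)))"
      unfolding M_def by (simp add: emeasure_density nn_integral_count_space_nat p_def)
    also have "\<dots> = ennreal (exp (- lam) * exp c)"
      using c by (intro sums_unique[symmetric] sums_ennreal[THEN iffD2] sums_mult exp_sums_divide_fact) auto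
    finally show "emeasure M (space M) \<noteq> \<infinity>" by simp
  qed
  \<comment> \<open>The formula for nonnegative integrands does not reach characteristic functions.
    Bounded real integrands do, through the real and imaginary parts of
    \<open>iexp (t * x)\<close>.\<close>
  have realP: "(\<lambda>n. p n * (LINT x|N n. h x)) sums (LINT x|P. h x)"
    if h[measurable]: "h \<in> borel_measurable borel" and b: "\<And>x. \<bar>h x\<bar> \<le> 1" for h :: "real \<Rightarrow> real"
  proof -
    have hb: "\<bar>LINT x|N n. h x\<bar> \<le> 1" for n
    proof -
      interpret finite_measure "N n" by (rule fN)
      have "\<bar>LINT x|N n. h x\<bar> \<le> (LINT x|N n. \<bar>h x\<bar>)" by (rule integral_abs_bound)
      also have "\<dots> \<le> (LINT x|N n. 1)"
        by (intro integral_mono integrable_const_bound[of _ 1]) (auto simp: b)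
      also have "\<dots> = measure (N n) UNIV" by simp
      also have "\<dots> \<le> 1" using N1[of n] by (simp add: emeasure_eq_measure)
      finally show ?thesis .
    qed
    have "(LINT x|P. h x) = (LINT n|M. LINT x|N n. h x)"
      unfolding P_def by (rule integral_bind[OF h b NM fM, of 1]) (auto simp: N1)
    also have "\<dots> = (LINT n|count_space UNIV. p n * (LINT x|N n. h x))"
      unfolding M_def by (subst integral_density) (auto simp: p0)
    finally have eq: "(LINT x|P. h x) = (LINT n|count_space UNIV. p n * (LINT x|N n. h x))" .
    have "summable (\<lambda>n. norm (p n * (LINT x|N n. h x)))"
    proof (rule summable_comparison_test)
      show "\<exists>k. \<forall>n\<ge>k. norm (norm (p n * (LINT x|N n. h x))) \<le> p n"
        using hb p0 by (auto simp: abs_mult intro!: mult_left_le)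
      show "summable p" unfolding p_def
        using sums_mult[OF exp_sums_divide_fact[of c], of "exp (- lam)"] by (simp add: sums_iff)
    qed
    then have "integrable (count_space UNIV) (\<lambda>n. p n * (LINT x|N n. h x))"
      by (simp add: integrable_count_space_nat_iff)
    then show ?thesis unfolding eq by (rule sums_integral_count_space_nat)
  qed
  have charP: "char P t = char Q t * exp (CLINT x|lborel. w x * (iexp (t * x) - 1))" for t
  proof -
    interpret P: real_distribution P by (rule P)
    have iP: "integrable P (\<lambda>x. iexp (t * x))"
      by (rule P.integrable_const_bound[of _ 1]) auto
    have iN: "integrable (N n) (\<lambda>x. iexp (t * x))" for n
      by (rule finite_measure.integrable_const_bound[OF fN, of _ 1])
        (auto cong: measurable_cong_sets)
    have re: "Re (of_real (p n) * char (N n) t) = p n * (LINT x|N n. Re (iexp (t * x)))"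
         and im: "Im (of_real (p n) * char (N n) t) = p n * (LINT x|N n. Im (iexp (t * x)))" for n
      unfolding char_def integral_Re[OF iN] integral_Im[OF iN] by auto
    have s1: "(\<lambda>n. of_real (p n) * char (N n) t) sums char P t"
      unfolding sums_complex_iff re im
      unfolding char_def integral_Re[OF iP, symmetric] integral_Im[OF iP, symmetric]
      by (intro conjI realP) (auto intro!: order_trans[OF abs_Re_le_cmod] order_trans[OF abs_Im_le_cmod])
    define ww where "ww = (CLINT x|lborel. w x * iexp (t * x))"
    have "char D' t = ww / c"
      unfolding D'_def ww_def using w0 c by (subst char_density) auto
    then have "of_real (p n) * char (N n) t = of_real (exp (- lam)) * char Q t * (ww ^ n / fact n)" for n
      unfolding N_def char_conv_iter[OF Qs(1) Ds(3) Qs(2) Ds(4)] p_def using c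
      by (simp add: power_divide)
    moreover have "(\<lambda>n. of_real (exp (- lam)) * char Q t * (ww ^ n / fact n)) sums
        (of_real (exp (- lam)) * char Q t * exp ww)"
      using exp_converges[of ww] by (intro sums_mult) (simp add: scaleR_conv_of_real divide_inverse mult.commute)
    ultimately have "char P t = of_real (exp (- lam)) * char Q t * exp ww"
      using s1 sums_unique2 by auto
    moreover have "(CLINT x|lborel. w x * (iexp (t * x) - 1)) = ww - lam"
    proof -
      have "integrable lborel (\<lambda>x. w x * iexp (t * x))"
        by (rule Bochner_Integration.integrable_bound[OF w]) (auto simp: norm_mult)
      then show ?thesis unfolding ww_def lam_def using w by (simp add: right_diff_distrib)
    qed
    ultimately show ?thesis by (simp add: exp_diff exp_minus exp_of_real divide_inverse mult_ac)
  qed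
  show thesis
    by (rule that[OF P]) (use nnP' charP in \<open>auto simp: D_def lam_def\<close>)
qed

section \<open>Exponential moments\<close>

lemma nn_integral_exp_conv_iter:
  assumes "finite_measure Q" "finite_measure D"
    and [simp, measurable_cong]: "sets Q = sets borel" "sets D = sets borel"
  shows "(\<integral>\<^sup>+x. ennreal (exp (\<theta> * x)) \<partial>conv_iter Q D n) =
    (\<integral>\<^sup>+x. ennreal (exp (\<theta> * x)) \<partial>Q) * (\<integral>\<^sup>+x. ennreal (exp (\<theta> * x)) \<partial>D) ^ n"
proof (induction n)
  case 0
  then show ?case by simp
next
  case (Suc n)
  have "(\<integral>\<^sup>+x. ennreal (exp (\<theta> * x)) \<partial>conv_iter Q D (Suc n)) =
    (\<integral>\<^sup>+x. (\<integral>\<^sup>+y. ennreal (exp (\<theta> * x)) * ennreal (exp (\<theta> * y)) \<partial>D) \<partial>conv_iter Q D n)"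
    by (simp add: nn_integral_convolution finite_measure_conv_iter assms
        ring_distribs exp_add ennreal_mult)
  also have "\<dots> = (\<integral>\<^sup>+x. ennreal (exp (\<theta> * x)) * (\<integral>\<^sup>+y. ennreal (exp (\<theta> * y)) \<partial>D) \<partial>conv_iter Q D n)"
    by (simp add: nn_integral_cmult)
  also have "\<dots> = (\<integral>\<^sup>+x. ennreal (exp (\<theta> * x)) \<partial>conv_iter Q D n) * (\<integral>\<^sup>+y. ennreal (exp (\<theta> * y)) \<partial>D)"
    by (simp add: nn_integral_multc)
  finally show ?case by (simp only: Suc.IH power_Suc2 mult.assoc)
qed

text \<open>Exponential moments multiply under convolution, so the mixture becomes the series of
  \<open>exp (E - lam)\<close> with \<open>E\<close> the exponential moment of \<open>w\<close>. The
  moment of \<open>Q\<close> may be infinite here; the identity holds in the extended sense.\<close>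

lemma nn_integral_exp_compound_poisson:
  fixes w :: "real \<Rightarrow> real"
  assumes Q: "real_distribution Q" and w: "integrable lborel w" and w0: "\<And>x. 0 \<le> w x"
    and P: "\<And>f. f \<in> borel_measurable borel \<Longrightarrow> (\<integral>\<^sup>+x. f x \<partial>P) =
       (\<Sum>n. ennreal (exp (- (LINT x|lborel. w x)) / fact n) *
         (\<integral>\<^sup>+x. f x \<partial>conv_iter Q (density lborel (\<lambda>x. ennreal (w x))) n))"
    and we: "integrable lborel (\<lambda>x. w x * exp (\<theta> * x))"
  shows "(\<integral>\<^sup>+x. ennreal (exp (\<theta> * x)) \<partial>P) =
    (\<integral>\<^sup>+x. ennreal (exp (\<theta> * x)) \<partial>Q) * ennreal (exp (LINT x|lborel. w x * (exp (\<theta> * x) - 1)))"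
proof -
  interpret Q: real_distribution Q by fact
  have [measurable]: "w \<in> borel_measurable borel" using w by auto
  have Qs: "finite_measure Q" "sets Q = sets borel" by unfold_locales simp
  define lam where "lam = (LINT x|lborel. w x)"
  define E where "E = (LINT x|lborel. w x * exp (\<theta> * x))"
  define q where "q = (\<integral>\<^sup>+x. ennreal (exp (\<theta> * x)) \<partial>Q)"
  have E: "(\<integral>\<^sup>+x. ennreal (exp (\<theta> * x)) \<partial>density lborel (\<lambda>x. ennreal (w x))) = ennreal E"
    unfolding E_def using w0 we
    by (simp add: nn_integral_density ennreal_mult'[symmetric] nn_integral_eq_integral)
  have E0: "E \<ge> 0" unfolding E_def by (simp add: w0)
  have "(\<integral>\<^sup>+x. ennreal (exp (\<theta> * x)) \<partial>P) = (\<Sum>n. q * ennreal (exp (- lam) * (E ^ n / fact n)))"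
    using E0 by (subst P)
      (simp_all add: nn_integral_exp_conv_iter finite_measure_density_real w Qs E q_def[symmetric]
        lam_def[symmetric] ennreal_power ennreal_mult'[symmetric] mult.left_commute[of _ q])
  also have "\<dots> = q * ennreal (exp (- lam) * exp E)"
    using E0 by (subst ennreal_suminf_cmult)
      (intro arg_cong[where f="\<lambda>x. q * x"] sums_unique[symmetric] sums_ennreal[THEN iffD2]
        sums_mult exp_sums_divide_fact, auto)
  also have "exp (- lam) * exp E = exp (LINT x|lborel. w x * (exp (\<theta> * x) - 1))"
    using w we by (simp add: right_diff_distrib lam_def E_def exp_minus exp_diff divide_inverse mult.commute)
  finally show ?thesis unfolding q_def .
qed

text \<open>The quadratic factor matches the integrability of \<open>w x * x\<^sup>2\<close>, which
  is all that is available for small jumps.\<close>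

lemma exp_minus_one_minus_le: "exp y - 1 - y \<le> y\<^sup>2 * exp \<bar>y\<bar>" for y :: real
proof -
  obtain t where t: "\<bar>t\<bar> \<le> \<bar>y\<bar>" "exp y = (\<Sum>m<2. y ^ m / fact m) + exp t / fact 2 * y ^ 2"
    using Maclaurin_exp_le[of y 2] by auto
  have "exp t / 2 * y\<^sup>2 \<le> exp \<bar>y\<bar> * y\<^sup>2"
  proof (intro mult_right_mono)
    have "exp t \<le> exp \<bar>y\<bar>" using t(1) by simp
    then show "exp t / 2 \<le> exp \<bar>y\<bar>" using exp_gt_zero[of t] by linarith
  qed simp
  then show ?thesis using t(2) by (simp add: numeral_2_eq_2 mult.commute)
qed

text \<open>Completing the square: tilting the standard normal density by
  \<open>exp (\<theta> * x)\<close> moves its mean to \<theta>.\<close>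

lemma nn_integral_exp_std_normal:
  "(\<integral>\<^sup>+x. ennreal (exp (\<theta> * x)) \<partial>std_normal_distribution) = ennreal (exp (\<theta>\<^sup>2 / 2))"
proof -
  have "std_normal_density x * exp (\<theta> * x) = exp (\<theta>\<^sup>2 / 2) * normal_density \<theta> 1 x" for x
  proof -
    have "- (x\<^sup>2 / 2) + \<theta> * x = \<theta>\<^sup>2 / 2 + - (x - \<theta>)\<^sup>2 / 2"
      by (simp add: power2_eq_square field_simps)
    then have "exp (- (x\<^sup>2 / 2)) * exp (\<theta> * x) = exp (\<theta>\<^sup>2 / 2) * exp (- (x - \<theta>)\<^sup>2 / 2)"
      by (simp only: exp_add[symmetric])
    then show ?thesis
      by (simp add: normal_density_def std_normal_density_def)
  qed
  then have "(\<integral>\<^sup>+x. ennreal (exp (\<theta> * x)) \<partial>std_normal_distribution) =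
      (\<integral>\<^sup>+x. ennreal (exp (\<theta>\<^sup>2 / 2)) * ennreal (normal_density \<theta> 1 x) \<partial>lborel)"
    by (simp add: nn_integral_density ennreal_mult'[symmetric] normal_density_nonneg)
  also have "\<dots> = ennreal (exp (\<theta>\<^sup>2 / 2))"
    using integrable_normal_density[of 1 \<theta>] integral_normal_density[of 1 \<theta>]
    by (subst nn_integral_cmult) (auto simp: nn_integral_eq_integral)
  finally show ?thesis .
qed

text \<open>An affine image of the standard normal law, so that \<open>v = 0\<close> yields the
  point mass at \<open>b\<close> without a separate case.\<close>

lemma gaussian_exists:
  assumes "v \<ge> 0"
  obtains G where "real_distribution G"
    "\<And>t. char G t = exp (\<i> * of_real (b * t) - of_real (v * t\<^sup>2 / 2))"
    "\<And>\<theta>. (\<integral>\<^sup>+x. ennreal (exp (\<theta> * x)) \<partial>G) = ennreal (exp (b * \<theta> + v * \<theta>\<^sup>2 / 2))"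
proof
  let ?G = "distr std_normal_distribution borel (\<lambda>x. b + sqrt v * x)"
  interpret std: real_distribution std_normal_distribution by (rule real_dist_normal_dist)
  show "real_distribution ?G"
    by (rule std.real_distribution_distr) simp
  show "char ?G t = exp (\<i> * of_real (b * t) - of_real (v * t\<^sup>2 / 2))" for t
  proof -
    have "char ?G t = (CLINT x|std_normal_distribution. iexp (b * t) * iexp (t * sqrt v * x))"
      unfolding char_def by (subst integral_distr) (auto simp: algebra_simps exp_add)
    also have "\<dots> = iexp (b * t) * char std_normal_distribution (t * sqrt v)"
      unfolding char_def by simp
    also have "\<dots> = iexp (b * t) * exp (- of_real (v * t\<^sup>2 / 2))"
    proof -
      have "(t * sqrt v)\<^sup>2 = v * t\<^sup>2" using assms by (simp add: power_mult_distrib)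
      then show ?thesis
        by (simp only: char_std_normal_distribution exp_of_real[symmetric] of_real_minus[symmetric]
            minus_divide_left[symmetric])
    qed
    also have "\<dots> = exp (\<i> * of_real (b * t) - of_real (v * t\<^sup>2 / 2))"
      by (simp only: exp_add[symmetric] diff_conv_add_uminus)
    finally show ?thesis .
  qed
  show "(\<integral>\<^sup>+x. ennreal (exp (\<theta> * x)) \<partial>?G) = ennreal (exp (b * \<theta> + v * \<theta>\<^sup>2 / 2))" for \<theta>
  proof -
    have "(\<integral>\<^sup>+x. ennreal (exp (\<theta> * x)) \<partial>?G) =
        (\<integral>\<^sup>+x. ennreal (exp (b * \<theta>)) * ennreal (exp (\<theta> * sqrt v * x)) \<partial>std_normal_distribution)"
      by (simp add: nn_integral_distr ennreal_mult'[symmetric] exp_add[symmetric] algebra_simps)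
    also have "\<dots> = ennreal (exp (b * \<theta>)) * ennreal (exp ((\<theta> * sqrt v)\<^sup>2 / 2))"
      by (subst nn_integral_cmult) (auto simp: nn_integral_exp_std_normal)
    also have "\<dots> = ennreal (exp (b * \<theta> + v * \<theta>\<^sup>2 / 2))"
      using assms by (simp add: ennreal_mult'[symmetric] exp_add power_mult_distrib mult.commute)
    finally show ?thesis .
  qed
qed

section \<open>Tightness and weak limits under exponential moment bounds\<close>

lemma tight_of_exp_moments:
  assumes P: "\<And>n. real_distribution (P n)"
    and K: "\<And>n. (\<integral>\<^sup>+x. ennreal (exp x + exp (- x)) \<partial>P n) \<le> ennreal K" "0 \<le> K"
  shows "tight P"
  unfolding tight_def
proof (intro conjI allI impI P)
  fix \<epsilon> :: real assume e: "\<epsilon> > 0"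
  \<comment> \<open>Chosen so that \<open>exp b\<close> exceeds \<open>K / \<epsilon>\<close>. The
    summand in \<open>K + 1\<close> keeps the argument of \<open>ln\<close> positive when
    \<open>K = 0\<close> and makes the inequality strict; the outer summand makes \<open>b\<close>
    positive.\<close>
  define b where "b = \<bar>ln ((K + 1) / \<epsilon>)\<bar> + 1"
  have b: "b > 0" "K < \<epsilon> * exp b"
  proof -
    show "b > 0" by (simp add: b_def)
    have "(K + 1) / \<epsilon> = exp (ln ((K + 1) / \<epsilon>))" using e K by simp
    also have "\<dots> \<le> exp b" by (simp add: b_def)
    finally show "K < \<epsilon> * exp b" using e by (simp add: field_simps)
  qed
  have "measure (P n) {-b<..b} > 1 - \<epsilon>" for n
  proof -
    interpret real_distribution "P n" by (rule P)
    let ?A = "- {-b<..b}"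
    \<comment> \<open>Markov's inequality: outside the interval one of \<open>exp x\<close> and
      \<open>exp (- x)\<close> is at least \<open>exp b\<close>.\<close>
    have "ennreal (exp b) * emeasure (P n) ?A = (\<integral>\<^sup>+x. ennreal (exp b) * indicator ?A x \<partial>P n)"
      by (simp add: nn_integral_cmult_indicator)
    also have "\<dots> \<le> (\<integral>\<^sup>+x. ennreal (exp x + exp (- x)) \<partial>P n)"
    proof (intro nn_integral_mono)
      fix x :: real
      have "exp b \<le> exp x + exp (-x)" if "x \<in> ?A"
      proof (cases "x \<le> -b")
        case True
        then have "exp b \<le> exp (-x)" by simp
        then show ?thesis using exp_ge_zero[of x] by linarith
      next
        case False
        then have "exp b \<le> exp x" using that by simp
        then show ?thesis using exp_ge_zero[of "-x"] by linarith
      qed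
      then show "ennreal (exp b) * indicator ?A x \<le> ennreal (exp x + exp (- x))"
        by (auto split: split_indicator intro!: ennreal_leI simp del: ennreal_plus)
    qed
    also have "\<dots> \<le> ennreal K" by (rule K)
    finally have "exp b * measure (P n) ?A \<le> K"
      using K by (simp add: emeasure_eq_measure ennreal_mult'[symmetric])
    then have "exp b * measure (P n) ?A < \<epsilon> * exp b" using b(2) by (rule le_less_trans)
    then have "measure (P n) ?A < \<epsilon>" by (simp add: mult.commute[of \<epsilon>])
    moreover have "measure (P n) ?A = 1 - measure (P n) {-b<..b}"
      using prob_compl[of "{-b<..b}"] by (simp add: Compl_eq_Diff_UNIV)
    ultimately show ?thesis by simp
  qed
  then show "\<exists>a b. a < b \<and> (\<forall>n. measure (P n) {a<..b} > 1 - \<epsilon>)"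
    using b by (intro exI[of _ "-b"] exI[of _ b]) auto
qed

text \<open>The exponential is unbounded, so weak convergence is applied to its truncations
  \<open>min (exp (\<theta> * x)) m\<close>, which are bounded and continuous. Fatou's lemma then
  removes the truncation.\<close>

lemma exp_moment_weak_limit:
  assumes P: "\<And>n. real_distribution (P n)" "real_distribution M" "weak_conv_m P M"
    and K: "\<And>n. (\<integral>\<^sup>+x. ennreal (exp (\<theta> * x)) \<partial>P n) \<le> ennreal K" "0 \<le> K"
  shows "(\<integral>\<^sup>+x. ennreal (exp (\<theta> * x)) \<partial>M) \<le> ennreal K"
proof -
  interpret M: real_distribution M by fact
  define h where "h m x = min (exp (\<theta> * x)) (real m)" for m x
  have [measurable]: "h m \<in> borel_measurable borel" for m unfolding h_def by measurable
  have hb: "norm (h m x) \<le> real m" "0 \<le> h m x" for m x by (auto simp: h_def)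
  have hm: "(\<integral>\<^sup>+x. ennreal (h m x) \<partial>M) \<le> ennreal K" for m
  proof -
    have lim: "(\<lambda>n. LINT x|P n. h m x) \<longlonglongrightarrow> (LINT x|M. h m x)"
      by (rule weak_conv_imp_integral_bdd_continuous_conv[OF P(1,2,3), where B = "real m"])
        (auto simp: h_def[abs_def] intro!: continuous_intros hb(1)[unfolded h_def])
    have "(LINT x|P n. h m x) \<le> K" for n
    proof (rule integral_real_bounded[OF K(2)])
      have "(\<integral>\<^sup>+x. ennreal (h m x) \<partial>P n) \<le> (\<integral>\<^sup>+x. ennreal (exp (\<theta> * x)) \<partial>P n)"
        by (intro nn_integral_mono ennreal_leI) (auto simp: h_def)
      then show "(\<integral>\<^sup>+x. ennreal (h m x) \<partial>P n) \<le> ennreal K" using K(1) by (rule order_trans)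
    qed
    then have "(LINT x|M. h m x) \<le> K" using lim by (intro LIMSEQ_le_const2) auto
    moreover have "integrable M (h m)" by (rule M.integrable_const_bound[of _ "real m"]) (use hb in auto)
    ultimately show ?thesis by (simp add: nn_integral_eq_integral hb ennreal_leI)
  qed
  have "(\<integral>\<^sup>+x. ennreal (exp (\<theta> * x)) \<partial>M) = (\<integral>\<^sup>+x. liminf (\<lambda>m. ennreal (h m x)) \<partial>M)"
  proof (intro nn_integral_cong)
    fix x :: real
    have "\<forall>\<^sub>F m in sequentially. h m x = exp (\<theta> * x)"
      using eventually_ge_at_top[of "nat \<lceil>exp (\<theta> * x)\<rceil>"]
    proof eventually_elim
      case (elim m)
      then have "exp (\<theta> * x) \<le> real m" by linarith
      then show ?case by (simp add: h_def)
    qed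
    then have "(\<lambda>m. ennreal (h m x)) \<longlonglongrightarrow> ennreal (exp (\<theta> * x))"
      by (intro tendsto_eventually) (auto elim: eventually_mono)
    then show "ennreal (exp (\<theta> * x)) = liminf (\<lambda>m. ennreal (h m x))"
      by (intro lim_imp_Liminf[symmetric]) auto
  qed
  also have "\<dots> \<le> liminf (\<lambda>m. \<integral>\<^sup>+x. ennreal (h m x) \<partial>M)"
    by (rule nn_integral_liminf) measurable
  also have "\<dots> \<le> ennreal K"
    by (rule Liminf_le) (use hm in auto)
  finally show ?thesis .
qed

section \<open>Splitting off the large jumps\<close>

lemma cmod_iexp_minus_linear_le: "cmod (iexp y - 1 - \<i> * of_real y) \<le> y\<^sup>2"
proof -
  have "cmod (iexp y - 1 - \<i> * of_real y) \<le> y\<^sup>2 / 2"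
    using iexp_approx1[of y 1] by (simp add: numeral_2_eq_2 algebra_simps power2_eq_square)
  also have "\<dots> \<le> y\<^sup>2" by simp
  finally show ?thesis .
qed

text \<open>Small jumps may have infinite intensity. Away from 0 the integrability of
  \<open>w x * x\<^sup>2\<close> makes the intensity finite, so the jumps larger than
  \<open>1 / (n + 1)\<close> form a compensated compound Poisson law. Exponential moments bounded
  uniformly in \<open>n\<close> give both tightness and the moments of the limit.\<close>

lemma small_jumps_exists:
  fixes w :: "real \<Rightarrow> real"
  assumes v: "v \<ge> 0" and [measurable]: "w \<in> borel_measurable borel" and w0: "\<And>x. 0 \<le> w x"
    and supp: "\<And>x. \<bar>x\<bar> > 1 \<Longrightarrow> w x = 0" and int2: "integrable lborel (\<lambda>x. w x * x\<^sup>2)"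
  obtains Q where "real_distribution Q"
    "\<And>t. char Q t = exp (\<i> * of_real (c * t) - of_real (v * t\<^sup>2 / 2)
        + (CLINT x|lborel. w x * (iexp (t * x) - 1 - \<i> * of_real (t * x))))"
    "\<And>\<theta>. (\<integral>\<^sup>+x. ennreal (exp (\<theta> * x)) \<partial>Q) < \<infinity>"
proof -
  define wn where "wn n x = w x * indicator {x. 1 / real (Suc n) < \<bar>x\<bar>} x" for n x
  have [measurable]: "wn n \<in> borel_measurable borel" for n unfolding wn_def[abs_def] by measurable
  have wn0: "0 \<le> wn n x" for n x by (simp add: wn_def w0)
  have wn_le: "wn n x \<le> w x" for n x by (simp add: wn_def w0 split: split_indicator)
  have wn_supp: "wn n x = 0" if "\<bar>x\<bar> > 1" for n x using supp[OF that] by (simp add: wn_def)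
  have wn_int: "integrable lborel (wn n)" for n
  proof (rule Bochner_Integration.integrable_bound)
    show "integrable lborel (\<lambda>x. (real (Suc n))\<^sup>2 * (w x * x\<^sup>2))" using int2 by simp
    have "wn n x \<le> (real (Suc n))\<^sup>2 * (w x * x\<^sup>2)" for x
    proof (cases "1 / real (Suc n) < \<bar>x\<bar>")
      case True
      then have "1 \<le> real (Suc n) * \<bar>x\<bar>" by (simp add: field_simps)
      then have "1 \<le> (real (Suc n) * \<bar>x\<bar>)\<^sup>2" by (rule one_le_power)
      then have "w x * 1 \<le> w x * ((real (Suc n))\<^sup>2 * x\<^sup>2)" 
        by (intro mult_left_mono w0) (simp add: power_mult_distrib)
      then show ?thesis using True by (simp add: wn_def mult_ac)
    next
      case False
      then show ?thesis using w0[of x] by (simp add: wn_def)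
    qed
    then show "AE x in lborel. norm (wn n x) \<le> norm ((real (Suc n))\<^sup>2 * (w x * x\<^sup>2))"
      using wn0 w0 by (intro AE_I2) (simp add: abs_mult)
  qed simp
  have wnx_int: "integrable lborel (\<lambda>x. wn n x * x)" for n
  proof (rule Bochner_Integration.integrable_bound[OF wn_int[of n]])
    have "\<bar>wn n x * x\<bar> \<le> \<bar>wn n x\<bar>" for x
      using wn_supp[of x n] by (cases "\<bar>x\<bar> > 1") (auto simp: abs_mult intro: mult_left_le)
    then show "AE x in lborel. norm (wn n x * x) \<le> norm (wn n x)" by simp
  qed simp
  have wne_int: "integrable lborel (\<lambda>x. wn n x * exp (\<theta> * x))" for n \<theta>
  proof (rule Bochner_Integration.integrable_bound)
    show "integrable lborel (\<lambda>x. wn n x * exp \<bar>\<theta>\<bar>)" using wn_int by simp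
    have "wn n x * exp (\<theta> * x) \<le> wn n x * exp \<bar>\<theta>\<bar>" for x
    proof (cases "\<bar>x\<bar> > 1")
      case False
      then have "\<bar>\<theta> * x\<bar> \<le> \<bar>\<theta>\<bar>" by (simp add: abs_mult mult_left_le)
      then have "\<theta> * x \<le> \<bar>\<theta>\<bar>" by linarith
      then show ?thesis by (intro mult_left_mono wn0) simp
    qed (simp add: wn_supp)
    then show "AE x in lborel. norm (wn n x * exp (\<theta> * x)) \<le> norm (wn n x * exp \<bar>\<theta>\<bar>)"
      using wn0 by (intro AE_I2) (simp add: abs_mult)
  qed simp
  \<comment> \<open>The compensator is moved into the drift of the Gaussian factor. The drift alone
    may diverge with \<open>n\<close>; only its combination with the jumps converges.\<close>
  define b where "b n = c - (LINT x|lborel. wn n x * x)" for n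
  have "\<exists>P. real_distribution P \<and>
      (\<forall>t. char P t = exp (\<i> * of_real (c * t) - of_real (v * t\<^sup>2 / 2)
        + (CLINT x|lborel. wn n x * (iexp (t * x) - 1 - \<i> * of_real (t * x))))) \<and>
      (\<forall>\<theta>. (\<integral>\<^sup>+x. ennreal (exp (\<theta> * x)) \<partial>P) = ennreal (exp (c * \<theta> + v * \<theta>\<^sup>2 / 2 +
         (LINT x|lborel. wn n x * (exp (\<theta> * x) - 1 - \<theta> * x)))))" for n
  proof -
    obtain G where G: "real_distribution G"
      "\<And>t. char G t = exp (\<i> * of_real (b n * t) - of_real (v * t\<^sup>2 / 2))"
      "\<And>\<theta>. (\<integral>\<^sup>+x. ennreal (exp (\<theta> * x)) \<partial>G) = ennreal (exp (b n * \<theta> + v * \<theta>\<^sup>2 / 2))"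
      using gaussian_exists[OF v] by blast
    obtain P where P: "real_distribution P"
      "\<And>f. f \<in> borel_measurable borel \<Longrightarrow> (\<integral>\<^sup>+x. f x \<partial>P) =
         (\<Sum>k. ennreal (exp (- (LINT x|lborel. wn n x)) / fact k) *
           (\<integral>\<^sup>+x. f x \<partial>conv_iter G (density lborel (\<lambda>x. ennreal (wn n x))) k))"
      "\<And>t. char P t = char G t * exp (CLINT x|lborel. wn n x * (iexp (t * x) - 1))"
      by (rule compound_poisson_exists[OF G(1) wn_int[of n] wn0[of n]]) blast
    have "char P t = exp (\<i> * of_real (c * t) - of_real (v * t\<^sup>2 / 2)
        + (CLINT x|lborel. wn n x * (iexp (t * x) - 1 - \<i> * of_real (t * x))))" for t
    proof -
      have i1: "integrable lborel (\<lambda>x. wn n x * (iexp (t * x) - 1))"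
      proof (rule Bochner_Integration.integrable_bound)
        show "integrable lborel (\<lambda>x. wn n x * 2)" using wn_int by simp
        have "cmod (iexp (t * x) - 1) \<le> 2" for x
          using norm_triangle_ineq4[of "iexp (t * x)" 1] by simp
        then show "AE x in lborel. cmod (wn n x * (iexp (t * x) - 1)) \<le> norm (wn n x * 2)"
          using wn0 by (auto simp: norm_mult intro!: mult_left_mono)
      qed simp
      have i2: "integrable lborel (\<lambda>x. (\<i> * of_real t) * complex_of_real (wn n x * x))"
        using wnx_int[of n] by (intro integrable_mult_right) (simp only: complex_of_real_integrable_eq)
      have "(CLINT x|lborel. wn n x * (iexp (t * x) - 1 - \<i> * of_real (t * x))) =
          (CLINT x|lborel. wn n x * (iexp (t * x) - 1) - (\<i> * of_real t) * complex_of_real (wn n x * x))"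
        by (intro Bochner_Integration.integral_cong) (auto simp: algebra_simps)
      also have "\<dots> = (CLINT x|lborel. wn n x * (iexp (t * x) - 1)) - (\<i> * of_real t) * of_real (LINT x|lborel. wn n x * x)"
        using i1 i2 by (subst Bochner_Integration.integral_diff)
          (simp_all only: integral_mult_right_zero integral_complex_of_real)
      finally have "(CLINT x|lborel. wn n x * (iexp (t * x) - 1)) = 
         (CLINT x|lborel. wn n x * (iexp (t * x) - 1 - \<i> * of_real (t * x))) + (\<i> * of_real t) * of_real (LINT x|lborel. wn n x * x)"
        by simp
      then show ?thesis
        unfolding P(3) G(2) exp_add[symmetric] b_def by (simp add: algebra_simps)
    qed
    moreover have "(\<integral>\<^sup>+x. ennreal (exp (\<theta> * x)) \<partial>P) = ennreal (exp (c * \<theta> + v * \<theta>\<^sup>2 / 2 +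
         (LINT x|lborel. wn n x * (exp (\<theta> * x) - 1 - \<theta> * x))))" for \<theta>
    proof -
      have "(LINT x|lborel. wn n x * (exp (\<theta> * x) - 1 - \<theta> * x)) =
          (LINT x|lborel. (wn n x * exp (\<theta> * x) - wn n x) - \<theta> * (wn n x * x))"
        by (simp add: algebra_simps)
      also have "\<dots> = (LINT x|lborel. wn n x * exp (\<theta> * x) - wn n x) - \<theta> * (LINT x|lborel. wn n x * x)"
        using wne_int wn_int wnx_int by simp
      finally have *: "(LINT x|lborel. wn n x * (exp (\<theta> * x) - 1)) =
         (LINT x|lborel. wn n x * (exp (\<theta> * x) - 1 - \<theta> * x)) + \<theta> * (LINT x|lborel. wn n x * x)"
        by (simp add: right_diff_distrib)
      have "ennreal (exp ((c - L) * \<theta> + V)) * ennreal (exp (J + \<theta> * L)) = ennreal (exp (c * \<theta> + V + J))"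
        for J L V by (simp add: ennreal_mult'[symmetric] exp_add[symmetric] algebra_simps)
      moreover have "(\<integral>\<^sup>+x. ennreal (exp (\<theta> * x)) \<partial>P) = (\<integral>\<^sup>+x. ennreal (exp (\<theta> * x)) \<partial>G) *
          ennreal (exp (LINT x|lborel. wn n x * (exp (\<theta> * x) - 1)))"
        by (rule nn_integral_exp_compound_poisson[OF G(1) wn_int wn0 _ wne_int]) (rule P(2))
      ultimately show ?thesis unfolding G(3) * b_def by simp
    qed
    ultimately show ?thesis using P(1) by blast
  qed
  then obtain P where P: "\<And>n. real_distribution (P n)"
      "\<And>n t. char (P n) t = exp (\<i> * of_real (c * t) - of_real (v * t\<^sup>2 / 2)
        + (CLINT x|lborel. wn n x * (iexp (t * x) - 1 - \<i> * of_real (t * x))))"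
      "\<And>n \<theta>. (\<integral>\<^sup>+x. ennreal (exp (\<theta> * x)) \<partial>P n) = ennreal (exp (c * \<theta> + v * \<theta>\<^sup>2 / 2 +
         (LINT x|lborel. wn n x * (exp (\<theta> * x) - 1 - \<theta> * x))))"
    by metis
  \<comment> \<open>Independent of \<open>n\<close>: the quadratic bound for
    \<open>exp y - 1 - y\<close> is used at \<open>y = \<theta> * x\<close>, where
    \<open>\<bar>y\<bar>\<close> is at most \<open>\<bar>\<theta>\<bar>\<close> because the jumps
    are at most 1.\<close>
  define K where "K \<theta> = exp (c * \<theta> + v * \<theta>\<^sup>2 / 2 + \<theta>\<^sup>2 * exp \<bar>\<theta>\<bar> * (LINT x|lborel. w x * x\<^sup>2))" for \<theta>
  have PK: "(\<integral>\<^sup>+x. ennreal (exp (\<theta> * x)) \<partial>P n) \<le> ennreal (K \<theta>)" for n \<theta>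
  proof -
    have "(LINT x|lborel. wn n x * (exp (\<theta> * x) - 1 - \<theta> * x)) \<le>
        (LINT x|lborel. \<theta>\<^sup>2 * exp \<bar>\<theta>\<bar> * (w x * x\<^sup>2))"
    proof (rule integral_mono)
      have "(\<lambda>x. wn n x * (exp (\<theta> * x) - 1 - \<theta> * x)) = (\<lambda>x. (wn n x * exp (\<theta> * x) - wn n x) - \<theta> * (wn n x * x))"
        by (simp add: algebra_simps)
      then show "integrable lborel (\<lambda>x. wn n x * (exp (\<theta> * x) - 1 - \<theta> * x))"
        using wne_int wn_int wnx_int by simp
      show "wn n x * (exp (\<theta> * x) - 1 - \<theta> * x) \<le> \<theta>\<^sup>2 * exp \<bar>\<theta>\<bar> * (w x * x\<^sup>2)" for x
      proof (cases "\<bar>x\<bar> > 1")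
        case True
        then show ?thesis using w0[of x] by (simp add: wn_supp)
      next
        case False
        then have "\<bar>\<theta> * x\<bar> \<le> \<bar>\<theta>\<bar>" by (simp add: abs_mult mult_left_le)
        then have "(\<theta> * x)\<^sup>2 * exp \<bar>\<theta> * x\<bar> \<le> (\<theta> * x)\<^sup>2 * exp \<bar>\<theta>\<bar>" by (intro mult_left_mono) auto
        then have "exp (\<theta> * x) - 1 - \<theta> * x \<le> (\<theta> * x)\<^sup>2 * exp \<bar>\<theta>\<bar>"
          using exp_minus_one_minus_le[of "\<theta> * x"] by linarith
        moreover have "0 \<le> exp (\<theta> * x) - 1 - \<theta> * x" using exp_ge_add_one_self[of "\<theta> * x"] by linarith
        ultimately have "wn n x * (exp (\<theta> * x) - 1 - \<theta> * x) \<le> w x * ((\<theta> * x)\<^sup>2 * exp \<bar>\<theta>\<bar>)"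
          by (intro mult_mono wn_le w0)
        then show ?thesis by (simp add: power_mult_distrib mult_ac)
      qed
    qed (use int2 in simp)
    then show ?thesis unfolding P(3) K_def by (intro ennreal_leI) simp
  qed
  have "tight P"
  proof (rule tight_of_exp_moments[OF P(1), where K = "K 1 + K (-1)"])
    fix n
    interpret real_distribution "P n" by (rule P)
    have "(\<integral>\<^sup>+x. ennreal (exp x + exp (- x)) \<partial>P n) =
        (\<integral>\<^sup>+x. ennreal (exp (1 * x)) \<partial>P n) + (\<integral>\<^sup>+x. ennreal (exp ((-1) * x)) \<partial>P n)"
      by (subst nn_integral_add[symmetric]) auto
    also have "\<dots> \<le> ennreal (K 1) + ennreal (K (-1))" by (intro add_mono PK)
    also have "\<dots> = ennreal (K 1 + K (-1))" by (simp add: K_def)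
    finally show "(\<integral>\<^sup>+x. ennreal (exp x + exp (- x)) \<partial>P n) \<le> ennreal (K 1 + K (-1))" .
  qed (simp add: K_def add_nonneg_nonneg)
  \<comment> \<open>A convergent subsequence suffices, since the characteristic functions converge
    along the whole sequence and determine the one of \<open>Q\<close>.\<close>
  then obtain r Q where r: "strict_mono (r :: nat \<Rightarrow> nat)" and Q: "real_distribution Q" "weak_conv_m (P \<circ> id \<circ> r) Q"
    using tight_imp_convergent_subsubsequence[of P id] strict_mono_id by blast
  have Q2: "weak_conv_m (\<lambda>n. P (r n)) Q" using Q(2) by (simp add: comp_def)
  have charQ: "char Q t = exp (\<i> * of_real (c * t) - of_real (v * t\<^sup>2 / 2)
        + (CLINT x|lborel. w x * (iexp (t * x) - 1 - \<i> * of_real (t * x))))" for t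
  proof -
    have "(\<lambda>n. CLINT x|lborel. wn n x * (iexp (t * x) - 1 - \<i> * of_real (t * x))) \<longlonglongrightarrow>
       (CLINT x|lborel. w x * (iexp (t * x) - 1 - \<i> * of_real (t * x)))"
    proof (rule integral_dominated_convergence[where w="\<lambda>x. t\<^sup>2 * (w x * x\<^sup>2)"])
      show "AE x in lborel. (\<lambda>n. wn n x * (iexp (t * x) - 1 - \<i> * of_real (t * x))) \<longlonglongrightarrow>
          w x * (iexp (t * x) - 1 - \<i> * of_real (t * x))"
      proof (intro AE_I2)
        fix x :: real
        show "(\<lambda>n. wn n x * (iexp (t * x) - 1 - \<i> * of_real (t * x))) \<longlonglongrightarrow>
          w x * (iexp (t * x) - 1 - \<i> * of_real (t * x))"
        \<comment> \<open>At \<open>x = 0\<close> the cutoff never opens, but there the other factor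
          of the integrand is 0.\<close>
        proof (cases "x = 0")
          case False
          have "(\<lambda>n. 1 / real (Suc n)) \<longlonglongrightarrow> 0" using LIMSEQ_inverse_real_of_nat by (simp add: inverse_eq_divide)
          then have "\<forall>\<^sub>F n in sequentially. 1 / real (Suc n) < \<bar>x\<bar>"
            using False by (intro order_tendstoD) auto
          then have "\<forall>\<^sub>F n in sequentially. wn n x = w x"
            by eventually_elim (simp add: wn_def)
          then show ?thesis by (intro tendsto_eventually) (auto elim: eventually_mono)
        qed simp
      qed
      show "AE x in lborel. cmod (wn n x * (iexp (t * x) - 1 - \<i> * of_real (t * x))) \<le> t\<^sup>2 * (w x * x\<^sup>2)" for n
      proof (intro AE_I2)
        fix x :: real
        have "cmod (wn n x * (iexp (t * x) - 1 - \<i> * of_real (t * x))) = wn n x * cmod (iexp (t * x) - 1 - \<i> * of_real (t * x))"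
          using wn0 by (simp add: norm_mult)
        also have "\<dots> \<le> w x * (t * x)\<^sup>2"
          using cmod_iexp_minus_linear_le[of "t * x"] by (intro mult_mono wn_le w0) auto
        finally show "cmod (wn n x * (iexp (t * x) - 1 - \<i> * of_real (t * x))) \<le> t\<^sup>2 * (w x * x\<^sup>2)"
          by (simp add: power_mult_distrib mult_ac)
      qed
    qed (use int2 in auto)
    then have "(\<lambda>n. char (P n) t) \<longlonglongrightarrow> exp (\<i> * of_real (c * t) - of_real (v * t\<^sup>2 / 2)
        + (CLINT x|lborel. w x * (iexp (t * x) - 1 - \<i> * of_real (t * x))))"
      unfolding P(2) by (intro tendsto_intros)
    from LIMSEQ_subseq_LIMSEQ[OF this r] levy_continuity1[OF P(1) Q(1) Q2, of t]
    show ?thesis by (auto simp: comp_def intro: LIMSEQ_unique)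
  qed
  have "(\<integral>\<^sup>+x. ennreal (exp (\<theta> * x)) \<partial>Q) < \<infinity>" for \<theta>
    using exp_moment_weak_limit[OF P(1) Q(1) Q2 PK, of \<theta>] by (auto simp: K_def intro: order_le_less_trans)
  with Q(1) charQ show thesis by (rule that)
qed

text \<open>The jumps are cut at the very set used as truncation function, so the three parts of the
  exponent add up without a correction of the drift. \<open>Q\<close> receives the Gaussian part,
  the drift, the small jumps and the large negative jumps. The latter can only lower moments of
  nonnegative order but may destroy those of negative order, whence the restriction on
  \<theta>.\<close>

lemma levy_large_jump_decomposition:
  fixes w w1 :: "real \<Rightarrow> real"
  assumes mu: "real_distribution \<mu>" and v: "v \<ge> 0"
    and [measurable]: "w \<in> borel_measurable borel" and w0: "\<And>x. 0 \<le> w x"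
    and int: "integrable lborel (\<lambda>x. w x * min 1 (x\<^sup>2))"
    and char: "\<And>t. char \<mu> t = exp (\<i> * of_real (c * t) - of_real (v * t\<^sup>2 / 2)
        + (CLINT x|lborel. w x * (iexp (t * x) - 1 - \<i> * of_real (t * x * indicator {-1..1} x))))"
    and w1_def: "\<And>x. w1 x = w x * indicator {1<..} x"
  obtains Q where "real_distribution Q" "integrable lborel w1"
    "\<And>\<theta>. \<theta> \<ge> 0 \<Longrightarrow> (\<integral>\<^sup>+x. ennreal (exp (\<theta> * x)) \<partial>Q) < \<infinity>"
    "\<And>f. f \<in> borel_measurable borel \<Longrightarrow> (\<integral>\<^sup>+x. f x \<partial>\<mu>) =
       (\<Sum>n. ennreal (exp (- (LINT x|lborel. w1 x)) / fact n) *
         (\<integral>\<^sup>+x. f x \<partial>conv_iter Q (density lborel (\<lambda>x. ennreal (w1 x))) n))"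
proof -
  define w2 where "w2 x = w x * indicator {..<-1} x" for x
  define w3 where "w3 x = w x * indicator {-1..1} x" for x
  have [measurable]: "w1 \<in> borel_measurable borel" "w2 \<in> borel_measurable borel" "w3 \<in> borel_measurable borel"
    unfolding w1_def[abs_def] w2_def[abs_def] w3_def[abs_def] by measurable
  have nn: "0 \<le> w1 x" "0 \<le> w2 x" "0 \<le> w3 x" for x
    using w0 by (auto simp: w1_def w2_def w3_def)
  have large: "1 < x\<^sup>2" if "\<bar>x\<bar> > 1" for x :: real
    using power_strict_mono[of 1 "\<bar>x\<bar>" 2] that by simp
  have small: "x\<^sup>2 \<le> 1" if "\<bar>x\<bar> \<le> 1" for x :: real
    using power_mono[of "\<bar>x\<bar>" 1 2] that by simp
  have w1: "integrable lborel w1"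
    by (rule Bochner_Integration.integrable_bound[OF int])
      (use w0 large in \<open>auto simp: w1_def abs_mult less_imp_le split: split_indicator\<close>)
  have w2: "integrable lborel w2"
    by (rule Bochner_Integration.integrable_bound[OF int])
      (use w0 large in \<open>auto simp: w2_def abs_mult less_imp_le split: split_indicator\<close>)
  have w3: "integrable lborel (\<lambda>x. w3 x * x\<^sup>2)"
    by (rule Bochner_Integration.integrable_bound[OF int])
      (use w0 small in \<open>auto simp: w3_def abs_mult split: split_indicator\<close>)
  obtain Q3 where Q3: "real_distribution Q3"
    "\<And>t. char Q3 t = exp (\<i> * of_real (c * t) - of_real (v * t\<^sup>2 / 2)
        + (CLINT x|lborel. w3 x * (iexp (t * x) - 1 - \<i> * of_real (t * x))))"
    "\<And>\<theta>. (\<integral>\<^sup>+x. ennreal (exp (\<theta> * x)) \<partial>Q3) < \<infinity>"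
    by (rule small_jumps_exists[OF v _ nn(3) _ w3]) (auto simp: w3_def indicator_def)
  obtain Q where Q: "real_distribution Q"
    "\<And>f. f \<in> borel_measurable borel \<Longrightarrow> (\<integral>\<^sup>+x. f x \<partial>Q) =
         (\<Sum>k. ennreal (exp (- (LINT x|lborel. w2 x)) / fact k) *
           (\<integral>\<^sup>+x. f x \<partial>conv_iter Q3 (density lborel (\<lambda>x. ennreal (w2 x))) k))"
    "\<And>t. char Q t = char Q3 t * exp (CLINT x|lborel. w2 x * (iexp (t * x) - 1))"
    by (rule compound_poisson_exists[OF Q3(1) w2 nn(2)]) blast
  obtain P where P: "real_distribution P"
    "\<And>f. f \<in> borel_measurable borel \<Longrightarrow> (\<integral>\<^sup>+x. f x \<partial>P) =
         (\<Sum>k. ennreal (exp (- (LINT x|lborel. w1 x)) / fact k) *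
           (\<integral>\<^sup>+x. f x \<partial>conv_iter Q (density lborel (\<lambda>x. ennreal (w1 x))) k))"
    "\<And>t. char P t = char Q t * exp (CLINT x|lborel. w1 x * (iexp (t * x) - 1))"
    by (rule compound_poisson_exists[OF Q(1) w1 nn(1)]) blast
  have "char P t = char \<mu> t" for t
  proof -
    have bd: "cmod (iexp (t * x) - 1) \<le> 2" for x
      using norm_triangle_ineq4[of "iexp (t * x)" 1] by simp
    have i1: "integrable lborel (\<lambda>x. w1 x * (iexp (t * x) - 1))"
    proof (rule Bochner_Integration.integrable_bound)
      show "integrable lborel (\<lambda>x. w1 x * 2)" using w1 by simp
      show "AE x in lborel. cmod (w1 x * (iexp (t * x) - 1)) \<le> norm (w1 x * 2)"
        using nn bd by (auto simp: norm_mult intro!: mult_left_mono)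
    qed simp
    have i2: "integrable lborel (\<lambda>x. w2 x * (iexp (t * x) - 1))"
    proof (rule Bochner_Integration.integrable_bound)
      show "integrable lborel (\<lambda>x. w2 x * 2)" using w2 by simp
      show "AE x in lborel. cmod (w2 x * (iexp (t * x) - 1)) \<le> norm (w2 x * 2)"
        using nn bd by (auto simp: norm_mult intro!: mult_left_mono)
    qed simp
    have i3: "integrable lborel (\<lambda>x. w3 x * (iexp (t * x) - 1 - \<i> * of_real (t * x)))"
    proof (rule Bochner_Integration.integrable_bound)
      show "integrable lborel (\<lambda>x. t\<^sup>2 * (w3 x * x\<^sup>2))" using w3 by simp
      have "cmod (w3 x * (iexp (t * x) - 1 - \<i> * of_real (t * x))) \<le> w3 x * (t * x)\<^sup>2" for x
        using cmod_iexp_minus_linear_le[of "t * x"] nn(3)[of x] by (simp add: norm_mult mult_left_mono)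
      then show "AE x in lborel. cmod (w3 x * (iexp (t * x) - 1 - \<i> * of_real (t * x))) \<le> norm (t\<^sup>2 * (w3 x * x\<^sup>2))"
        using nn by (simp add: abs_mult power_mult_distrib mult_ac)
    qed simp
    have "(CLINT x|lborel. w x * (iexp (t * x) - 1 - \<i> * of_real (t * x * indicator {-1..1} x))) =
      (CLINT x|lborel. w3 x * (iexp (t * x) - 1 - \<i> * of_real (t * x)) + w2 x * (iexp (t * x) - 1)
        + w1 x * (iexp (t * x) - 1))"
      by (intro Bochner_Integration.integral_cong)
        (auto simp: w1_def w2_def w3_def split: split_indicator)
    also have "\<dots> = (CLINT x|lborel. w3 x * (iexp (t * x) - 1 - \<i> * of_real (t * x))) +
        (CLINT x|lborel. w2 x * (iexp (t * x) - 1)) + (CLINT x|lborel. w1 x * (iexp (t * x) - 1))"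
      using i1 i2 i3 by (simp only: Bochner_Integration.integral_add Bochner_Integration.integrable_add)
    finally show ?thesis unfolding char P(3) Q(3) Q3(2) by (simp only: exp_add[symmetric] add.assoc)
  qed
  \<comment> \<open>Uniqueness of characteristic functions turns the constructed mixture into a
    representation of the given law.\<close>
  then have "P = \<mu>" using Levy_uniqueness[OF P(1) mu] by auto
  moreover have "(\<integral>\<^sup>+x. ennreal (exp (\<theta> * x)) \<partial>Q) < \<infinity>" if "\<theta> \<ge> 0" for \<theta>
  proof -
    have "integrable lborel (\<lambda>x. w2 x * exp (\<theta> * x))"
    proof (rule Bochner_Integration.integrable_bound[OF w2])
      have "w2 x * exp (\<theta> * x) \<le> w2 x" for x
        using that nn(2)[of x] by (cases "x < -1")
          (auto simp: w2_def intro!: mult_left_le mult_nonneg_nonpos w0)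
      then show "AE x in lborel. norm (w2 x * exp (\<theta> * x)) \<le> norm (w2 x)"
        using nn(2) by (simp add: abs_mult)
    qed simp
    then have "(\<integral>\<^sup>+x. ennreal (exp (\<theta> * x)) \<partial>Q) = (\<integral>\<^sup>+x. ennreal (exp (\<theta> * x)) \<partial>Q3) *
        ennreal (exp (LINT x|lborel. w2 x * (exp (\<theta> * x) - 1)))"
      by (rule nn_integral_exp_compound_poisson[OF Q3(1) w2 nn(2), rotated]) (rule Q(2))
    with Q3(3)[of \<theta>] show ?thesis by (simp add: ennreal_mult_less_top)
  qed
  ultimately show thesis using that[OF Q(1) w1] P(2) by blast
qed

section \<open>Laplace transforms with left edge zero\<close>

text \<open>Models the measure \<open>\<tau>p\<close> translated by its left edge. An atom at 0 is
  allowed, as the edge may itself be an atom; hence only the open negative half-line is required to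
  be null. The total mass may be infinite, and finiteness is demanded only of the Laplace
  transform.\<close>

locale thorin_transform =
  fixes T :: "real measure"
  assumes sets_T [simp, measurable_cong]: "sets T = sets borel"
    and neg_null: "emeasure T {..<0} = 0"
    and edge: "\<And>s. s > 0 \<Longrightarrow> emeasure T {..s} > 0"
    and fin: "\<And>x. x > 0 \<Longrightarrow> (\<integral>\<^sup>+s. ennreal (exp (- (s * x))) \<partial>T) < \<infinity>"
begin

definition L :: "real \<Rightarrow> real" where "L x = (LINT s|T. exp (- (s * x)))"

lemma space_T [simp]: "space T = UNIV"
  using sets_eq_imp_space_eq[OF sets_T] by simp

lemma AE_nonneg: "AE s in T. 0 \<le> s"
  by (rule AE_I[of _ _ "{..<0}"]) (auto simp: neg_null)

lemma integrable_L: "x > 0 \<Longrightarrow> integrable T (\<lambda>s. exp (- (s * x)))"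
  using fin[of x] by (simp add: integrable_iff_bounded)

lemma nn_integral_L: "x > 0 \<Longrightarrow> (\<integral>\<^sup>+s. ennreal (exp (- (s * x))) \<partial>T) = ennreal (L x)"
  unfolding L_def using integrable_L[of x] by (intro nn_integral_eq_integral) auto

lemma L_nonneg: "0 \<le> L x"
  unfolding L_def by simp

lemma emeasure_le_exp_L:
  assumes "s \<ge> 0" "x > 0"
  shows "ennreal (exp (- (s * x))) * emeasure T {..s} \<le> ennreal (L x)"
proof -
  have "ennreal (exp (- (s * x))) * emeasure T {..s} = (\<integral>\<^sup>+r. ennreal (exp (- (s * x))) * indicator {..s} r \<partial>T)"
    by (simp add: nn_integral_cmult_indicator)
  also have "\<dots> \<le> (\<integral>\<^sup>+r. ennreal (exp (- (r * x))) \<partial>T)"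
    using assms by (intro nn_integral_mono) (auto split: split_indicator intro!: ennreal_leI)
  also have "\<dots> = ennreal (L x)" using assms by (simp add: nn_integral_L)
  finally show ?thesis .
qed

lemma emeasure_T_finite: "emeasure T {..s} < \<infinity>"
proof -
  have "ennreal (exp (- (max s 0 * 1))) * emeasure T {..max s 0} < \<infinity>"
    using emeasure_le_exp_L[of "max s 0" 1] by (auto intro: order_le_less_trans)
  then have "emeasure T {..max s 0} < \<infinity>" by (auto simp: ennreal_mult_less_top)
  moreover have "emeasure T {..s} \<le> emeasure T {..max s 0}" by (intro emeasure_mono) auto
  ultimately show ?thesis by (rule order_le_less_trans[rotated])
qed

sublocale sigma_finite_measure T
proof
  show "\<exists>A. countable A \<and> A \<subseteq> sets T \<and> \<Union> A = space T \<and> (\<forall>a\<in>A. emeasure T a \<noteq> \<infinity>)"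
    using emeasure_T_finite by (intro exI[of _ "range (\<lambda>n. {..real n})"])
      (auto simp: less_top intro: real_arch_simple)
qed

lemma measure_T_pos: "s > 0 \<Longrightarrow> measure T {..s} > 0"
  using edge[of s] emeasure_T_finite[of s] by (simp add: measure_def enn2real_positive_iff)

lemma L_lower: "s \<ge> 0 \<Longrightarrow> x > 0 \<Longrightarrow> exp (- (s * x)) * measure T {..s} \<le> L x"
  using emeasure_le_exp_L[of s x] emeasure_T_finite[of s] L_nonneg[of x]
  by (subst (asm) emeasure_eq_ennreal_measure) (auto simp: ennreal_mult'[symmetric])

lemma L_pos: "x > 0 \<Longrightarrow> L x > 0"
  using L_lower[of 1 x] measure_T_pos[of 1] by (smt (verit) exp_gt_zero mult_pos_pos)

lemma L_antimono: "0 < x \<Longrightarrow> x \<le> y \<Longrightarrow> L y \<le> L x"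
  unfolding L_def
  by (intro integral_mono_AE integrable_L) (use AE_nonneg in \<open>auto elim!: eventually_mono intro: mult_left_mono\<close>)

lemma L_measurable [measurable]: "L \<in> borel_measurable borel"
  unfolding L_def[abs_def] by measurable

lemma exp_over_L: 
  assumes "\<epsilon> > 0"
  shows "((\<lambda>x. exp (- (\<epsilon> * x)) / L x) \<longlongrightarrow> 0) at_top"
proof (rule tendsto_sandwich)
  \<comment> \<open>Mass within \<open>\<epsilon> / 2\<close> of the edge bounds \<open>L x\<close>
    below by \<open>m * exp (- (\<epsilon> / 2 * x))\<close>; the other half of the exponent is the
    margin that tends to 0.\<close>
  define m where "m = measure T {..\<epsilon> / 2}"
  have m: "m > 0" using measure_T_pos assms by (simp add: m_def)
  show "\<forall>\<^sub>F x in at_top. 0 \<le> exp (- (\<epsilon> * x)) / L x"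
    using L_nonneg by simp
  show "\<forall>\<^sub>F x in at_top. exp (- (\<epsilon> * x)) / L x \<le> exp (- ((\<epsilon> / 2) * x)) / m"
    using eventually_gt_at_top[of 0]
  proof eventually_elim
    case (elim x)
    have "exp (- (\<epsilon> * x)) * m = exp (- ((\<epsilon> / 2) * x)) * (exp (- ((\<epsilon> / 2) * x)) * m)"
      by (simp add: mult.assoc[symmetric] exp_add[symmetric])
    also have "\<dots> \<le> exp (- ((\<epsilon> / 2) * x)) * L x"
      using L_lower[of "\<epsilon> / 2" x] elim assms by (intro mult_left_mono) (auto simp: m_def)
    finally show ?case using m L_pos[OF elim] by (simp add: field_simps)
  qed
  have "((\<lambda>x. exp (- ((\<epsilon> / 2) * x))) \<longlongrightarrow> 0) at_top"
    using assms by real_asymp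
  then show "((\<lambda>x. exp (- ((\<epsilon> / 2) * x)) / m) \<longlongrightarrow> 0) at_top"
    by (rule tendsto_divide_zero)
qed simp

text \<open>The spectral variable is cut at \<eta>. Below it the shift by \<open>y\<close> costs at
  most \<open>exp (\<eta> * y)\<close>; above it the integrand is exponentially small. There one
  unit of \<open>x\<close> is held back as \<open>exp (- s)\<close>, since the constant 1 need not
  be integrable.\<close>

lemma L_shift_le:
  assumes "\<eta> > 0" "y \<ge> 0" "x \<ge> y + 1"
  shows "L (x - y) \<le> exp (\<eta> * y) * L x + exp (- (\<eta> * (x - y - 1))) * L 1"
proof -
  have "L (x - y) \<le> (LINT s|T. exp (\<eta> * y) * exp (- (s * x)) + exp (- (\<eta> * (x - y - 1))) * exp (- (s * 1)))"
    unfolding L_def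
  proof (intro integral_mono_AE)
    show "AE s in T. exp (- (s * (x - y))) \<le>
        exp (\<eta> * y) * exp (- (s * x)) + exp (- (\<eta> * (x - y - 1))) * exp (- (s * 1))"
      using AE_nonneg
    proof eventually_elim
      case (elim s)
      show ?case
      proof (cases "s \<le> \<eta>")
        case True
        have "exp (- (s * (x - y))) = exp (s * y) * exp (- (s * x))"
          by (simp add: exp_add[symmetric] algebra_simps)
        also have "\<dots> \<le> exp (\<eta> * y) * exp (- (s * x))"
          using True assms by (intro mult_right_mono) (auto intro: mult_right_mono)
        finally show ?thesis by (simp add: add_increasing2)
      next
        case False
        have "exp (- (s * (x - y))) = exp (- (s * (x - y - 1))) * exp (- (s * 1))"
          by (simp add: exp_add[symmetric] algebra_simps)
        also have "\<dots> \<le> exp (- (\<eta> * (x - y - 1))) * exp (- (s * 1))"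
          using False assms by (intro mult_right_mono) (auto intro: mult_right_mono)
        finally show ?thesis by (simp add: add_increasing)
      qed
    qed
    show "integrable T (\<lambda>s. exp (- (s * (x - y))))" using assms by (intro integrable_L) auto
    show "integrable T (\<lambda>s. exp (\<eta> * y) * exp (- (s * x)) + exp (- (\<eta> * (x - y - 1))) * exp (- (s * 1)))"
      using assms by (intro Bochner_Integration.integrable_add integrable_mult_right integrable_L) auto
  qed
  also have "\<dots> = exp (\<eta> * y) * L x + exp (- (\<eta> * (x - y - 1))) * L 1"
    unfolding L_def using assms integrable_L[of x] integrable_L[of 1]
    by (subst Bochner_Integration.integral_add) auto
  finally show ?thesis .
qed

lemma L_long_tailed_nonneg:
  assumes y: "y \<ge> 0"
  shows "((\<lambda>x. L (x - y) / L x) \<longlongrightarrow> 1) at_top"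
proof (rule order_tendstoI)
  fix a :: real assume "a < 1"
  show "\<forall>\<^sub>F x in at_top. a < L (x - y) / L x"
    using eventually_gt_at_top[of y]
  proof eventually_elim
    case (elim x)
    then have "L x \<le> L (x - y)" using y by (intro L_antimono) auto
    then have "1 \<le> L (x - y) / L x" using L_pos[of x] elim y by simp
    then show ?case using \<open>a < 1\<close> by simp
  qed
next
  fix a :: real assume a: "1 < a"
  \<comment> \<open>Makes \<open>exp (\<eta> * y)\<close> at most \<open>(1 + a) / 2\<close>,
    leaving \<open>(a - 1) / 2\<close> for the exponentially small remainder. The denominator
    \<open>y + 1\<close> also admits \<open>y = 0\<close>.\<close>
  define \<eta> where "\<eta> = ln ((1 + a) / 2) / (y + 1)"
  have \<eta>: "\<eta> > 0" using a y by (simp add: \<eta>_def)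
  have "\<eta> * y \<le> \<eta> * (y + 1)" using \<eta> by simp
  also have "\<dots> = ln ((1 + a) / 2)" using y by (simp add: \<eta>_def)
  finally have "exp (\<eta> * y) \<le> exp (ln ((1 + a) / 2))" by simp
  also have "\<dots> = (1 + a) / 2" using a by simp
  finally have e: "exp (\<eta> * y) \<le> (1 + a) / 2" .
  have "((\<lambda>x. exp (\<eta> * (y + 1)) * L 1 * (exp (- (\<eta> * x)) / L x)) \<longlongrightarrow> exp (\<eta> * (y + 1)) * L 1 * 0) at_top"
    by (intro tendsto_mult tendsto_const exp_over_L \<eta>)
  then have "\<forall>\<^sub>F x in at_top. exp (\<eta> * (y + 1)) * L 1 * (exp (- (\<eta> * x)) / L x) < (a - 1) / 2"
    using a by (intro order_tendstoD) auto
  then show "\<forall>\<^sub>F x in at_top. L (x - y) / L x < a"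
    using eventually_ge_at_top[of "y + 1"]
  proof eventually_elim
    case (elim x)
    have Lx: "L x > 0" using elim y by (intro L_pos) auto
    have "L (x - y) / L x \<le> (exp (\<eta> * y) * L x + exp (- (\<eta> * (x - y - 1))) * L 1) / L x"
      using Lx L_shift_le[OF \<eta> y, of x] elim by (intro divide_right_mono) auto
    also have "\<dots> = exp (\<eta> * y) + exp (\<eta> * (y + 1)) * L 1 * (exp (- (\<eta> * x)) / L x)"
    proof -
      have "exp (- (\<eta> * (x - y - 1))) = exp (\<eta> * (y + 1)) * exp (- (\<eta> * x))"
        by (simp add: exp_add[symmetric] algebra_simps)
      then show ?thesis using Lx by (simp add: add_divide_distrib)
    qed
    also have "\<dots> < (1 + a) / 2 + (a - 1) / 2" using e elim(1) by (rule add_le_less_mono)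
    also have "\<dots> = a" by (simp add: field_simps)
    finally show ?case .
  qed
qed

lemma L_long_tailed: "((\<lambda>x. L (x - y) / L x) \<longlongrightarrow> 1) at_top"
proof (cases "y \<ge> 0")
  case False
  \<comment> \<open>For negative \<open>y\<close> the nonnegative case is used with shift
    \<open>- y\<close> at the point \<open>x - y\<close>, which gives the reciprocal
    quotient.\<close>
  have "filterlim (\<lambda>x. x - y) at_top at_top"
    using filterlim_tendsto_add_at_top[OF tendsto_const[of "-y"] filterlim_ident] by simp
  from filterlim_compose[OF L_long_tailed_nonneg[of "-y"] this] False
  have "((\<lambda>x. L x / L (x - y)) \<longlongrightarrow> 1) at_top" by simp
  from tendsto_inverse[OF this] show ?thesis by simp
qed (rule L_long_tailed_nonneg)

lemma nn_integral_exp_tail: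
  fixes s x :: real assumes "x > 0"
  shows "(\<integral>\<^sup>+u. ennreal (x * exp (- (u * x))) * indicator {s..} u \<partial>lborel) = ennreal (exp (- (s * x)))"
proof -
  have "(\<integral>\<^sup>+u. ennreal (x * exp (- (u * x))) * indicator {s..} u \<partial>lborel) = ennreal (0 - (- exp (- (s * x))))"
  proof (rule nn_integral_FTC_atLeast)
    show "DERIV (\<lambda>u. - exp (- (u * x))) u :> x * exp (- (u * x))" for u
      by (auto intro!: derivative_eq_intros)
    show "((\<lambda>u. - exp (- (u * x))) \<longlongrightarrow> 0) at_top"
      using assms by real_asymp
  qed (use assms in auto)
  then show ?thesis by simp
qed

text \<open>Fubini, after writing \<open>exp (- (s * x))\<close> as the integral of
  \<open>x * exp (- (u * x))\<close> over \<open>u\<close> from \<open>s\<close> on.\<close>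

lemma L_layer_cake:
  assumes x: "x > 0"
  shows "ennreal (L x) = (\<integral>\<^sup>+u. ennreal (x * exp (- (u * x))) * emeasure T {..u} \<partial>lborel)"
proof -
  interpret pair_sigma_finite T lborel ..
  have "ennreal (L x) = (\<integral>\<^sup>+s. (\<integral>\<^sup>+u. ennreal (x * exp (- (u * x))) * indicator {s..} u \<partial>lborel) \<partial>T)"
    using x by (simp only: nn_integral_exp_tail nn_integral_L)
  also have "\<dots> = (\<integral>\<^sup>+s. (\<integral>\<^sup>+u. ennreal (x * exp (- (u * x))) * indicator {p. fst p \<le> snd p} (s, u) \<partial>lborel) \<partial>T)"
    by (intro nn_integral_cong) (auto split: split_indicator)
  also have "\<dots> = (\<integral>\<^sup>+u. (\<integral>\<^sup>+s. ennreal (x * exp (- (u * x))) * indicator {p. fst p \<le> snd p} (s, u) \<partial>T) \<partial>lborel)"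
    by (rule Fubini'[symmetric]) measurable
  also have "\<dots> = (\<integral>\<^sup>+u. (\<integral>\<^sup>+s. ennreal (x * exp (- (u * x))) * indicator {..u} s \<partial>T) \<partial>lborel)"
    by (intro nn_integral_cong) (auto split: split_indicator)
  also have "\<dots> = (\<integral>\<^sup>+u. ennreal (x * exp (- (u * x))) * emeasure T {..u} \<partial>lborel)"
    by (intro nn_integral_cong) (simp add: nn_integral_cmult_indicator)
  finally show ?thesis .
qed

text \<open>
  By the layer-cake formula \<open>L (x / 2)\<close> is the integral of \<open>x * exp (- z * x)\<close> against \<open>T {..2 * z}\<close>,
  so doubling of the distribution function near \<open>0\<close> passes to \<open>L\<close> at infinity; regular variation
  is used only through this doubling.
\<close>

lemma L_doubling:
  assumes s0: "s0 > 0" and D: "D \<ge> 0" and doubling: "\<And>s. 0 < s \<Longrightarrow> s < s0 \<Longrightarrow> measure T {..2 * s} \<le> D * measure T {..s}"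
  obtains C where "C > 0" "\<And>x. x \<ge> 2 \<Longrightarrow> L (x / 2) \<le> C * L x"
proof -
  define V where "V u = emeasure T {..u}" for u
  have V [measurable]: "V \<in> borel_measurable borel"
  proof -
    have "(\<lambda>u. emeasure T (Pair u -` {p \<in> space (lborel \<Otimes>\<^sub>M T). snd p \<le> fst p})) \<in> borel_measurable lborel"
      by (rule measurable_emeasure_Pair) measurable
    also have "(\<lambda>u. emeasure T (Pair u -` {p \<in> space (lborel \<Otimes>\<^sub>M T). snd p \<le> fst p})) = V"
      by (auto simp: V_def space_pair_measure intro!: arg_cong[where f="emeasure T"])
    finally show ?thesis by simp
  qed
  have half: "ennreal (L (x / 2)) = (\<integral>\<^sup>+z. ennreal (x * exp (- (z * x))) * V (2 * z) \<partial>lborel)" if "x > 0" for x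
  proof -
    have [measurable]: "V \<in> borel_measurable borel" by (rule V)
    have "ennreal (L (x / 2)) = (\<integral>\<^sup>+u. ennreal (x / 2 * exp (- (u * (x / 2)))) * V u \<partial>lborel)"
      unfolding V_def using that by (intro L_layer_cake) simp
    also have "\<dots> = ennreal 2 * (\<integral>\<^sup>+z. ennreal (x / 2 * exp (- ((0 + 2 * z) * (x / 2)))) * V (0 + 2 * z) \<partial>lborel)"
      by (subst nn_integral_real_affine[of _ 2 0]) simp_all
    also have "\<dots> = (\<integral>\<^sup>+z. ennreal 2 * (ennreal (x / 2 * exp (- ((0 + 2 * z) * (x / 2)))) * V (0 + 2 * z)) \<partial>lborel)"
      by (rule nn_integral_cmult[symmetric]) measurable
    also have "\<dots> = (\<integral>\<^sup>+z. ennreal (x * exp (- (z * x))) * V (2 * z) \<partial>lborel)"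
    proof (intro nn_integral_cong)
      fix z :: real
      have "ennreal 2 * ennreal (x / 2 * exp (- ((0 + 2 * z) * (x / 2)))) = ennreal (x * exp (- (z * x)))"
        by (subst ennreal_mult'[symmetric]) auto
      then show "ennreal 2 * (ennreal (x / 2 * exp (- ((0 + 2 * z) * (x / 2)))) * V (0 + 2 * z)) =
          ennreal (x * exp (- (z * x))) * V (2 * z)"
        by (simp only: mult.assoc[symmetric] add_0)
    qed
    finally show ?thesis .
  qed
  have key: "L (x / 2) \<le> D * L x + x / 2 * exp (- (s0 * (x - 2))) * L 1" if x: "x \<ge> 2" for x
  proof -
    have "ennreal (L (x / 2)) = (\<integral>\<^sup>+z. ennreal (x * exp (- (z * x))) * V (2 * z) \<partial>lborel)"
      using x by (intro half) simp
    \<comment> \<open>Below \<open>s0\<close> doubling replaces \<open>V (2 * z)\<close> by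
      \<open>D * V z\<close>. Above it \<open>exp (- (z * 2))\<close> is kept in reserve, because
      against \<open>V (2 * z)\<close> it integrates to a multiple of \<open>L 1\<close>; the rest
      of the exponential is largest at \<open>s0\<close>. The point \<open>z = 0\<close>, where
      doubling says nothing, is a null set.\<close>
    also have "\<dots> \<le> (\<integral>\<^sup>+z. ennreal D * (ennreal (x * exp (- (z * x))) * V z) +
        ennreal (x / 2 * exp (- (s0 * (x - 2)))) * (ennreal (2 * exp (- (z * 2))) * V (2 * z)) \<partial>lborel)"
    proof (rule nn_integral_mono_AE, use AE_lborel_singleton[of 0] in \<open>rule eventually_mono\<close>)
      fix z :: real assume z: "z \<noteq> 0"
      show "ennreal (x * exp (- (z * x))) * V (2 * z) \<le> ennreal D * (ennreal (x * exp (- (z * x))) * V z) +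
        ennreal (x / 2 * exp (- (s0 * (x - 2)))) * (ennreal (2 * exp (- (z * 2))) * V (2 * z))"
      proof -
        consider "z < 0" | "z = 0" | "0 < z" "z < s0" | "s0 \<le> z" by linarith
        then show ?thesis
        proof cases
          case 1
          then have "V (2 * z) \<le> emeasure T {..<0}" unfolding V_def by (intro emeasure_mono) auto
          then have "V (2 * z) = 0" using neg_null by simp
          then show ?thesis by simp
        next
          case 2
          with z show ?thesis by simp
        next
          case 3
          have "V (2 * z) \<le> ennreal D * V z"
            unfolding V_def using doubling[of z] 3 emeasure_T_finite D
            by (simp add: emeasure_eq_ennreal_measure less_top ennreal_mult'[symmetric] ennreal_leI)
          then have "ennreal (x * exp (- (z * x))) * V (2 * z) \<le> ennreal (x * exp (- (z * x))) * (ennreal D * V z)"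
            by (rule mult_left_mono) simp
          then show ?thesis by (simp add: mult_ac add_increasing2)
        next
          case 4
          have "exp (- (z * x)) = exp (- (z * (x - 2))) * exp (- (z * 2))"
            by (simp add: exp_add[symmetric] algebra_simps)
          also have "\<dots> \<le> exp (- (s0 * (x - 2))) * exp (- (z * 2))"
            using 4 x by (intro mult_right_mono) (auto intro: mult_right_mono)
          finally have "x * exp (- (z * x)) \<le> x * (exp (- (s0 * (x - 2))) * exp (- (z * 2)))"
            using x by (intro mult_left_mono) auto
          then have "ennreal (x * exp (- (z * x))) \<le> ennreal (x / 2 * exp (- (s0 * (x - 2)))) * ennreal (2 * exp (- (z * 2)))"
            using x by (subst ennreal_mult'[symmetric]) (auto intro!: ennreal_leI simp: mult_ac)
          then have "ennreal (x * exp (- (z * x))) * V (2 * z) \<le>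
              ennreal (x / 2 * exp (- (s0 * (x - 2)))) * ennreal (2 * exp (- (z * 2))) * V (2 * z)"
            by (rule mult_right_mono) simp
          then show ?thesis by (simp add: mult.assoc add_increasing)
        qed
      qed
    qed
    also have "\<dots> = ennreal D * ennreal (L x) + ennreal (x / 2 * exp (- (s0 * (x - 2)))) * ennreal (L (2 / 2))"
    proof -
      have "ennreal (L x) = (\<integral>\<^sup>+z. ennreal (x * exp (- (z * x))) * V z \<partial>lborel)"
        unfolding V_def using x by (intro L_layer_cake) simp
      moreover have "ennreal (L (2 / 2)) = (\<integral>\<^sup>+z. ennreal (2 * exp (- (z * 2))) * V (2 * z) \<partial>lborel)"
        by (rule half) simp
      ultimately show ?thesis
        by (simp only:) (subst nn_integral_add, measurable, simp add: nn_integral_cmult)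
    qed
    also have "\<dots> = ennreal (D * L x + x / 2 * exp (- (s0 * (x - 2))) * L 1)"
      using x D L_nonneg by (simp add: ennreal_mult'[symmetric])
    finally show ?thesis using x D L_nonneg by (subst (asm) ennreal_le_iff) auto
  qed
  define m where "m = measure T {..s0 / 2}"
  have m: "m > 0" using measure_T_pos s0 by (simp add: m_def)
  \<comment> \<open>The remainder is absorbed by \<open>L x\<close>, which is at least
    \<open>m * exp (- (s0 / 2 * x))\<close>: the factor \<open>x / 2\<close> is paid for by
    \<open>exp (s0 * x / 2) / s0\<close>, and the exponents then leave \<open>exp (2 * s0)\<close>.
    The summand 1 makes \<open>C\<close> positive.\<close>
  define C where "C = D + 1 + exp (2 * s0) * L 1 / (s0 * m)"
  show thesis
  proof (rule that[of C])
    have "0 \<le> exp (2 * s0) * L 1 / (s0 * m)" using s0 m L_nonneg[of 1] by simp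
    then show "C > 0" unfolding C_def using D by linarith
    fix x :: real assume x: "x \<ge> 2"
    have Lx: "exp (- ((s0 / 2) * x)) * m \<le> L x" unfolding m_def using x s0 by (intro L_lower) auto
    have "s0 * x / 2 \<le> exp (s0 * x / 2)" using exp_ge_add_one_self[of "s0 * x / 2"] by linarith
    then have a: "x / 2 \<le> exp (s0 * x / 2) / s0" using s0 by (simp add: field_simps)
    have "x / 2 * exp (- (s0 * (x - 2))) \<le> exp (s0 * x / 2) / s0 * exp (- (s0 * (x - 2)))"
      using a by (intro mult_right_mono) auto
    also have "\<dots> = exp (2 * s0) / (s0 * m) * (exp (- ((s0 / 2) * x)) * m)"
      using m s0 by (simp add: exp_add[symmetric] algebra_simps)
    also have "\<dots> \<le> exp (2 * s0) / (s0 * m) * L x"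
      using m s0 Lx by (intro mult_left_mono) auto
    finally have "x / 2 * exp (- (s0 * (x - 2))) * L 1 \<le> exp (2 * s0) / (s0 * m) * L x * L 1"
      by (intro mult_right_mono L_nonneg)
    moreover have "exp (2 * s0) / (s0 * m) * L x * L 1 = exp (2 * s0) * L 1 / (s0 * m) * L x" by simp
    ultimately have "L (x / 2) \<le> (D + exp (2 * s0) * L 1 / (s0 * m)) * L x"
      using key[OF x] unfolding distrib_right by linarith
    also have "\<dots> \<le> C * L x" unfolding C_def by (intro mult_right_mono L_nonneg) simp
    finally show "L (x / 2) \<le> C * L x" .
  qed
qed

end

section \<open>Subexponential densities\<close>

text \<open>\<open>g\<close> is not normalised, and its mass enters the constants.
  \<open>g_dominated\<close> is stated for all \<open>y\<close> from \<open>x / 2\<close> on, which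
  is the range of \<open>x - z\<close> when the other summand \<open>z\<close> is at most
  \<open>x / 2\<close>. In the application \<open>g\<close> vanishes up to 1, so the threshold 2
  keeps \<open>x / 2\<close> at or above that edge.\<close>

locale subexponential_density =
  fixes g :: "real \<Rightarrow> real" and C B0 :: real
  assumes g_measurable [measurable]: "g \<in> borel_measurable borel"
    and g_nonneg: "0 \<le> g x"
    and g_integrable: "integrable lborel g"
    and g_bounded: "g x \<le> B0"
    and g_pos: "x \<ge> 2 \<Longrightarrow> g x > 0"
    and g_dominated: "x \<ge> 2 \<Longrightarrow> x / 2 \<le> y \<Longrightarrow> g y \<le> C * g x"
    and g_long_tailed: "((\<lambda>x. g (x - y) / g x) \<longlongrightarrow> 1) at_top"
    and g_heavy: "\<epsilon> > 0 \<Longrightarrow> ((\<lambda>x. exp (- (\<epsilon> * x)) / g x) \<longlongrightarrow> 0) at_top"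
begin

lemma C_pos: "C > 0"
proof (rule ccontr)
  assume "\<not> C > 0"
  then have "C * g 2 \<le> 0" using g_nonneg[of 2] by (intro mult_nonpos_nonneg) auto
  moreover have "g 2 \<le> C * g 2" by (rule g_dominated) auto
  ultimately show False using g_pos[of 2] by linarith
qed

lemma B0_nonneg: "B0 \<ge> 0"
  using g_nonneg[of 0] g_bounded[of 0] by linarith

text \<open>For \<open>y\<close> at most \<open>x / 2\<close>, negative \<open>y\<close> included,
  \<open>g (x - y) / g x\<close> is bounded by \<open>C\<close> and tends to 1, so dominated
  convergence applies for any finite measure.\<close>

lemma near_part:
  assumes "finite_measure N" and [measurable_cong]: "sets N = sets borel"
  shows "((\<lambda>x. (LINT y|N. g (x - y) * indicator {..x / 2} y) / g x) \<longlongrightarrow> measure N UNIV) at_top"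
    and "x \<ge> 2 \<Longrightarrow> (LINT y|N. g (x - y) * indicator {..x / 2} y) \<le> C * measure N UNIV * g x"
proof -
  interpret finite_measure N by fact
  have [simp]: "space N = UNIV" using sets_eq_imp_space_eq[OF assms(2)] by simp
  have bd: "g (x - y) * indicator {..x / 2} y \<le> C * g x" if "x \<ge> 2" for x y
    using g_dominated[OF that, of "x - y"] g_pos[OF that] C_pos by (auto split: split_indicator)
  have "((\<lambda>x. LINT y|N. g (x - y) * indicator {..x / 2} y / g x) \<longlongrightarrow> (LINT y|N. 1)) at_top"
  proof (rule integral_dominated_convergence_at_top[where w="\<lambda>_. C"])
    show "\<forall>\<^sub>F x in at_top. AE y in N. norm (g (x - y) * indicator {..x / 2} y / g x) \<le> C"
      using eventually_ge_at_top[of 2]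
      by eventually_elim (use bd g_nonneg g_pos in \<open>auto simp: abs_mult divide_le_eq\<close>)
    show "AE y in N. ((\<lambda>x. g (x - y) * indicator {..x / 2} y / g x) \<longlongrightarrow> 1) at_top"
    proof (intro AE_I2)
      fix y :: real
      have "\<forall>\<^sub>F x in at_top. g (x - y) / g x = g (x - y) * indicator {..x / 2} y / g x"
        using eventually_ge_at_top[of "2 * y"] by eventually_elim auto
      with g_long_tailed[of y] show "((\<lambda>x. g (x - y) * indicator {..x / 2} y / g x) \<longlongrightarrow> 1) at_top"
        by (rule Lim_transform_eventually)
    qed
  qed auto
  then show "((\<lambda>x. (LINT y|N. g (x - y) * indicator {..x / 2} y) / g x) \<longlongrightarrow> measure N UNIV) at_top"
    by simp
  assume x: "x \<ge> 2"
  have "(LINT y|N. g (x - y) * indicator {..x / 2} y) \<le> (LINT y|N. C * g x)"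
  proof (rule integral_mono)
    show "integrable N (\<lambda>y. g (x - y) * indicator {..x / 2} y)"
      by (rule integrable_const_bound[of _ B0])
        (use g_nonneg g_bounded B0_nonneg in \<open>auto simp: abs_mult split: split_indicator\<close>)
  qed (use bd[OF x] in auto)
  then show "(LINT y|N. g (x - y) * indicator {..x / 2} y) \<le> C * measure N UNIV * g x"
    by (simp add: mult_ac)
qed

text \<open>Far out this is heaviness. On the remaining stretch from 2 to \<open>Y\<close>
  domination keeps \<open>g\<close> above \<open>g Y / C\<close>, while the exponential is at most
  1.\<close>

lemma exp_le_g:
  assumes "\<epsilon> > 0"
  obtains K where "K \<ge> 0" "\<And>x. x \<ge> 2 \<Longrightarrow> exp (- (\<epsilon> * x)) \<le> K * g x"
proof -
  have "\<forall>\<^sub>F x in at_top. exp (- (\<epsilon> * x)) / g x < 1"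
    using g_heavy[OF assms] by (rule order_tendstoD) simp
  then obtain X where X: "\<And>x. x \<ge> X \<Longrightarrow> exp (- (\<epsilon> * x)) / g x < 1"
    by (auto simp: eventually_at_top_linorder)
  define Y where "Y = max 2 X"
  have Y: "Y \<ge> 2" "g Y > 0" using g_pos[of Y] by (auto simp: Y_def)
  show thesis
  proof (rule that[of "1 + C / g Y"])
    show "1 + C / g Y \<ge> 0" using Y C_pos by simp
    fix x :: real assume x: "x \<ge> 2"
    show "exp (- (\<epsilon> * x)) \<le> (1 + C / g Y) * g x"
    proof (cases "x \<ge> Y")
      case True
      then have "exp (- (\<epsilon> * x)) < g x" using X[of x] g_pos[OF x] by (simp add: Y_def field_simps)
      also have "\<dots> \<le> (1 + C / g Y) * g x" using C_pos Y g_pos[OF x] by (simp add: distrib_right)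
      finally show ?thesis by simp
    next
      case False
      then have "g Y \<le> C * g x" using g_dominated[OF x, of Y] x by simp
      then have "1 \<le> C / g Y * g x" using Y by (simp add: field_simps)
      moreover have "exp (- (\<epsilon> * x)) \<le> 1" using assms x by simp
      ultimately show ?thesis using g_nonneg[of x] unfolding distrib_right by linarith
    qed
  qed
qed

text \<open>When the summand from \<open>N\<close> exceeds \<open>x / 2\<close>, the contribution is
  at most \<open>B0\<close> times an exponentially small tail, which is negligible against
  \<open>g\<close>. What remains is the near part.\<close>

lemma light_convolution:
  assumes "finite_measure N" and [measurable_cong]: "sets N = sets borel"
    and \<epsilon>: "\<epsilon> > 0" and light: "\<And>x. measure N {x<..} \<le> K * exp (- (\<epsilon> * x))"
  shows "((\<lambda>x. (LINT y|N. g (x - y)) / g x) \<longlongrightarrow> measure N UNIV) at_top"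
    and "\<exists>B\<ge>0. \<forall>x\<ge>2. (LINT y|N. g (x - y)) \<le> B * g x"
proof -
  interpret finite_measure N by fact
  have [simp]: "space N = UNIV" using sets_eq_imp_space_eq[OF assms(2)] by simp
  have int: "integrable N (\<lambda>y. g (x - y) * indicator A y)" if [measurable]: "A \<in> sets borel" for x A
    by (rule integrable_const_bound[of _ B0])
      (use g_nonneg g_bounded B0_nonneg in \<open>auto simp: abs_mult split: split_indicator\<close>)
  have split: "(LINT y|N. g (x - y)) = (LINT y|N. g (x - y) * indicator {..x / 2} y) + (LINT y|N. g (x - y) * indicator {x / 2<..} y)" for x
    by (subst Bochner_Integration.integral_add[symmetric])
      (auto intro!: int Bochner_Integration.integral_cong split: split_indicator)
  have far: "(LINT y|N. g (x - y) * indicator {x / 2<..} y) \<le> B0 * K * exp (- (\<epsilon> / 2 * x))" for x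
  proof -
    have "(LINT y|N. g (x - y) * indicator {x / 2<..} y) \<le> (LINT y|N. B0 * indicator {x / 2<..} y)"
      by (intro integral_mono int integrable_mult_right integrable_real_indicator)
        (auto intro: g_bounded split: split_indicator simp: less_top[symmetric])
    also have "\<dots> = B0 * measure N {x / 2<..}" by simp
    also have "\<dots> \<le> B0 * (K * exp (- (\<epsilon> * (x / 2))))" by (intro mult_left_mono light B0_nonneg)
    finally show ?thesis by (simp add: mult_ac)
  qed
  have far0: "0 \<le> (LINT y|N. g (x - y) * indicator {x / 2<..} y)" for x
    using g_nonneg by (intro Bochner_Integration.integral_nonneg) simp
  \<comment> \<open>The sign of \<open>K\<close> is not assumed; it is read off at
    \<open>x = 0\<close>, where the exponential is 1.\<close>
  have K0: "0 \<le> B0 * K"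
    using far0[of 0] far[of 0] by simp
  have "((\<lambda>x. (LINT y|N. g (x - y) * indicator {x / 2<..} y) / g x) \<longlongrightarrow> 0) at_top"
  proof (rule tendsto_sandwich[where f = "\<lambda>_. 0" and h = "\<lambda>x. B0 * K * (exp (- (\<epsilon> / 2 * x)) / g x)"])
    show "((\<lambda>x. B0 * K * (exp (- (\<epsilon> / 2 * x)) / g x)) \<longlongrightarrow> 0) at_top"
      using tendsto_mult[OF tendsto_const g_heavy[of "\<epsilon> / 2"]] \<epsilon> by fastforce
    show "\<forall>\<^sub>F x in at_top. (LINT y|N. g (x - y) * indicator {x / 2<..} y) / g x \<le> B0 * K * (exp (- (\<epsilon> / 2 * x)) / g x)"
    proof (intro always_eventually allI)
      fix x
      show "(LINT y|N. g (x - y) * indicator {x / 2<..} y) / g x \<le> B0 * K * (exp (- (\<epsilon> / 2 * x)) / g x)"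
        using divide_right_mono[OF far g_nonneg[of x], of x] by simp
    qed
  qed (use far0 g_nonneg in auto)
  from tendsto_add[OF near_part(1)[OF assms(1,2)] this]
  show "((\<lambda>x. (LINT y|N. g (x - y)) / g x) \<longlongrightarrow> measure N UNIV) at_top"
    unfolding split add_divide_distrib by simp
  obtain K' where K': "K' \<ge> 0" "\<And>x. x \<ge> 2 \<Longrightarrow> exp (- (\<epsilon> / 2 * x)) \<le> K' * g x"
    using exp_le_g[of "\<epsilon> / 2"] \<epsilon> by auto
  show "\<exists>B\<ge>0. \<forall>x\<ge>2. (LINT y|N. g (x - y)) \<le> B * g x"
  proof (intro exI[of _ "C * measure N UNIV + B0 * K * K'"] conjI allI impI)
    show "0 \<le> C * measure N UNIV + B0 * K * K'" using C_pos K0 K'(1) by simp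
    fix x :: real assume x: "x \<ge> 2"
    have "(LINT y|N. g (x - y) * indicator {x / 2<..} y) \<le> B0 * K * (K' * g x)"
      using far[of x] mult_left_mono[OF K'(2)[OF x] K0] by linarith
    then show "(LINT y|N. g (x - y)) \<le> (C * measure N UNIV + B0 * K * K') * g x"
      unfolding split using near_part(2)[OF assms(1,2) x] by (simp add: algebra_simps)
  qed
qed

definition conv_g :: "(real \<Rightarrow> real) \<Rightarrow> real \<Rightarrow> real" where
  "conv_g r x = (LINT y|lborel. r (x - y) * g y)"

lemma conv_g:
  assumes [measurable]: "r \<in> borel_measurable borel" and r0: "\<And>x. 0 \<le> r x" and r: "integrable lborel r"
    and R: "\<And>x. r x \<le> R"
  shows "conv_g r \<in> borel_measurable borel" and "0 \<le> conv_g r x" and "conv_g r x \<le> R * (LINT y|lborel. g y)"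
    and "ennreal (conv_g r x) = (\<integral>\<^sup>+y. ennreal (r (x - y) * g y) \<partial>lborel)"
    and "integrable lborel (conv_g r)"
    and "(LINT x|lborel. conv_g r x) = (LINT x|lborel. r x) * (LINT x|lborel. g x)"
proof -
  have R0: "R \<ge> 0" using r0[of 0] R[of 0] by linarith
  have int: "integrable lborel (\<lambda>y. r (x - y) * g y)" for x
    by (rule Bochner_Integration.integrable_bound[of _ "\<lambda>y. R * g y"])
      (use g_integrable g_nonneg r0 R R0 in \<open>auto simp: abs_mult intro!: mult_right_mono\<close>)
  show m [measurable]: "conv_g r \<in> borel_measurable borel"
    unfolding conv_g_def[abs_def] by measurable
  show nn: "0 \<le> conv_g r x" for x
    unfolding conv_g_def using r0 g_nonneg by simp
  have "conv_g r x \<le> (LINT y|lborel. R * g y)"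
    unfolding conv_g_def by (rule integral_mono[OF int])
      (use g_integrable g_nonneg R in \<open>auto intro!: mult_right_mono\<close>)
  then show "conv_g r x \<le> R * (LINT y|lborel. g y)" by simp
  show nni: "ennreal (conv_g r x) = (\<integral>\<^sup>+y. ennreal (r (x - y) * g y) \<partial>lborel)" for x
    unfolding conv_g_def using int[of x] r0 g_nonneg by (subst nn_integral_eq_integral) auto
  have "(\<integral>\<^sup>+x. ennreal (conv_g r x) \<partial>lborel) = (\<integral>\<^sup>+x. (\<integral>\<^sup>+y. ennreal (r (x - y) * g y) \<partial>lborel) \<partial>lborel)"
    unfolding nni ..
  also have "\<dots> = (\<integral>\<^sup>+y. (\<integral>\<^sup>+x. ennreal (r (x - y) * g y) \<partial>lborel) \<partial>lborel)"
    by (rule lborel_pair.Fubini') measurable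
  also have "\<dots> = (\<integral>\<^sup>+y. ennreal (LINT x|lborel. r x) * ennreal (g y) \<partial>lborel)"
  proof (intro nn_integral_cong)
    fix y :: real
    have "(\<integral>\<^sup>+x. ennreal (r (x - y) * g y) \<partial>lborel) = (\<integral>\<^sup>+x. ennreal (r (- y + 1 * x)) * ennreal (g y) \<partial>lborel)"
      using r0 g_nonneg by (simp add: ennreal_mult)
    also have "\<dots> = (\<integral>\<^sup>+x. ennreal (r (- y + 1 * x)) \<partial>lborel) * ennreal (g y)"
      by (rule nn_integral_multc) measurable
    also have "(\<integral>\<^sup>+x. ennreal (r (- y + 1 * x)) \<partial>lborel) = (\<integral>\<^sup>+x. ennreal (r x) \<partial>lborel)"
      using nn_integral_real_affine[of "\<lambda>x. ennreal (r x)" 1 "-y"] by simp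
    also have "\<dots> = ennreal (LINT x|lborel. r x)" using r r0 by (intro nn_integral_eq_integral) auto
    finally show "(\<integral>\<^sup>+x. ennreal (r (x - y) * g y) \<partial>lborel) = ennreal (LINT x|lborel. r x) * ennreal (g y)" .
  qed
  also have "\<dots> = ennreal ((LINT x|lborel. r x) * (LINT x|lborel. g x))"
    using g_integrable g_nonneg r0
    by (simp add: nn_integral_cmult nn_integral_eq_integral ennreal_mult)
  finally have tot: "(\<integral>\<^sup>+x. ennreal (conv_g r x) \<partial>lborel) = ennreal ((LINT x|lborel. r x) * (LINT x|lborel. g x))" .
  then show i: "integrable lborel (conv_g r)"
    using nn by (intro integrableI_nonneg) auto
  show "(LINT x|lborel. conv_g r x) = (LINT x|lborel. r x) * (LINT x|lborel. g x)"
    using tot nn r0 g_nonneg by (subst (asm) nn_integral_eq_integral[OF i]) auto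
qed

text \<open>
  One big jump: either the \<open>g\<close>-summand is at most \<open>x / 2\<close> and the \<open>r\<close>-summand is large, or conversely.
\<close>

lemma conv_g_asymptotics:
  assumes [measurable]: "r \<in> borel_measurable borel" and r0: "\<And>x. 0 \<le> r x" and r: "integrable lborel r"
    and R: "\<And>x. r x \<le> R"
    and B: "\<And>x. x \<ge> 2 \<Longrightarrow> r x \<le> B * g x" and c: "((\<lambda>x. r x / g x) \<longlongrightarrow> c) at_top"
  shows "((\<lambda>x. conv_g r x / g x) \<longlongrightarrow> c * (LINT x|lborel. g x) + (LINT x|lborel. r x)) at_top"
    and "x \<ge> 2 \<Longrightarrow> conv_g r x \<le> 
      (B * C * (LINT x|lborel. g x) + C * (LINT x|lborel. r x) + R * (LINT x|lborel. g x) * C / g 4) * g x"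
proof -
  have R0: "R \<ge> 0" using r0[of 0] R[of 0] by linarith
  have B0: "B \<ge> 0"
  proof (rule ccontr)
    assume "\<not> B \<ge> 0"
    then have "B * g 2 < 0" using g_pos[of 2] by (intro mult_neg_pos) auto
    then show False using B[of 2] r0[of 2] by simp
  qed
  have G0: "0 \<le> (LINT x|lborel. g x)" "0 \<le> (LINT x|lborel. r x)" using g_nonneg r0 by auto
  \<comment> \<open>Substituting \<open>z = x - y\<close> in the part with \<open>y\<close> above
    \<open>x / 2\<close> exchanges the roles of the summands, so that part becomes the near part for
    the measure with density \<open>r\<close>.\<close>
  define N where "N = density lborel (\<lambda>x. ennreal (r x))"
  have N: "finite_measure N" "sets N = sets borel"
    using finite_measure_density_real[OF r] by (auto simp: N_def)
  have NU: "measure N UNIV = (LINT x|lborel. r x)"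
    unfolding N_def measure_def using r r0 by (simp add: emeasure_density nn_integral_eq_integral)
  define I1 where "I1 x = (LINT y|lborel. r (x - y) * g y * indicator {..x / 2} y)" for x
  define I2 where "I2 x = (LINT z|N. g (x - z) * indicator {..x / 2} z)" for x
  have int: "integrable lborel (\<lambda>y. r (x - y) * g y * indicator A y)" if [measurable]: "A \<in> sets borel" for x A
    by (rule Bochner_Integration.integrable_bound[of _ "\<lambda>y. R * g y"])
      (use g_integrable g_nonneg r0 R R0 in \<open>auto simp: abs_mult split: split_indicator intro!: mult_right_mono\<close>)
  have split: "conv_g r x = I1 x + I2 x" for x
  proof -
    have "conv_g r x = (LINT y|lborel. r (x - y) * g y * indicator {..x / 2} y + r (x - y) * g y * indicator {x / 2<..} y)"
      unfolding conv_g_def by (intro Bochner_Integration.integral_cong) (auto split: split_indicator)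
    also have "\<dots> = I1 x + (LINT y|lborel. r (x - y) * g y * indicator {x / 2<..} y)"
      unfolding I1_def by (intro Bochner_Integration.integral_add int) auto
    also have "(LINT y|lborel. r (x - y) * g y * indicator {x / 2<..} y) = 
        (LINT z|lborel. r (x - (x + (-1) * z)) * g (x + (-1) * z) * indicator {x / 2<..} (x + (-1) * z))"
      by (subst lborel_integral_real_affine[of "-1" _ x]) auto
    also have "\<dots> = (LINT z|lborel. r z * (g (x - z) * indicator {..x / 2} z))"
    proof (rule integral_cong_AE)
      \<comment> \<open>The reflected open half-line differs from \<open>{..x / 2}\<close> only in
        its endpoint.\<close>
      show "AE z in lborel. r (x - (x + (-1) * z)) * g (x + (-1) * z) * indicator {x / 2<..} (x + (-1) * z) = 
          r z * (g (x - z) * indicator {..x / 2} z)"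
        using AE_lborel_singleton[of "x / 2"] by eventually_elim (auto split: split_indicator)
    qed auto
    also have "\<dots> = I2 x"
      unfolding I2_def N_def using r0 by (subst integral_density) auto
    finally show ?thesis .
  qed
  have lim2: "((\<lambda>x. I2 x / g x) \<longlongrightarrow> (LINT x|lborel. r x)) at_top"
    unfolding I2_def NU[symmetric] by (rule near_part(1)[OF N])
  have le2: "I2 x \<le> C * (LINT x|lborel. r x) * g x" if "x \<ge> 2" for x
    unfolding I2_def NU[symmetric] by (rule near_part(2)[OF N that])
  \<comment> \<open>From 4 on, \<open>x - y\<close> is at least 2, so the bound \<open>B\<close> on
    \<open>r\<close> is available there.\<close>
  have bd: "r (x - y) * indicator {..x / 2} y \<le> B * C * g x" if "x \<ge> 4" for x y
  proof (cases "y \<le> x / 2")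
    case True
    then have "r (x - y) \<le> B * g (x - y)" using that by (intro B) simp
    also have "\<dots> \<le> B * (C * g x)" using True that B0 by (intro mult_left_mono g_dominated) auto
    finally show ?thesis using True by simp
  next
    case False
    then show ?thesis using B0 C_pos g_nonneg[of x] by simp
  qed
  have lim1: "((\<lambda>x. I1 x / g x) \<longlongrightarrow> c * (LINT x|lborel. g x)) at_top"
  proof -
    have "((\<lambda>x. LINT y|lborel. r (x - y) * indicator {..x / 2} y / g x * g y) \<longlongrightarrow> (LINT y|lborel. c * g y)) at_top"
    proof (rule integral_dominated_convergence_at_top[where w="\<lambda>y. B * C * g y"])
      show "\<forall>\<^sub>F x in at_top. AE y in lborel. norm (r (x - y) * indicator {..x / 2} y / g x * g y) \<le> B * C * g y"
        using eventually_ge_at_top[of 4]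
      proof eventually_elim
        case (elim x)
        have gx: "g x > 0" using elim by (intro g_pos) simp
        show ?case
        proof (intro AE_I2)
          fix y :: real
          have "r (x - y) * indicator {..x / 2} y / g x \<le> B * C"
            using bd[OF elim, of y] gx by (simp add: divide_le_eq)
          then have "r (x - y) * indicator {..x / 2} y / g x * g y \<le> B * C * g y"
            by (intro mult_right_mono g_nonneg)
          then show "norm (r (x - y) * indicator {..x / 2} y / g x * g y) \<le> B * C * g y"
            using r0 g_nonneg by (simp add: abs_mult)
        qed
      qed
      show "AE y in lborel. ((\<lambda>x. r (x - y) * indicator {..x / 2} y / g x * g y) \<longlongrightarrow> c * g y) at_top"
      proof (intro AE_I2 tendsto_mult tendsto_const)
        fix y :: real
        have "filterlim (\<lambda>x. x - y) at_top at_top"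
          using filterlim_tendsto_add_at_top[OF tendsto_const[of "-y"] filterlim_ident] by simp
        from filterlim_compose[OF c this] have "((\<lambda>x. r (x - y) / g (x - y) * (g (x - y) / g x)) \<longlongrightarrow> c * 1) at_top"
          by (intro tendsto_mult g_long_tailed)
        moreover have "\<forall>\<^sub>F x in at_top. r (x - y) / g (x - y) * (g (x - y) / g x) = r (x - y) * indicator {..x / 2} y / g x"
          using eventually_ge_at_top[of "2 * y"] eventually_ge_at_top[of "y + 2"]
        proof eventually_elim
          case (elim x)
          then show ?case using g_pos[of "x - y"] by simp
        qed
        ultimately show "((\<lambda>x. r (x - y) * indicator {..x / 2} y / g x) \<longlongrightarrow> c) at_top"
          by (simp add: Lim_transform_eventually)
      qed
    qed (use g_integrable in auto)
    moreover have "(LINT y|lborel. r (x - y) * indicator {..x / 2} y / g x * g y) = I1 x / g x" for x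
      unfolding I1_def by (subst integral_divide_zero[symmetric]) (simp add: field_simps)
    ultimately show ?thesis by (simp only: integral_mult_right_zero)
  qed
  from tendsto_add[OF lim1 lim2]
  show "((\<lambda>x. conv_g r x / g x) \<longlongrightarrow> c * (LINT x|lborel. g x) + (LINT x|lborel. r x)) at_top"
    unfolding split add_divide_distrib .
  assume x: "x \<ge> 2"
  have nn: "0 \<le> B * C * (LINT x|lborel. g x) * g x" "0 \<le> C * (LINT x|lborel. r x) * g x"
    "0 \<le> R * (LINT x|lborel. g x) * C / g 4 * g x"
    using B0 C_pos G0 R0 g_nonneg by auto
  show "conv_g r x \<le> 
      (B * C * (LINT x|lborel. g x) + C * (LINT x|lborel. r x) + R * (LINT x|lborel. g x) * C / g 4) * g x"
  proof (cases "x \<ge> 4")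
    case True
    have "I1 x \<le> (LINT y|lborel. B * C * g x * g y)"
      unfolding I1_def
    proof (rule integral_mono[OF int])
      show "r (x - y) * g y * indicator {..x / 2} y \<le> B * C * g x * g y" for y
        using mult_right_mono[OF bd[OF True, of y] g_nonneg[of y]] by (simp add: mult_ac)
    qed (use g_integrable in auto)
    then have "I1 x \<le> B * C * (LINT x|lborel. g x) * g x" by (simp add: mult_ac)
    with le2[OF x] nn show ?thesis unfolding split distrib_right by linarith
  next
    case False
    \<comment> \<open>Between 2 and 4 only the uniform bound on the convolution is available.
      Domination by \<open>g x\<close> at the point 4 turns this constant into a multiple of
      \<open>g x\<close>; this is the origin of \<open>C / g 4\<close>.\<close>
    have "g 4 \<le> C * g x" using False x by (intro g_dominated) auto
    then have "1 \<le> C / g 4 * g x" using g_pos[of 4] by (simp add: field_simps)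
    then have "R * (LINT x|lborel. g x) * 1 \<le> R * (LINT x|lborel. g x) * (C / g 4 * g x)"
      using R0 G0 by (intro mult_left_mono) auto
    moreover have "conv_g r x \<le> R * (LINT y|lborel. g y)"
      by (rule conv_g(3)[OF assms(1-4)])
    ultimately have "conv_g r x \<le> R * (LINT x|lborel. g x) * C / g 4 * g x" by simp
    with nn show ?thesis unfolding distrib_right by linarith
  qed
qed

end

section \<open>Iterated convolutions and their exponential series\<close>

context subexponential_density begin

text \<open>In the application \<open>r\<close> is itself the convolution of a measure with
  \<open>g\<close>, so index \<open>n\<close> stands for \<open>n + 1\<close> jumps. This is the
  source of every \<open>Suc n\<close> in the limits and factorials below.\<close>

primrec conv_seq :: "(real \<Rightarrow> real) \<Rightarrow> nat \<Rightarrow> real \<Rightarrow> real" where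
  "conv_seq r 0 = r"
| "conv_seq r (Suc n) = conv_g (conv_seq r n)"

lemma conv_seq:
  assumes [measurable]: "r \<in> borel_measurable borel" and r0: "\<And>x. 0 \<le> r x" and r: "integrable lborel r"
    and R: "\<And>x. r x \<le> R"
  shows "conv_seq r n \<in> borel_measurable borel" "0 \<le> conv_seq r n x" "integrable lborel (conv_seq r n)"
    "conv_seq r n x \<le> R * (LINT x|lborel. g x) ^ n"
    "(LINT x|lborel. conv_seq r n x) = (LINT x|lborel. r x) * (LINT x|lborel. g x) ^ n"
proof -
  have "conv_seq r n \<in> borel_measurable borel \<and> (\<forall>x. 0 \<le> conv_seq r n x) \<and> integrable lborel (conv_seq r n)
    \<and> (\<forall>x. conv_seq r n x \<le> R * (LINT x|lborel. g x) ^ n) \<and>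
    (LINT x|lborel. conv_seq r n x) = (LINT x|lborel. r x) * (LINT x|lborel. g x) ^ n"
  proof (induction n)
    case (Suc n)
    then have IH: "conv_seq r n \<in> borel_measurable borel" "\<And>x. 0 \<le> conv_seq r n x" "integrable lborel (conv_seq r n)"
      "\<And>x. conv_seq r n x \<le> R * (LINT x|lborel. g x) ^ n"
      "(LINT x|lborel. conv_seq r n x) = (LINT x|lborel. r x) * (LINT x|lborel. g x) ^ n"
      by auto
    show ?case
      using conv_g[OF IH(1-4)] IH(5) by (simp add: mult_ac)
  qed (use assms in auto)
  then show "conv_seq r n \<in> borel_measurable borel" "0 \<le> conv_seq r n x" "integrable lborel (conv_seq r n)"
    "conv_seq r n x \<le> R * (LINT x|lborel. g x) ^ n"
    "(LINT x|lborel. conv_seq r n x) = (LINT x|lborel. r x) * (LINT x|lborel. g x) ^ n"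
    by auto
qed

text \<open>
  The geometric bound plays the role of Kesten's bound: it permits summation of the
  exponential series term by term.
\<close>

lemma conv_seq_asymptotics:
  assumes r: "r \<in> borel_measurable borel" "\<And>x. 0 \<le> r x" "integrable lborel r" "\<And>x. r x \<le> R"
    and B: "\<And>x. x \<ge> 2 \<Longrightarrow> r x \<le> B * g x" and q: "((\<lambda>x. r x / g x) \<longlongrightarrow> q) at_top"
    and qint: "(LINT x|lborel. r x) = q * (LINT x|lborel. g x)"
  shows "((\<lambda>x. conv_seq r n x / g x) \<longlongrightarrow> real (Suc n) * (LINT x|lborel. g x) ^ n * q) at_top"
    and "\<exists>A K. A \<ge> 0 \<and> K \<ge> 0 \<and> (\<forall>n. \<forall>x\<ge>2. conv_seq r n x \<le> A * K ^ n * g x)"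
proof -
  define lam where "lam = (LINT x|lborel. g x)"
  have lam: "lam \<ge> 0" unfolding lam_def using g_nonneg by simp
  note P = conv_seq[OF r, folded lam_def]
  \<comment> \<open>One convolution step multiplies the bound by \<open>C * lam\<close> and adds
    terms of order \<open>lam ^ n\<close>. \<open>K\<close> dominates both
    \<open>C * lam + 1\<close> and \<open>lam\<close>, and \<open>A\<close> dominates the initial
    bound and the coefficients of the added terms.\<close>
  define K where "K = C * lam + lam + 1"
  define A where "A = max B 0 + C * \<bar>q\<bar> * lam + \<bar>R\<bar> * lam * C / g 4"
  have g4: "g 4 > 0" by (rule g_pos) simp
  have K: "K \<ge> 0" "lam \<le> K" "C * lam + 1 \<le> K" using lam C_pos by (auto simp: K_def)
  have A: "A \<ge> 0" "B \<le> A" "C * \<bar>q\<bar> * lam + \<bar>R\<bar> * lam * C / g 4 \<le> A"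
    using lam C_pos g4 by (auto simp: A_def add_increasing2)
  \<comment> \<open>Limit and bound go through the induction together, because one convolution step
    consumes both.\<close>
  have main: "((\<lambda>x. conv_seq r n x / g x) \<longlongrightarrow> real (Suc n) * lam ^ n * q) at_top \<and>
     (\<forall>x\<ge>2. conv_seq r n x \<le> A * K ^ n * g x)" for n
  proof (induction n)
    case 0
    have "r x \<le> A * g x" if "x \<ge> 2" for x
      using B[OF that] mult_right_mono[OF A(2) g_nonneg[of x]] by linarith
    then show ?case using q by simp
  next
    case (Suc n)
    then have lim: "((\<lambda>x. conv_seq r n x / g x) \<longlongrightarrow> real (Suc n) * lam ^ n * q) at_top"
      and le: "\<And>x. x \<ge> 2 \<Longrightarrow> conv_seq r n x \<le> A * K ^ n * g x" by auto
    have int: "(LINT x|lborel. conv_seq r n x) = q * lam * lam ^ n"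
      using P(5) qint by (simp add: lam_def)
    note ca = conv_g_asymptotics[OF P(1,2,3,4) le lim, folded lam_def, unfolded int]
    \<comment> \<open>The old limit is multiplied by \<open>lam\<close> when the new summand is
      moderate, and the mass of the old term is added when the new summand is the large one. Each
      step thus adds one to the linear factor.\<close>
    have "real (Suc n) * lam ^ n * q * lam + q * lam * lam ^ n = real (Suc (Suc n)) * lam ^ Suc n * q"
      by (simp add: algebra_simps)
    with ca(1) have 1: "((\<lambda>x. conv_seq r (Suc n) x / g x) \<longlongrightarrow> real (Suc (Suc n)) * lam ^ Suc n * q) at_top"
      by simp
    have "conv_seq r (Suc n) x \<le> A * K ^ Suc n * g x" if x: "x \<ge> 2" for x
    proof -
      have "conv_seq r (Suc n) x \<le> (A * K ^ n * C * lam + C * (q * lam * lam ^ n) + R * lam ^ n * lam * C / g 4) * g x"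
        using ca(2)[of x] x by simp
      also have "\<dots> \<le> A * K ^ Suc n * g x"
      proof (intro mult_right_mono g_nonneg)
        have "C * (q * lam * lam ^ n) + R * lam ^ n * lam * C / g 4 = (C * q * lam + R * lam * C / g 4) * lam ^ n"
          by (simp add: field_simps)
        also have "\<dots> \<le> (C * \<bar>q\<bar> * lam + \<bar>R\<bar> * lam * C / g 4) * lam ^ n"
          using lam C_pos g4 by (intro mult_right_mono add_mono divide_right_mono mult_left_mono) auto
        also have "\<dots> \<le> A * K ^ n" using lam A K by (intro mult_mono power_mono) auto
        finally have "A * K ^ n * C * lam + C * (q * lam * lam ^ n) + R * lam ^ n * lam * C / g 4 \<le> A * K ^ n * (C * lam + 1)"
          by (simp add: algebra_simps)
        also have "\<dots> \<le> A * K ^ n * K" using A K by (intro mult_left_mono) auto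
        finally show "A * K ^ n * C * lam + C * (q * lam * lam ^ n) + R * lam ^ n * lam * C / g 4 \<le> A * K ^ Suc n"
          by (simp add: mult_ac)
      qed
      finally show ?thesis .
    qed
    with 1 show ?case by blast
  qed
  show "((\<lambda>x. conv_seq r n x / g x) \<longlongrightarrow> real (Suc n) * (LINT x|lborel. g x) ^ n * q) at_top"
    using main[of n] unfolding lam_def by blast
  show "\<exists>A K. A \<ge> 0 \<and> K \<ge> 0 \<and> (\<forall>n. \<forall>x\<ge>2. conv_seq r n x \<le> A * K ^ n * g x)"
    using main A(1) K(1) by blast
qed

text \<open>The compound Poisson series without its jump-free term and without the normalisation
  \<open>exp (- lam)\<close>.\<close>

definition conv_exp :: "(real \<Rightarrow> real) \<Rightarrow> real \<Rightarrow> real" where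
  "conv_exp r x = (\<Sum>n. conv_seq r n x / fact (Suc n))"

lemma conv_exp_sums:
  assumes "r \<in> borel_measurable borel" "\<And>x. 0 \<le> r x" "integrable lborel r" "\<And>x. r x \<le> R"
  shows "(\<lambda>n. conv_seq r n x / fact (Suc n)) sums conv_exp r x"
  unfolding conv_exp_def
proof (rule summable_sums, rule summable_comparison_test)
  define lam where "lam = (LINT x|lborel. g x)"
  have lam: "lam \<ge> 0" unfolding lam_def using g_nonneg by simp
  have R: "R \<ge> 0" using assms(2)[of 0] assms(4)[of 0] by linarith
  show "summable (\<lambda>n. R * (lam ^ n / fact n))"
    using exp_sums_divide_fact[of lam] by (intro summable_mult) (simp add: sums_iff)
  have "norm (conv_seq r n x / fact (Suc n)) \<le> R * (lam ^ n / fact n)" for n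
  proof -
    have "conv_seq r n x / fact (Suc n) \<le> R * lam ^ n / fact n"
      using conv_seq(4)[OF assms, of n x] R lam
      by (intro frac_le) (auto simp: lam_def fact_mono)
    then show ?thesis using conv_seq(2)[OF assms, of n x] by (simp del: fact_Suc)
  qed
  then show "\<exists>N. \<forall>n\<ge>N. norm (conv_seq r n x / fact (Suc n)) \<le> R * (lam ^ n / fact n)" by blast
qed

text \<open>Tannery's theorem with the geometric bound as majorant. The factor \<open>n + 1\<close>
  in the limit of each term reduces \<open>fact (Suc n)\<close> to \<open>fact n\<close>, so the
  limits sum to an exponential.\<close>

lemma conv_exp_asymptotics:
  assumes r: "r \<in> borel_measurable borel" "\<And>x. 0 \<le> r x" "integrable lborel r" "\<And>x. r x \<le> R"
    and B: "\<And>x. x \<ge> 2 \<Longrightarrow> r x \<le> B * g x" and q: "((\<lambda>x. r x / g x) \<longlongrightarrow> q) at_top"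
    and qint: "(LINT x|lborel. r x) = q * (LINT x|lborel. g x)"
  shows "((\<lambda>x. conv_exp r x / g x) \<longlongrightarrow> q * exp (LINT x|lborel. g x)) at_top"
proof -
  define lam where "lam = (LINT x|lborel. g x)"
  obtain A K where AK: "A \<ge> 0" "K \<ge> 0" "\<And>n x. x \<ge> 2 \<Longrightarrow> conv_seq r n x \<le> A * K ^ n * g x"
    using conv_seq_asymptotics(2)[OF assms] by blast
  let ?a = "\<lambda>n x. conv_seq r n x / g x / fact (Suc n)"
  have "((\<lambda>x. \<Sum>n. ?a n x) \<longlongrightarrow> (\<Sum>n. real (Suc n) * lam ^ n * q / fact (Suc n))) at_top"
  proof (rule conjunct2[OF conjunct2[OF tannerys_theorem]])
    show "((\<lambda>x. ?a n x) \<longlongrightarrow> real (Suc n) * lam ^ n * q / fact (Suc n)) at_top" for n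
      unfolding lam_def by (intro tendsto_divide conv_seq_asymptotics(1)[OF assms] tendsto_const fact_nonzero)
    show "summable (\<lambda>n. A * (K ^ n / fact n))"
      using exp_sums_divide_fact[of K] by (intro summable_mult) (simp add: sums_iff)
    have "norm (?a n x) \<le> A * (K ^ n / fact n)" if "x \<ge> 2" for n x
    proof -
      have "conv_seq r n x / g x \<le> A * K ^ n"
        using AK(3)[OF that] g_pos[OF that] by (simp add: divide_le_eq)
      then have "?a n x \<le> A * K ^ n / fact n"
        using AK conv_seq(2)[OF r] g_pos[OF that] by (intro frac_le) (auto simp: fact_mono)
      then show ?thesis using conv_seq(2)[OF r, of n x] g_pos[OF that] by (simp del: fact_Suc)
    qed
    then show "\<forall>\<^sub>F (n, x) in at_top \<times>\<^sub>F at_top. norm (?a n x) \<le> A * (K ^ n / fact n)"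
      unfolding eventually_prod_filter
      by (intro exI[of _ "\<lambda>_. True"] exI[of _ "\<lambda>x. x \<ge> 2"]) auto
  qed simp
  moreover have "(\<Sum>n. ?a n x) = conv_exp r x / g x" for x
  proof -
    have "(\<lambda>n. conv_seq r n x / fact (Suc n) / g x) sums (conv_exp r x / g x)"
      by (intro sums_divide conv_exp_sums[OF r])
    then show ?thesis by (simp add: sums_iff mult.commute)
  qed
  moreover have "(\<Sum>n. real (Suc n) * lam ^ n * q / fact (Suc n)) = q * exp lam"
  proof -
    have "real (Suc n) * lam ^ n * q / fact (Suc n) = q * (lam ^ n / fact n)" for n
      by (simp add: field_simps del: of_nat_Suc)
    then show ?thesis
      using sums_unique[OF sums_mult[OF exp_sums_divide_fact[of lam], of q]] by (simp only:)
  qed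
  ultimately show ?thesis by (simp only: lam_def)
qed

end

section \<open>Tilting, and recovering a density from its interval masses\<close>

context subexponential_density begin

definition measure_conv_g :: "real measure \<Rightarrow> real \<Rightarrow> real" where
  "measure_conv_g N x = (LINT y|N. g (x - y))"

lemma measure_conv_g:
  assumes "finite_measure N" and [measurable_cong]: "sets N = sets borel"
  defines "r \<equiv> measure_conv_g N"
  shows "r \<in> borel_measurable borel" "0 \<le> r x" "integrable lborel r" "r x \<le> B0 * measure N UNIV"
    "(LINT x|lborel. r x) = measure N UNIV * (LINT x|lborel. g x)"
    "ennreal (r x) = (\<integral>\<^sup>+y. ennreal (g (x - y)) \<partial>N)"
proof -
  interpret finite_measure N by fact
  interpret NL: pair_sigma_finite N lborel ..
  have [simp]: "space N = UNIV" using sets_eq_imp_space_eq[OF assms(2)] by simp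
  have int: "integrable N (\<lambda>y. g (x - y))" for x
    by (rule integrable_const_bound[of _ B0]) (use g_nonneg g_bounded in auto)
  show m [measurable]: "r \<in> borel_measurable borel"
    unfolding r_def measure_conv_g_def[abs_def] by measurable
  show r0: "0 \<le> r x" for x unfolding r_def measure_conv_g_def using g_nonneg by simp
  have "r x \<le> (LINT y|N. B0)" unfolding r_def measure_conv_g_def by (rule integral_mono[OF int]) (auto simp: g_bounded)
  then show "r x \<le> B0 * measure N UNIV" by (simp add: mult.commute)
  show nn: "ennreal (r x) = (\<integral>\<^sup>+y. ennreal (g (x - y)) \<partial>N)" for x
    unfolding r_def measure_conv_g_def using int[of x] g_nonneg by (subst nn_integral_eq_integral) auto
  have "(\<integral>\<^sup>+x. ennreal (r x) \<partial>lborel) = (\<integral>\<^sup>+x. (\<integral>\<^sup>+y. ennreal (g (x - y)) \<partial>N) \<partial>lborel)"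
    unfolding nn ..
  also have "\<dots> = (\<integral>\<^sup>+y. (\<integral>\<^sup>+x. ennreal (g (x - y)) \<partial>lborel) \<partial>N)"
    by (rule NL.Fubini') measurable
  also have "\<dots> = (\<integral>\<^sup>+y. ennreal (LINT x|lborel. g x) \<partial>N)"
  proof (intro nn_integral_cong)
    fix y :: real
    have "(\<integral>\<^sup>+x. ennreal (g (x - y)) \<partial>lborel) = (\<integral>\<^sup>+x. ennreal (g x) \<partial>lborel)"
      using nn_integral_real_affine[of "\<lambda>x. ennreal (g x)" 1 "-y"] by simp
    also have "\<dots> = ennreal (LINT x|lborel. g x)"
      using g_integrable g_nonneg by (intro nn_integral_eq_integral) auto
    finally show "(\<integral>\<^sup>+x. ennreal (g (x - y)) \<partial>lborel) = ennreal (LINT x|lborel. g x)" .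
  qed
  also have "\<dots> = ennreal (measure N UNIV * (LINT x|lborel. g x))"
    using g_nonneg by (simp add: emeasure_eq_measure ennreal_mult mult.commute)
  finally have tot: "(\<integral>\<^sup>+x. ennreal (r x) \<partial>lborel) = ennreal (measure N UNIV * (LINT x|lborel. g x))" .
  then show i: "integrable lborel r"
    using r0 by (intro integrableI_nonneg) auto
  show "(LINT x|lborel. r x) = measure N UNIV * (LINT x|lborel. g x)"
    using tot r0 g_nonneg by (subst (asm) nn_integral_eq_integral[OF i]) auto
qed

text \<open>The exponential is multiplicative on sums, so tilting commutes with convolution:
  \<open>Q\<close> becomes the tilted measure and every \<open>w\<close> becomes \<open>g\<close>.
  The index starts at one jump because only then is a density guaranteed.\<close>

lemma tilted_conv_iter:
  fixes w :: "real \<Rightarrow> real" and F :: "real \<Rightarrow> ennreal"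
  assumes Q: "finite_measure Q" and Qs [measurable_cong]: "sets Q = sets borel"
    and w: "integrable lborel w" and w0: "\<And>x. 0 \<le> w x"
    and gw: "\<And>x. g x = exp (\<gamma> * x) * w x"
    and N: "finite_measure (density Q (\<lambda>y. ennreal (exp (\<gamma> * y))))"
    and F: "F \<in> borel_measurable borel"
  defines "r \<equiv> measure_conv_g (density Q (\<lambda>y. ennreal (exp (\<gamma> * y))))"
  shows "(\<integral>\<^sup>+u. F u * ennreal (exp (\<gamma> * u)) \<partial>conv_iter Q (density lborel (\<lambda>x. ennreal (w x))) (Suc n)) =
    (\<integral>\<^sup>+u. F u * ennreal (conv_seq r n u) \<partial>lborel)"
  using F
proof (induction n arbitrary: F)
  case 0
  note [measurable] = 0
  have [measurable]: "w \<in> borel_measurable borel" using w by auto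
  let ?D = "density lborel (\<lambda>x. ennreal (w x))"
  let ?N = "density Q (\<lambda>y. ennreal (exp (\<gamma> * y)))"
  have D: "finite_measure ?D" by (rule finite_measure_density_real[OF w])
  interpret Q: finite_measure Q by fact
  interpret QL: pair_sigma_finite Q lborel ..
  note rp = measure_conv_g[OF N, folded r_def]
  have "(\<integral>\<^sup>+u. F u * ennreal (exp (\<gamma> * u)) \<partial>conv_iter Q ?D (Suc 0)) =
      (\<integral>\<^sup>+x. (\<integral>\<^sup>+y. F (x + y) * ennreal (exp (\<gamma> * (x + y))) \<partial>?D) \<partial>Q)"
    by (simp add: nn_integral_convolution Q D Qs)
  also have "\<dots> = (\<integral>\<^sup>+x. (\<integral>\<^sup>+z. F z * (ennreal (exp (\<gamma> * x)) * ennreal (g (z - x))) \<partial>lborel) \<partial>Q)"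
  proof (intro nn_integral_cong)
    fix x :: real
    have "(\<integral>\<^sup>+y. F (x + y) * ennreal (exp (\<gamma> * (x + y))) \<partial>?D) =
        (\<integral>\<^sup>+y. F (x + y) * (ennreal (exp (\<gamma> * x)) * ennreal (g ((x + y) - x))) \<partial>lborel)"
      using w0 by (subst nn_integral_density)
        (auto simp: gw exp_add ring_distribs ennreal_mult' mult_ac intro!: nn_integral_cong)
    also have "\<dots> = (\<integral>\<^sup>+z. F z * (ennreal (exp (\<gamma> * x)) * ennreal (g (z - x))) \<partial>lborel)"
      using nn_integral_real_affine[of "\<lambda>z. F z * (ennreal (exp (\<gamma> * x)) * ennreal (g (z - x)))" 1 x] by simp
    finally show "(\<integral>\<^sup>+y. F (x + y) * ennreal (exp (\<gamma> * (x + y))) \<partial>?D) =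
       (\<integral>\<^sup>+z. F z * (ennreal (exp (\<gamma> * x)) * ennreal (g (z - x))) \<partial>lborel)" .
  qed
  also have "\<dots> = (\<integral>\<^sup>+z. (\<integral>\<^sup>+x. F z * (ennreal (exp (\<gamma> * x)) * ennreal (g (z - x))) \<partial>Q) \<partial>lborel)"
    by (rule QL.Fubini'[symmetric]) measurable
  also have "\<dots> = (\<integral>\<^sup>+z. F z * ennreal (r z) \<partial>lborel)"
  proof (intro nn_integral_cong)
    fix z :: real
    have "(\<integral>\<^sup>+x. F z * (ennreal (exp (\<gamma> * x)) * ennreal (g (z - x))) \<partial>Q) =
        F z * (\<integral>\<^sup>+x. ennreal (exp (\<gamma> * x)) * ennreal (g (z - x)) \<partial>Q)"
      by (rule nn_integral_cmult) measurable
    also have "(\<integral>\<^sup>+x. ennreal (exp (\<gamma> * x)) * ennreal (g (z - x)) \<partial>Q) = ennreal (r z)"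
      using rp(6)[of z] by (simp add: nn_integral_density Qs)
    finally show "(\<integral>\<^sup>+x. F z * (ennreal (exp (\<gamma> * x)) * ennreal (g (z - x))) \<partial>Q) = F z * ennreal (r z)" .
  qed
  finally show ?case by simp
next
  case (Suc n)
  note [measurable] = Suc.prems
  have [measurable]: "w \<in> borel_measurable borel" using w by auto
  let ?D = "density lborel (\<lambda>x. ennreal (w x))"
  let ?R = "conv_iter Q ?D (Suc n)"
  have D: "finite_measure ?D" by (rule finite_measure_density_real[OF w])
  have R: "finite_measure ?R" by (rule finite_measure_conv_iter) (auto simp: Q D Qs)
  have Rs [measurable_cong]: "sets ?R = sets borel" by (rule sets_conv_iter[OF Qs])
  note rp = measure_conv_g[OF N, folded r_def]
  have Ns: "sets (density Q (\<lambda>y. ennreal (exp (\<gamma> * y)))) = sets borel" by (simp add: Qs)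
  note cs = conv_seq[OF rp(1)[OF Ns] rp(2)[OF Ns] rp(3)[OF Ns] rp(4)[OF Ns]]
  note [measurable] = cs(1)[of n]
  have "(\<integral>\<^sup>+u. F u * ennreal (exp (\<gamma> * u)) \<partial>conv_iter Q ?D (Suc (Suc n))) =
      (\<integral>\<^sup>+x. (\<integral>\<^sup>+y. F (x + y) * ennreal (exp (\<gamma> * (x + y))) \<partial>?D) \<partial>?R)"
    unfolding conv_iter.simps(2)[of _ _ "Suc n"]
    by (rule nn_integral_convolution[OF R D _ Rs]) auto
  also have "\<dots> = (\<integral>\<^sup>+x. (\<integral>\<^sup>+y. F (x + y) * ennreal (g y) \<partial>lborel) * ennreal (exp (\<gamma> * x)) \<partial>?R)"
  proof (intro nn_integral_cong)
    fix x :: real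
    have "(\<integral>\<^sup>+y. F (x + y) * ennreal (exp (\<gamma> * (x + y))) \<partial>?D) =
        (\<integral>\<^sup>+y. F (x + y) * ennreal (g y) * ennreal (exp (\<gamma> * x)) \<partial>lborel)"
      using w0 by (subst nn_integral_density)
        (auto simp: gw exp_add ring_distribs ennreal_mult' mult_ac intro!: nn_integral_cong)
    also have "\<dots> = (\<integral>\<^sup>+y. F (x + y) * ennreal (g y) \<partial>lborel) * ennreal (exp (\<gamma> * x))"
      by (rule nn_integral_multc) measurable
    finally show "(\<integral>\<^sup>+y. F (x + y) * ennreal (exp (\<gamma> * (x + y))) \<partial>?D) =
      (\<integral>\<^sup>+y. F (x + y) * ennreal (g y) \<partial>lborel) * ennreal (exp (\<gamma> * x))" .
  qed
  \<comment> \<open>The induction hypothesis is applied with the inner integral as the new test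
    function, which is why \<open>F\<close> is kept arbitrary.\<close>
  also have "\<dots> = (\<integral>\<^sup>+x. (\<integral>\<^sup>+y. F (x + y) * ennreal (g y) \<partial>lborel) * ennreal (conv_seq r n x) \<partial>lborel)"
    by (rule Suc.IH) measurable
  also have "\<dots> = (\<integral>\<^sup>+x. (\<integral>\<^sup>+y. F (x + y) * (ennreal (g y) * ennreal (conv_seq r n x)) \<partial>lborel) \<partial>lborel)"
    by (simp add: nn_integral_multc[symmetric] mult.assoc)
  also have "\<dots> = (\<integral>\<^sup>+y. (\<integral>\<^sup>+x. F (x + y) * (ennreal (g y) * ennreal (conv_seq r n x)) \<partial>lborel) \<partial>lborel)"
    by (rule lborel_pair.Fubini') measurable
  also have "\<dots> = (\<integral>\<^sup>+y. (\<integral>\<^sup>+u. F u * (ennreal (g y) * ennreal (conv_seq r n (u - y))) \<partial>lborel) \<partial>lborel)"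
  proof (rule nn_integral_cong)
    fix y :: real
    show "(\<integral>\<^sup>+x. F (x + y) * (ennreal (g y) * ennreal (conv_seq r n x)) \<partial>lborel) =
      (\<integral>\<^sup>+u. F u * (ennreal (g y) * ennreal (conv_seq r n (u - y))) \<partial>lborel)"
      using nn_integral_real_affine[of "\<lambda>u. F u * (ennreal (g y) * ennreal (conv_seq r n (u - y)))" 1 y]
      by (simp add: add.commute)
  qed
  also have "\<dots> = (\<integral>\<^sup>+u. (\<integral>\<^sup>+y. F u * (ennreal (g y) * ennreal (conv_seq r n (u - y))) \<partial>lborel) \<partial>lborel)"
    by (rule lborel_pair.Fubini') measurable
  also have "\<dots> = (\<integral>\<^sup>+u. F u * ennreal (conv_seq r (Suc n) u) \<partial>lborel)"
  proof (intro nn_integral_cong)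
    fix u :: real
    have "(\<integral>\<^sup>+y. F u * (ennreal (g y) * ennreal (conv_seq r n (u - y))) \<partial>lborel) =
        F u * (\<integral>\<^sup>+y. ennreal (g y) * ennreal (conv_seq r n (u - y)) \<partial>lborel)"
      by (rule nn_integral_cmult) measurable
    also have "(\<integral>\<^sup>+y. ennreal (g y) * ennreal (conv_seq r n (u - y)) \<partial>lborel) =
        (\<integral>\<^sup>+y. ennreal (conv_seq r n (u - y) * g y) \<partial>lborel)"
      using cs(2) g_nonneg by (intro nn_integral_cong) (simp add: ennreal_mult mult.commute)
    also have "\<dots> = ennreal (conv_seq r (Suc n) u)"
      using conv_g(4)[OF cs(1,2,3,4), of n u] by simp
    finally show "(\<integral>\<^sup>+y. F u * (ennreal (g y) * ennreal (conv_seq r n (u - y))) \<partial>lborel) = F u * ennreal (conv_seq r (Suc n) u)" .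
  qed
  finally show ?case .
qed

text \<open>
  Interval masses determine an antitone density up to shifts by \<open>d\<close>, which long-tailedness of \<open>g\<close>
  makes harmless as \<open>d\<close> tends to \<open>0\<close>. The tilted density itself need not be monotone.
\<close>

lemma tail_of_antimono_density:
  fixes f W :: "real \<Rightarrow> real"
  assumes \<gamma>: "\<gamma> \<ge> 0" and g_antimono: "\<And>x y. 2 \<le> x \<Longrightarrow> x \<le> y \<Longrightarrow> g y \<le> g x"
    and f0: "\<And>x. 0 \<le> f x" and f: "antimono_on {a..} f"
    and M: "M > 0" and W: "((\<lambda>x. W x / g x) \<longlongrightarrow> M) at_top"
    and K: "K \<ge> 0"
    and mass_ge: "\<And>x d. d > 0 \<Longrightarrow> (\<integral>\<^sup>+u\<in>{x<..x + d}. ennreal (W u) \<partial>lborel) \<le>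
       (\<integral>\<^sup>+u\<in>{x<..x + d}. ennreal (exp (\<gamma> * u) * f u) \<partial>lborel)"
    and mass_le: "\<And>x d. d > 0 \<Longrightarrow> (\<integral>\<^sup>+u\<in>{x<..x + d}. ennreal (exp (\<gamma> * u) * f u) \<partial>lborel) \<le>
       (\<integral>\<^sup>+u\<in>{x<..x + d}. ennreal (W u) \<partial>lborel) + ennreal (K * exp (- x))"
  shows "((\<lambda>x. exp (\<gamma> * x) * f x / g x) \<longlongrightarrow> M) at_top"
proof -
  have const: "(\<integral>\<^sup>+u\<in>{x<..x + d}. ennreal k \<partial>lborel) = ennreal (k * d)" if "d > 0" "k \<ge> 0" for x d k :: real
    using that by (simp add: nn_integral_cmult_indicator ennreal_mult)
  have shift: "((\<lambda>x. g (x - y) / g x) \<longlongrightarrow> 1) at_top" for y by (rule g_long_tailed)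
  show ?thesis
  proof (rule order_tendstoI)
    fix b assume b: "b < M"
    \<comment> \<open>A single parameter \<open>d\<close> serves as the length of the interval and
      as the tolerance in \<open>W x / g x\<close>; the factor \<open>exp (- \<gamma> * d)\<close>
      pays for freezing the tilt at one endpoint.\<close>
    have "((\<lambda>d. exp (- \<gamma> * d) * (M - d)) \<longlongrightarrow> exp (- \<gamma> * 0) * (M - 0)) (at_right 0)"
      by (intro tendsto_intros)
    then have "\<forall>\<^sub>F d in at_right 0. b < exp (- \<gamma> * d) * (M - d)"
      using b by (intro order_tendstoD(1)) auto
    moreover have "\<forall>\<^sub>F d in at_right 0. d < M" using M by (intro order_tendstoD(2)[OF tendsto_ident_at])
    moreover have "\<forall>\<^sub>F d in at_right 0. (d::real) > 0" by (rule eventually_at_right_less)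
    ultimately have "\<forall>\<^sub>F d in at_right 0. b < exp (- \<gamma> * d) * (M - d) \<and> d < M \<and> d > 0"
      by eventually_elim auto
    then obtain d where d: "b < exp (- \<gamma> * d) * (M - d)" "d < M" "d > 0"
      using eventually_happens[of _ "at_right (0::real)"] by auto
    have "\<forall>\<^sub>F x in at_top. M - d < W x / g x" using W d by (intro order_tendstoD(1)) auto
    then obtain X where X: "\<And>x. x \<ge> X \<Longrightarrow> M - d < W x / g x" by (auto simp: eventually_at_top_linorder)
    have "((\<lambda>x. exp (- \<gamma> * d) * (M - d) * (g (x - (- d)) / g x)) \<longlongrightarrow> exp (- \<gamma> * d) * (M - d) * 1) at_top"
      by (intro tendsto_intros shift)
    then have "\<forall>\<^sub>F x in at_top. b < exp (- \<gamma> * d) * (M - d) * (g (x - (- d)) / g x)"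
      using d by (intro order_tendstoD(1)) auto
    then show "\<forall>\<^sub>F x in at_top. b < exp (\<gamma> * x) * f x / g x"
      using eventually_ge_at_top[of "max 2 (max a X)"]
    proof eventually_elim
      case (elim x)
      then have x: "x \<ge> 2" "x \<ge> a" "x \<ge> X" by auto
      have gx: "g x > 0" using x g_pos by simp
      have "ennreal ((M - d) * g (x + d) * d) = (\<integral>\<^sup>+u\<in>{x<..x + d}. ennreal ((M - d) * g (x + d)) \<partial>lborel)"
        using d g_nonneg by (intro const[symmetric]) auto
      also have "\<dots> \<le> (\<integral>\<^sup>+u\<in>{x<..x + d}. ennreal (W u) \<partial>lborel)"
      proof (intro nn_integral_mono)
        fix u :: real
        have "(M - d) * g (x + d) \<le> W u" if u: "u \<in> {x<..x + d}"
        proof -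
          have "g u > 0" "g (x + d) \<le> g u" using u x by (auto intro: g_pos g_antimono)
          then have "(M - d) * g (x + d) \<le> (M - d) * g u" "(M - d) * g u < W u"
            using d X[of u] u x by (auto simp: less_divide_eq intro!: mult_left_mono)
          then show ?thesis by linarith
        qed
        then show "ennreal ((M - d) * g (x + d)) * indicator {x<..x + d} u \<le> ennreal (W u) * indicator {x<..x + d} u"
          by (auto split: split_indicator intro: ennreal_leI)
      qed
      also have "\<dots> \<le> (\<integral>\<^sup>+u\<in>{x<..x + d}. ennreal (exp (\<gamma> * u) * f u) \<partial>lborel)"
        by (rule mass_ge[OF d(3)])
      \<comment> \<open>To the right of \<open>x\<close> the density is at most \<open>f x\<close>,
        so the mass there bounds \<open>f x\<close> from below. The upper bound on
        \<open>f x\<close> correspondingly uses the interval to the left of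
        \<open>x\<close>.\<close>
      also have "\<dots> \<le> (\<integral>\<^sup>+u\<in>{x<..x + d}. ennreal (exp (\<gamma> * (x + d)) * f x) \<partial>lborel)"
      proof (intro nn_integral_mono)
        fix u :: real
        have "exp (\<gamma> * u) * f u \<le> exp (\<gamma> * (x + d)) * f x" if u: "u \<in> {x<..x + d}"
          using u x \<gamma> f0 monotone_onD[OF f, of x u]
          by (intro mult_mono) (auto intro: mult_left_mono)
        then show "ennreal (exp (\<gamma> * u) * f u) * indicator {x<..x + d} u \<le>
            ennreal (exp (\<gamma> * (x + d)) * f x) * indicator {x<..x + d} u"
          by (auto split: split_indicator intro: ennreal_leI)
      qed
      also have "\<dots> = ennreal (exp (\<gamma> * (x + d)) * f x * d)" using d f0 by (intro const) auto
      finally have "(M - d) * g (x + d) * d \<le> exp (\<gamma> * (x + d)) * f x * d"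
        using d f0 by (subst (asm) ennreal_le_iff) auto
      then have "(M - d) * g (x + d) \<le> exp (\<gamma> * d) * (exp (\<gamma> * x) * f x)"
        using d by (simp add: distrib_left exp_add mult_ac)
      then have "exp (- \<gamma> * d) * ((M - d) * g (x + d)) \<le> exp (- \<gamma> * d) * (exp (\<gamma> * d) * (exp (\<gamma> * x) * f x))"
        by (intro mult_left_mono) auto
      also have "\<dots> = exp (\<gamma> * x) * f x" by (simp add: mult.assoc[symmetric] exp_add[symmetric])
      finally have "exp (- \<gamma> * d) * (M - d) * (g (x - (- d)) / g x) \<le> exp (\<gamma> * x) * f x / g x"
        using gx by (simp add: divide_right_mono mult.assoc)
      with elim(1) show ?case by linarith
    qed
  next
    fix b assume b: "M < b"
    have "((\<lambda>d. exp (\<gamma> * d) * (M + d)) \<longlongrightarrow> exp (\<gamma> * 0) * (M + 0)) (at_right 0)"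
      by (intro tendsto_intros)
    then have "\<forall>\<^sub>F d in at_right 0. exp (\<gamma> * d) * (M + d) < b"
      using b by (intro order_tendstoD(2)) auto
    moreover have "\<forall>\<^sub>F d in at_right 0. (d::real) > 0" by (rule eventually_at_right_less)
    ultimately have "\<forall>\<^sub>F d in at_right 0. exp (\<gamma> * d) * (M + d) < b \<and> d > 0"
      by eventually_elim auto
    then obtain d where d: "exp (\<gamma> * d) * (M + d) < b" "d > 0"
      using eventually_happens[of _ "at_right (0::real)"] by auto
    have "\<forall>\<^sub>F x in at_top. W x / g x < M + d" using W d by (intro order_tendstoD(2)) auto
    then obtain X where X: "\<And>x. x \<ge> X \<Longrightarrow> W x / g x < M + d" by (auto simp: eventually_at_top_linorder)
    \<comment> \<open>In the error term \<open>exp d\<close> comes from evaluating the exponential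
      at the left endpoint \<open>x - d\<close>, and \<open>1 / d\<close> from dividing the mass by
      the length. Heaviness of \<open>g\<close> removes it for fixed \<open>d\<close>.\<close>
    have "((\<lambda>x. exp (\<gamma> * d) * (M + d) * (g (x - d) / g x) + exp (\<gamma> * d) * K * exp d / d * (exp (- (1 * x)) / g x)) \<longlongrightarrow>
        exp (\<gamma> * d) * (M + d) * 1 + exp (\<gamma> * d) * K * exp d / d * 0) at_top"
      by (intro tendsto_add tendsto_mult tendsto_const shift g_heavy) simp
    then have "\<forall>\<^sub>F x in at_top. exp (\<gamma> * d) * (M + d) * (g (x - d) / g x) + exp (\<gamma> * d) * K * exp d / d * (exp (- (1 * x)) / g x) < b"
      using d by (intro order_tendstoD(2)) auto
    then show "\<forall>\<^sub>F x in at_top. exp (\<gamma> * x) * f x / g x < b"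
      using eventually_ge_at_top[of "max 2 (max a X) + d"]
    proof eventually_elim
      case (elim x)
      then have x: "x - d \<ge> 2" "x - d \<ge> a" "x - d \<ge> X" "x \<ge> 2" "x \<ge> a" using d by auto
      have gx: "g x > 0" using x g_pos by simp
      have x': "x - d + d = x" by simp
      have "ennreal (exp (\<gamma> * (x - d)) * f x * d) = (\<integral>\<^sup>+u\<in>{x - d<..x}. ennreal (exp (\<gamma> * (x - d)) * f x) \<partial>lborel)"
        using d f0 const[of d "exp (\<gamma> * (x - d)) * f x" "x - d"] by simp
      also have "\<dots> \<le> (\<integral>\<^sup>+u\<in>{x - d<..x}. ennreal (exp (\<gamma> * u) * f u) \<partial>lborel)"
      proof (intro nn_integral_mono)
        fix u :: real
        have "exp (\<gamma> * (x - d)) * f x \<le> exp (\<gamma> * u) * f u" if u: "u \<in> {x - d<..x}"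
          using u x \<gamma> f0 monotone_onD[OF f, of u x]
          by (intro mult_mono) (auto intro: mult_left_mono)
        then show "ennreal (exp (\<gamma> * (x - d)) * f x) * indicator {x - d<..x} u \<le>
            ennreal (exp (\<gamma> * u) * f u) * indicator {x - d<..x} u"
          by (auto split: split_indicator intro: ennreal_leI)
      qed
      also have "\<dots> \<le> (\<integral>\<^sup>+u\<in>{x - d<..x}. ennreal (W u) \<partial>lborel) + ennreal (K * exp (- (x - d)))"
        using mass_le[OF d(2), of "x - d"] by simp
      also have "(\<integral>\<^sup>+u\<in>{x - d<..x}. ennreal (W u) \<partial>lborel) \<le> (\<integral>\<^sup>+u\<in>{x - d<..x}. ennreal ((M + d) * g (x - d)) \<partial>lborel)"
      proof (intro nn_integral_mono)
        fix u :: real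
        have "W u \<le> (M + d) * g (x - d)" if u: "u \<in> {x - d<..x}"
        proof -
          have "g u > 0" "g u \<le> g (x - d)" using u x by (auto intro: g_pos g_antimono)
          then have "(M + d) * g u \<le> (M + d) * g (x - d)" "W u < (M + d) * g u"
            using d X[of u] u x M by (auto simp: divide_less_eq intro!: mult_left_mono)
          then show ?thesis by linarith
        qed
        then show "ennreal (W u) * indicator {x - d<..x} u \<le> ennreal ((M + d) * g (x - d)) * indicator {x - d<..x} u"
          by (auto split: split_indicator intro: ennreal_leI)
      qed
      also have "\<dots> = ennreal ((M + d) * g (x - d) * d)"
        using d M g_nonneg const[of d "(M + d) * g (x - d)" "x - d"] by simp
      finally have "exp (\<gamma> * (x - d)) * f x * d \<le> (M + d) * g (x - d) * d + K * exp (- (x - d))"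
        using d M K g_nonneg by (auto simp: ennreal_plus[symmetric] simp del: ennreal_plus)
      then have "exp (\<gamma> * (x - d)) * f x \<le> (M + d) * g (x - d) + K * exp (- (x - d)) / d"
        using d by (simp add: field_simps)
      then have "exp (\<gamma> * d) * (exp (\<gamma> * (x - d)) * f x) \<le> exp (\<gamma> * d) * ((M + d) * g (x - d) + K * exp (- (x - d)) / d)"
        by (intro mult_left_mono) auto
      moreover have "exp (\<gamma> * d) * (exp (\<gamma> * (x - d)) * f x) = exp (\<gamma> * x) * f x"
        by (simp add: mult.assoc[symmetric] exp_add[symmetric] distrib_left[symmetric])
      ultimately have "exp (\<gamma> * x) * f x / g x \<le> exp (\<gamma> * d) * ((M + d) * g (x - d) + K * exp (- (x - d)) / d) / g x"
        using gx by (intro divide_right_mono) auto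
      also have "\<dots> = exp (\<gamma> * d) * (M + d) * (g (x - d) / g x) + exp (\<gamma> * d) * K * exp d / d * (exp (- (1 * x)) / g x)"
        using gx d by (simp add: field_simps exp_diff exp_minus)
      finally show ?case using elim(1) by linarith
    qed
  qed
qed

end

context subexponential_density begin

text \<open>The constant is computed twice, once as the limit of \<open>W x / g x\<close> and once
  as the exponential moment of the mixture. Both equal the moment \<open>q\<close> of
  \<open>Q\<close> times the exponential of the mass of \<open>g\<close> minus the mass of
  \<open>w\<close>.\<close>

lemma compound_poisson_tail:
  fixes f w :: "real \<Rightarrow> real"
  assumes \<gamma>: "\<gamma> \<ge> 0" and g_antimono: "\<And>x y. 2 \<le> x \<Longrightarrow> x \<le> y \<Longrightarrow> g y \<le> g x"
    and Q: "real_distribution Q" "\<And>\<theta>. \<theta> \<ge> 0 \<Longrightarrow> (\<integral>\<^sup>+x. ennreal (exp (\<theta> * x)) \<partial>Q) < \<infinity>"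
    and w: "integrable lborel w" and w0: "\<And>x. 0 \<le> w x"
    and gw: "\<And>x. g x = exp (\<gamma> * x) * w x"
    and \<mu>: "\<And>f. f \<in> borel_measurable borel \<Longrightarrow> (\<integral>\<^sup>+x. f x \<partial>\<mu>) =
       (\<Sum>n. ennreal (exp (- (LINT x|lborel. w x)) / fact n) *
         (\<integral>\<^sup>+x. f x \<partial>conv_iter Q (density lborel (\<lambda>x. ennreal (w x))) n))"
    and f: "\<mu> = density lborel (\<lambda>x. ennreal (f x))" "f \<in> borel_measurable borel" "\<And>x. 0 \<le> f x" "antimono_on {a..} f"
  obtains M where "M > 0" "(\<integral>\<^sup>+x. ennreal (exp (\<gamma> * x)) \<partial>\<mu>) = ennreal M"
    "((\<lambda>x. exp (\<gamma> * x) * f x / g x) \<longlongrightarrow> M) at_top"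
proof -
  interpret Q: real_distribution Q by (rule Q)
  note [measurable] = f(2)
  have [measurable]: "w \<in> borel_measurable borel" using w by auto
  define D where "D = density lborel (\<lambda>x. ennreal (w x))"
  define N where "N = density Q (\<lambda>y. ennreal (exp (\<gamma> * y)))"
  define r where "r = measure_conv_g N"
  define lam where "lam = (LINT x|lborel. w x)"
  define q where "q = measure N UNIV"
  define M where "M = exp (- lam) * (q * exp (LINT x|lborel. g x))"
  define W where "W x = exp (- lam) * conv_exp r x" for x
  have Ns [measurable_cong]: "sets N = sets borel" by (simp add: N_def)
  have NU: "emeasure N UNIV = (\<integral>\<^sup>+x. ennreal (exp (\<gamma> * x)) \<partial>Q)"
    unfolding N_def by (simp add: emeasure_density)
  have N: "finite_measure N"
    using Q(2)[OF \<gamma>] sets_eq_imp_space_eq[OF Ns] by (intro finite_measureI) (simp add: NU)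
  interpret N: finite_measure N by (rule N)
  have qe: "(\<integral>\<^sup>+x. ennreal (exp (\<gamma> * x)) \<partial>Q) = ennreal q"
    using NU by (simp add: q_def N.emeasure_eq_measure)
  have q: "q > 0"
  proof (rule ccontr)
    assume "\<not> q > 0"
    then have "(\<integral>\<^sup>+x. ennreal (exp (\<gamma> * x)) \<partial>Q) = 0" using qe by (simp add: ennreal_neg)
    then have "AE x in Q. ennreal (exp (\<gamma> * x)) = 0" by (subst (asm) nn_integral_0_iff_AE) auto
    then have "AE x in Q. False" by simp
    then show False by simp
  qed
  \<comment> \<open>Order \<open>\<gamma> + 1\<close> leaves one unit of exponential decay after
    tilting: Markov's inequality bounds the tail of \<open>N\<close> by
    \<open>K * exp (- x)\<close>.\<close>
  define K where "K = enn2real (\<integral>\<^sup>+x. ennreal (exp ((\<gamma> + 1) * x)) \<partial>Q)"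
  have K: "(\<integral>\<^sup>+x. ennreal (exp ((\<gamma> + 1) * x)) \<partial>Q) = ennreal K" "K \<ge> 0"
    using Q(2)[of "\<gamma> + 1"] \<gamma> by (auto simp: K_def less_top)
  have tailN: "emeasure N {x<..} \<le> ennreal (K * exp (- x))" for x
  proof -
    have "emeasure N {x<..} = (\<integral>\<^sup>+u. ennreal (exp (\<gamma> * u)) * indicator {x<..} u \<partial>Q)"
      unfolding N_def by (simp add: emeasure_density)
    also have "\<dots> \<le> (\<integral>\<^sup>+u. ennreal (exp (- x)) * ennreal (exp ((\<gamma> + 1) * u)) \<partial>Q)"
    proof (intro nn_integral_mono)
      fix u :: real
      have "exp (\<gamma> * u) \<le> exp (- x) * exp ((\<gamma> + 1) * u)" if "u > x"
        using that by (simp add: exp_add[symmetric] algebra_simps)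
      then show "ennreal (exp (\<gamma> * u)) * indicator {x<..} u \<le> ennreal (exp (- x)) * ennreal (exp ((\<gamma> + 1) * u))"
        by (auto simp: ennreal_mult'[symmetric] split: split_indicator intro: ennreal_leI)
    qed
    also have "\<dots> = ennreal (K * exp (- x))"
      using K by (simp add: nn_integral_cmult ennreal_mult' mult.commute)
    finally show ?thesis .
  qed
  have light: "measure N {x<..} \<le> K * exp (- (1 * x))" for x
    using tailN[of x] K(2) by (simp add: N.emeasure_eq_measure)
  note rp = measure_conv_g[OF N Ns, folded r_def]
  note cs = conv_seq[OF rp(1,2,3,4)]
  have rlim: "((\<lambda>x. r x / g x) \<longlongrightarrow> q) at_top"
    using light_convolution(1)[OF N Ns zero_less_one light] unfolding r_def measure_conv_g_def[abs_def] q_def .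
  obtain B where B: "\<And>x. x \<ge> 2 \<Longrightarrow> r x \<le> B * g x"
    using light_convolution(2)[OF N Ns zero_less_one light] unfolding r_def measure_conv_g_def[abs_def] by blast
  have rint: "(LINT x|lborel. r x) = q * (LINT x|lborel. g x)"
    unfolding q_def by (rule rp(5))
  have Wlim: "((\<lambda>x. W x / g x) \<longlongrightarrow> M) at_top"
    unfolding W_def M_def times_divide_eq_right[symmetric]
    by (intro tendsto_mult tendsto_const conv_exp_asymptotics[OF rp(1,2,3,4) B rlim rint])
  have M: "M > 0" using q by (simp add: M_def)
  \<comment> \<open>The jump-free term is split off as the measure \<open>N\<close>, for which no
    density is claimed; all other terms are collected into the density \<open>W\<close>.\<close>
  have formula: "(\<integral>\<^sup>+u. F u * ennreal (exp (\<gamma> * u)) \<partial>\<mu>) =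
      (\<integral>\<^sup>+u. F u * ennreal (W u) \<partial>lborel) + ennreal (exp (- lam)) * (\<integral>\<^sup>+u. F u \<partial>N)"
    if F [measurable]: "F \<in> borel_measurable borel" for F
  proof -
    note [measurable] = cs(1)
    have "(\<integral>\<^sup>+u. F u * ennreal (exp (\<gamma> * u)) \<partial>\<mu>) =
       (\<Sum>n. ennreal (exp (- lam) / fact n) * (\<integral>\<^sup>+u. F u * ennreal (exp (\<gamma> * u)) \<partial>conv_iter Q D n))"
      unfolding lam_def D_def by (rule \<mu>) measurable
    also have "\<dots> = (\<Sum>n. ennreal (exp (- lam) / fact (Suc n)) * (\<integral>\<^sup>+u. F u * ennreal (exp (\<gamma> * u)) \<partial>conv_iter Q D (Suc n)))
       + ennreal (exp (- lam)) * (\<integral>\<^sup>+u. F u * ennreal (exp (\<gamma> * u)) \<partial>Q)"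
      by (subst suminf_offset[of _ 1]) simp_all
    also have "(\<integral>\<^sup>+u. F u * ennreal (exp (\<gamma> * u)) \<partial>Q) = (\<integral>\<^sup>+u. F u \<partial>N)"
      unfolding N_def by (simp add: nn_integral_density mult.commute)
    also have "(\<Sum>n. ennreal (exp (- lam) / fact (Suc n)) * (\<integral>\<^sup>+u. F u * ennreal (exp (\<gamma> * u)) \<partial>conv_iter Q D (Suc n))) =
       (\<Sum>n. \<integral>\<^sup>+u. F u * ennreal (exp (- lam) * (conv_seq r n u / fact (Suc n))) \<partial>lborel)"
    proof (intro suminf_cong)
      fix n
      have "(\<integral>\<^sup>+u. F u * ennreal (exp (\<gamma> * u)) \<partial>conv_iter Q D (Suc n)) = (\<integral>\<^sup>+u. F u * ennreal (conv_seq r n u) \<partial>lborel)"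
        unfolding D_def r_def N_def
        by (rule tilted_conv_iter[OF Q.finite_measure_axioms _ w w0 gw N[unfolded N_def] F]) simp
      then show "ennreal (exp (- lam) / fact (Suc n)) * (\<integral>\<^sup>+u. F u * ennreal (exp (\<gamma> * u)) \<partial>conv_iter Q D (Suc n)) =
          (\<integral>\<^sup>+u. F u * ennreal (exp (- lam) * (conv_seq r n u / fact (Suc n))) \<partial>lborel)"
        using cs(2)[of n]
        by (simp add: nn_integral_cmult[symmetric] ennreal_mult'[symmetric] mult.left_commute[of _ "F _"] del: fact_Suc)
    qed
    also have "\<dots> = (\<integral>\<^sup>+u. (\<Sum>n. F u * ennreal (exp (- lam) * (conv_seq r n u / fact (Suc n)))) \<partial>lborel)"
      by (rule nn_integral_suminf[symmetric]) measurable
    also have "\<dots> = (\<integral>\<^sup>+u. F u * ennreal (W u) \<partial>lborel)"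
    proof (rule nn_integral_cong)
      fix u :: real
      have "(\<lambda>n. exp (- lam) * (conv_seq r n u / fact (Suc n))) sums W u"
        unfolding W_def by (intro sums_mult conv_exp_sums[OF rp(1,2,3,4)])
      then have "(\<Sum>n. ennreal (exp (- lam) * (conv_seq r n u / fact (Suc n)))) = ennreal (W u)"
        using cs(2) by (intro suminf_ennreal_eq) auto
      then show "(\<Sum>n. F u * ennreal (exp (- lam) * (conv_seq r n u / fact (Suc n)))) = F u * ennreal (W u)"
        by (simp only: ennreal_suminf_cmult)
    qed
    finally show ?thesis .
  qed
  have dens: "(\<integral>\<^sup>+u. F u * ennreal (exp (\<gamma> * u)) \<partial>\<mu>) = (\<integral>\<^sup>+u. ennreal (exp (\<gamma> * u) * f u) * F u \<partial>lborel)"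
    if [measurable]: "F \<in> borel_measurable borel" for F
    unfolding f(1) using f(3)
    by (subst nn_integral_density) (auto simp: ennreal_mult mult_ac intro!: nn_integral_cong)
  have mass: "(\<integral>\<^sup>+u\<in>A. ennreal (exp (\<gamma> * u) * f u) \<partial>lborel) =
      (\<integral>\<^sup>+u\<in>A. ennreal (W u) \<partial>lborel) + ennreal (exp (- lam)) * emeasure N A" if [measurable]: "A \<in> sets borel" for A
    using formula[of "indicator A"] dens[of "indicator A"] that by (simp add: Ns mult.commute)
  have "((\<lambda>x. exp (\<gamma> * x) * f x / g x) \<longlongrightarrow> M) at_top"
  proof (rule tail_of_antimono_density[OF \<gamma> g_antimono f(3,4) M Wlim])
    show "0 \<le> exp (- lam) * K" using K by simp
    fix x d :: real
    show "(\<integral>\<^sup>+u\<in>{x<..x + d}. ennreal (W u) \<partial>lborel) \<le> (\<integral>\<^sup>+u\<in>{x<..x + d}. ennreal (exp (\<gamma> * u) * f u) \<partial>lborel)"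
      by (subst mass) simp_all
    have "emeasure N {x<..x + d} \<le> emeasure N {x<..}"
      by (intro emeasure_mono) (auto simp: Ns)
    also note tailN
    finally have "ennreal (exp (- lam)) * emeasure N {x<..x + d} \<le> ennreal (exp (- lam)) * ennreal (K * exp (- x))"
      by (rule mult_left_mono) simp
    then show "(\<integral>\<^sup>+u\<in>{x<..x + d}. ennreal (exp (\<gamma> * u) * f u) \<partial>lborel) \<le>
       (\<integral>\<^sup>+u\<in>{x<..x + d}. ennreal (W u) \<partial>lborel) + ennreal (exp (- lam) * K * exp (- x))"
      by (subst mass) (auto simp: ennreal_mult'[symmetric] mult.assoc intro: add_left_mono)
  qed
  moreover have "(\<integral>\<^sup>+x. ennreal (exp (\<gamma> * x)) \<partial>\<mu>) = ennreal M"
  proof -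
    have we: "integrable lborel (\<lambda>x. w x * exp (\<gamma> * x))"
      using g_integrable unfolding gw[abs_def] by (simp add: mult.commute)
    have "(\<integral>\<^sup>+x. ennreal (exp (\<gamma> * x)) \<partial>\<mu>) = ennreal q * ennreal (exp (LINT x|lborel. w x * (exp (\<gamma> * x) - 1)))"
      unfolding qe[symmetric]
      by (rule nn_integral_exp_compound_poisson[OF Q(1) w w0 _ we]) (rule \<mu>)
    also have "(LINT x|lborel. w x * (exp (\<gamma> * x) - 1)) = (LINT x|lborel. g x) - lam"
      using w we by (simp add: right_diff_distrib lam_def gw mult.commute)
    also have "ennreal q * ennreal (exp ((LINT x|lborel. g x) - lam)) = ennreal M"
      using q by (simp add: ennreal_mult'[symmetric] M_def exp_diff exp_minus divide_inverse mult_ac)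
    finally show ?thesis .
  qed
  ultimately show thesis using M that by blast
qed

end

section \<open>The tilted Levy density is subexponential\<close>

context thorin_transform begin

definition tilted_levy_density :: "real \<Rightarrow> real" where
  "tilted_levy_density x = L x / x * indicator {1<..} x"

lemma tilted_levy_density_antimono: "2 \<le> x \<Longrightarrow> x \<le> y \<Longrightarrow> tilted_levy_density y \<le> tilted_levy_density x"
  using L_nonneg by (auto simp: tilted_levy_density_def intro!: frac_le L_antimono)

lemma subexponential_tilted_levy_density:
  assumes s0: "s0 > 0" "D \<ge> 0" "\<And>s. 0 < s \<Longrightarrow> s < s0 \<Longrightarrow> measure T {..2 * s} \<le> D * measure T {..s}"
    and int: "integrable lborel tilted_levy_density"
  obtains C where "subexponential_density tilted_levy_density C (L 1)"
proof -
  obtain C where C: "C > 0" "\<And>x. x \<ge> 2 \<Longrightarrow> L (x / 2) \<le> C * L x"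
    using L_doubling[OF s0] by blast
  let ?g = tilted_levy_density
  \<comment> \<open>\<open>C\<close> controls halving the argument of \<open>L\<close>; the factor 2
    comes from halving the denominator \<open>x\<close>.\<close>
  have "subexponential_density ?g (2 * C) (L 1)"
  proof
    show "?g \<in> borel_measurable borel" unfolding tilted_levy_density_def[abs_def] by measurable
    show "0 \<le> ?g x" for x
      using L_nonneg by (auto simp: tilted_levy_density_def split: split_indicator)
    show "?g x \<le> L 1" for x
    proof (cases "x > 1")
      case True
      then have "L x / x \<le> L 1 / 1" using L_nonneg by (intro frac_le L_antimono) auto
      then show ?thesis using True by (simp add: tilted_levy_density_def)
    qed (simp add: tilted_levy_density_def L_nonneg)
    show "?g x > 0" if "x \<ge> 2" for x
      using that L_pos[of x] by (simp add: tilted_levy_density_def)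
    show "?g y \<le> 2 * C * ?g x" if "x \<ge> 2" "x / 2 \<le> y" for x y
    proof (cases "y > 1")
      case True
      have "L y / y \<le> L (x / 2) / (x / 2)" using that L_nonneg by (intro frac_le L_antimono) auto
      also have "\<dots> \<le> C * L x / (x / 2)" using that C by (intro divide_right_mono) auto
      finally show ?thesis using that True by (simp add: tilted_levy_density_def mult_ac)
    next
      case False
      then show ?thesis using that C L_nonneg[of x] by (simp add: tilted_levy_density_def)
    qed
    show "((\<lambda>x. ?g (x - y) / ?g x) \<longlongrightarrow> 1) at_top" for y
    proof -
      have "((\<lambda>x. x / (x - y)) \<longlongrightarrow> 1) at_top" by real_asymp
      from tendsto_mult[OF L_long_tailed[of y] this]
      have "((\<lambda>x. L (x - y) / L x * (x / (x - y))) \<longlongrightarrow> 1) at_top" by simp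
      moreover have "\<forall>\<^sub>F x in at_top. L (x - y) / L x * (x / (x - y)) = ?g (x - y) / ?g x"
        using eventually_gt_at_top[of 1] eventually_gt_at_top[of "y + 1"]
        by eventually_elim (simp add: tilted_levy_density_def)
      ultimately show ?thesis by (rule Lim_transform_eventually)
    qed
    show "((\<lambda>x. exp (- (\<epsilon> * x)) / ?g x) \<longlongrightarrow> 0) at_top" if "\<epsilon> > 0" for \<epsilon>
    proof -
      \<comment> \<open>Half of the exponent absorbs the factor \<open>x\<close> from the
        denominator of the density, the other half beats \<open>L\<close>.\<close>
      have "((\<lambda>x. x * exp (- (\<epsilon> / 2 * x))) \<longlongrightarrow> 0) at_top" using that by real_asymp
      from tendsto_mult[OF this exp_over_L[of "\<epsilon> / 2"]] that
      have "((\<lambda>x. x * exp (- (\<epsilon> / 2 * x)) * (exp (- (\<epsilon> / 2 * x)) / L x)) \<longlongrightarrow> 0) at_top" by simp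
      moreover have "\<forall>\<^sub>F x in at_top. x * exp (- (\<epsilon> / 2 * x)) * (exp (- (\<epsilon> / 2 * x)) / L x) = exp (- (\<epsilon> * x)) / ?g x"
        using eventually_gt_at_top[of 1]
      proof eventually_elim
        case (elim x)
        have "exp (- (\<epsilon> * x)) = exp (- (\<epsilon> / 2 * x)) * exp (- (\<epsilon> / 2 * x))" by (simp add: exp_add[symmetric])
        then show ?case using elim by (simp add: tilted_levy_density_def)
      qed
      ultimately show ?thesis by (rule Lim_transform_eventually)
    qed
  qed (rule int)
  then show thesis by (rule that)
qed

end

section \<open>Thorin measures\<close>

text \<open>The complement is a union of possibly uncountably many null open sets; second
  countability reduces it to countably many.\<close>

lemma measure_support_compl_null:
  fixes M :: "'a :: second_countable_topology measure"
  assumes "sets M = sets borel"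
  shows "emeasure M (- measure_support M) = 0"
proof -
  define \<F> where "\<F> = {U. open U \<and> emeasure M U = 0}"
  obtain \<F>' where \<F>': "\<F>' \<subseteq> \<F>" "countable \<F>'" "\<Union>\<F>' = \<Union>\<F>"
    using Lindelof[of \<F>] by (auto simp: \<F>_def)
  have "- measure_support M = \<Union>\<F>"
    by (auto simp: measure_support_def \<F>_def zero_less_iff_neq_zero)
  moreover have "(\<Union>U\<in>\<F>'. U) \<in> null_sets M"
    using \<F>' assms by (intro null_sets_UN') (auto simp: \<F>_def null_sets_def)
  ultimately show ?thesis using \<F>' by auto
qed

lemma thorin_measureD:
  assumes "thorin_measure \<tau>"
  shows "sets \<tau> = sets borel" "emeasure \<tau> {..0} = 0" "emeasure \<tau> {0<..1} < \<infinity>"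
    "(\<integral>\<^sup>+s\<in>{1<..}. ennreal (1 / s\<^sup>2) \<partial>\<tau>) < \<infinity>" "AE s in \<tau>. 0 < s"
proof -
  show s [measurable_cong]: "sets \<tau> = sets borel" and n: "emeasure \<tau> {..0} = 0"
    using assms by (auto simp: thorin_measure_def)
  have "(\<integral>\<^sup>+s\<in>{0<..1}. ennreal (1 + \<bar>ln s\<bar>) \<partial>\<tau>) + (\<integral>\<^sup>+s\<in>{1<..}. ennreal (1 / s\<^sup>2) \<partial>\<tau>) < \<infinity>"
    using assms by (auto simp: thorin_measure_def)
  then have *: "(\<integral>\<^sup>+s\<in>{0<..1}. ennreal (1 + \<bar>ln s\<bar>) \<partial>\<tau>) < \<infinity>" "(\<integral>\<^sup>+s\<in>{1<..}. ennreal (1 / s\<^sup>2) \<partial>\<tau>) < \<infinity>"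
    by auto
  then show "(\<integral>\<^sup>+s\<in>{1<..}. ennreal (1 / s\<^sup>2) \<partial>\<tau>) < \<infinity>" by simp
  have "emeasure \<tau> {0<..1} = (\<integral>\<^sup>+s. indicator {0<..1} s \<partial>\<tau>)" by (simp add: s)
  also have "\<dots> \<le> (\<integral>\<^sup>+s\<in>{0<..1}. ennreal (1 + \<bar>ln s\<bar>) \<partial>\<tau>)"
    by (intro nn_integral_mono) (auto split: split_indicator)
  finally show "emeasure \<tau> {0<..1} < \<infinity>" using * by (auto intro: order_le_less_trans)
  show "AE s in \<tau>. 0 < s"
    by (rule AE_I[of _ _ "{..0}"]) (auto simp: n s not_less)
qed

text \<open>Up to 1 the mass is finite. Beyond 1 the quadratic lower bound on the exponential gives
  a multiple of \<open>1 / s\<^sup>2\<close>, exactly the integrability imposed at infinity.\<close>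

lemma thorin_measure_exp_finite:
  assumes \<tau>: "thorin_measure \<tau>" and x: "x > 0"
  shows "(\<integral>\<^sup>+s. ennreal (exp (- (s * x))) \<partial>\<tau>) < \<infinity>"
proof -
  note t = thorin_measureD[OF \<tau>]
  note [measurable_cong] = t(1)
  have "(\<integral>\<^sup>+s. ennreal (exp (- (s * x))) \<partial>\<tau>) \<le>
      (\<integral>\<^sup>+s. indicator {0<..1} s + ennreal (2 / x\<^sup>2) * (ennreal (1 / s\<^sup>2) * indicator {1<..} s) \<partial>\<tau>)"
  proof (rule nn_integral_mono_AE, use t(5) in \<open>rule eventually_mono\<close>)
    fix s :: real assume s: "0 < s"
    show "ennreal (exp (- (s * x))) \<le> indicator {0<..1} s + ennreal (2 / x\<^sup>2) * (ennreal (1 / s\<^sup>2) * indicator {1<..} s)"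
    proof (cases "s \<le> 1")
      case True
      have "exp (- (s * x)) \<le> 1" using s x by simp
      then show ?thesis using True s by simp
    next
      case False
      have "(s * x)\<^sup>2 / 2 \<le> exp (s * x)"
        using exp_lower_Taylor_quadratic[of "s * x"] mult_pos_pos[OF s x] by simp
      then have "exp (- (s * x)) \<le> 2 / x\<^sup>2 * (1 / s\<^sup>2)"
        using s x by (simp add: exp_minus field_simps)
      then have "ennreal (exp (- (s * x))) \<le> ennreal (2 / x\<^sup>2) * ennreal (1 / s\<^sup>2)"
        by (subst ennreal_mult'[symmetric]) (auto intro: ennreal_leI)
      then show ?thesis using False by simp
    qed
  qed
  also have "\<dots> = emeasure \<tau> {0<..1} + ennreal (2 / x\<^sup>2) * (\<integral>\<^sup>+s\<in>{1<..}. ennreal (1 / s\<^sup>2) \<partial>\<tau>)"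
    by (subst nn_integral_add) (auto simp: nn_integral_cmult t(1))
  also have "\<dots> < \<infinity>" using t(3,4) by (auto simp: ennreal_mult_less_top)
  finally show ?thesis .
qed

lemma sigma_finite_thorin_measure:
  assumes \<tau>: "thorin_measure \<tau>"
  shows "sigma_finite_measure \<tau>"
proof
  note t = thorin_measureD[OF \<tau>]
  note [measurable_cong] = t(1)
  have fin: "emeasure \<tau> {..real n} < \<infinity>" for n
  proof -
    have "ennreal (exp (- real n)) * emeasure \<tau> {..real n} = (\<integral>\<^sup>+s. ennreal (exp (- real n)) * indicator {..real n} s \<partial>\<tau>)"
      by (simp add: nn_integral_cmult_indicator t(1))
    also have "\<dots> \<le> (\<integral>\<^sup>+s. ennreal (exp (- (s * 1))) \<partial>\<tau>)"
      by (intro nn_integral_mono) (auto split: split_indicator intro: ennreal_leI)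
    also have "\<dots> < \<infinity>" by (rule thorin_measure_exp_finite[OF \<tau>]) simp
    finally show ?thesis by (auto simp: ennreal_mult_less_top)
  qed
  then show "\<exists>A. countable A \<and> A \<subseteq> sets \<tau> \<and> \<Union> A = space \<tau> \<and> (\<forall>a\<in>A. emeasure \<tau> a \<noteq> \<infinity>)"
    using sets_eq_imp_space_eq[OF t(1)] t(1)
    by (intro exI[of _ "range (\<lambda>n. {..real n})"]) (auto simp: less_top intro: real_arch_simple)
qed

lemma canonical_fun_pos:
  assumes \<tau>: "thorin_measure \<tau>p" and "x > 0"
  shows "canonical_fun \<tau>p \<tau>m x = (LINT s|\<tau>p. exp (- (s * x)))"
proof -
  note t = thorin_measureD[OF \<tau>]
  note [measurable_cong] = t(1)
  have "canonical_fun \<tau>p \<tau>m x = (LINT s|\<tau>p. indicator {0<..} s *\<^sub>R exp (- s * \<bar>x\<bar>))"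
    using assms(2) by (simp add: canonical_fun_def set_lebesgue_integral_def)
  also have "\<dots> = (LINT s|\<tau>p. exp (- (s * x)))"
    using t(5) assms(2) by (intro integral_cong_AE) (auto elim!: eventually_mono)
  finally show ?thesis .
qed

lemma canonical_fun_nonneg: "0 \<le> canonical_fun \<tau>p \<tau>m x"
  by (auto simp: canonical_fun_def set_lebesgue_integral_def)

lemma canonical_fun_uminus: "canonical_fun \<tau>m \<tau>p x = canonical_fun \<tau>p \<tau>m (- x)"
  by (auto simp: canonical_fun_def)

lemma canonical_fun_measurable:
  assumes "thorin_measure \<tau>p" "thorin_measure \<tau>m"
  shows "canonical_fun \<tau>p \<tau>m \<in> borel_measurable borel"
proof -
  interpret p: sigma_finite_measure \<tau>p by (rule sigma_finite_thorin_measure) fact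
  interpret m: sigma_finite_measure \<tau>m by (rule sigma_finite_thorin_measure) fact
  note [measurable_cong] = thorin_measureD(1)[OF assms(1)] thorin_measureD(1)[OF assms(2)]
  show ?thesis
    unfolding canonical_fun_def[abs_def] set_lebesgue_integral_def by measurable
qed

text \<open>A measure with empty support vanishes, so for nonzero \<tau> the infimum runs over a
  nonempty set bounded below and has its usual meaning. Mass just above the edge comes from a
  support point found there.\<close>

lemma thorin_edge:
  assumes \<tau>: "thorin_measure \<tau>" and nz: "\<tau> \<noteq> null_measure borel"
  shows "0 \<le> thorin_edge \<tau>" "emeasure \<tau> {..<thorin_edge \<tau>} = 0"
    "s > 0 \<Longrightarrow> emeasure \<tau> {..thorin_edge \<tau> + s} > 0"
proof -
  note t = thorin_measureD[OF \<tau>]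
  define S where "S = measure_support \<tau> \<inter> {0..}"
  have null: "emeasure \<tau> A = 0" if "A \<inter> measure_support \<tau> = {}" for A
  proof -
    have "emeasure \<tau> A \<le> emeasure \<tau> (- measure_support \<tau>)"
    proof (rule emeasure_mono)
      have "- measure_support \<tau> = \<Union>{U. open U \<and> emeasure \<tau> U = 0}"
        by (auto simp: measure_support_def zero_less_iff_neq_zero)
      then have "open (- measure_support \<tau>)" by auto
      then show "- measure_support \<tau> \<in> sets \<tau>" by (simp add: t(1))
    qed (use that in auto)
    then show ?thesis using measure_support_compl_null[OF t(1)] by simp
  qed
  have supp: "x \<ge> 0" if "x \<in> measure_support \<tau>" for x
  proof (rule ccontr)
    assume "\<not> x \<ge> 0"
    then have "emeasure \<tau> {..<0} > 0" using that by (auto simp: measure_support_def)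
    moreover have "emeasure \<tau> {..<0} \<le> emeasure \<tau> {..0}" by (intro emeasure_mono) (auto simp: t(1))
    ultimately show False using t(2) by simp
  qed
  have "S \<noteq> {}"
  proof
    assume "S = {}"
    then have "measure_support \<tau> = {}" using supp by (auto simp: S_def)
    then have "\<tau> = null_measure borel" using null by (intro measure_eqI) (auto simp: t(1))
    then show False using nz by simp
  qed
  moreover have bdd: "bdd_below S" by (rule bdd_belowI[of _ 0]) (auto simp: S_def)
  ultimately show "0 \<le> thorin_edge \<tau>"
    unfolding thorin_edge_def S_def[symmetric] by (intro cInf_greatest) (auto simp: S_def)
  have le: "thorin_edge \<tau> \<le> x" if "x \<in> measure_support \<tau>" for x
    unfolding thorin_edge_def S_def[symmetric] using that supp[OF that]
    by (intro cInf_lower bdd) (auto simp: S_def)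
  show "emeasure \<tau> {..<thorin_edge \<tau>} = 0"
    using le by (intro null) force
  assume s: "s > 0"
  then have "Inf S < thorin_edge \<tau> + s" by (simp add: thorin_edge_def S_def)
  then obtain p where p: "p \<in> S" "p < thorin_edge \<tau> + s"
    using \<open>S \<noteq> {}\<close> bdd by (auto simp: cInf_less_iff)
  then have "0 < emeasure \<tau> {..<thorin_edge \<tau> + s}" by (auto simp: S_def measure_support_def)
  also have "\<dots> \<le> emeasure \<tau> {..thorin_edge \<tau> + s}" by (intro emeasure_mono) (auto simp: t(1))
  finally show "emeasure \<tau> {..thorin_edge \<tau> + s} > 0" .
qed

text \<open>Monotonicity is asked of the right tail alone; after reflection this is precisely what
  monotonicity of the left tail provides.\<close>

lemma thorin_right_tail:
  fixes \<mu> \<tau>p \<tau>m :: "real measure" and f :: "real \<Rightarrow> real"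
  assumes mu: "real_distribution \<mu>" and fam: "thorin_family \<mu> \<tau>p \<tau>m"
    and f [measurable]: "f \<in> borel_measurable borel" and f0: "\<And>x. 0 \<le> f x" 
    and dens: "\<mu> = density lborel (\<lambda>x. ennreal (f x))" and anti: "antimono_on {a..} f"
    and nz: "\<tau>p \<noteq> null_measure borel" and integ: "integrable \<mu> (\<lambda>x. exp (thorin_edge \<tau>p * x))"
    and rv: "regularly_varying_at_0 (\<lambda>x. measure \<tau>p {0..thorin_edge \<tau>p + x})"
  shows "f \<sim>[at_top] (\<lambda>x. (LINT y|\<mu>. exp (thorin_edge \<tau>p * y)) * (canonical_fun \<tau>p \<tau>m x / \<bar>x\<bar>))"
proof -
  define \<gamma> where "\<gamma> = thorin_edge \<tau>p"
  define w where "w x = canonical_fun \<tau>p \<tau>m x / \<bar>x\<bar>" for x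
  define T where "T = distr \<tau>p borel (\<lambda>s. s - \<gamma>)"
  interpret mu: real_distribution \<mu> by (rule mu)
  have tp: "thorin_measure \<tau>p" and tm: "thorin_measure \<tau>m"
    and lm: "levy_measure_of \<mu> (density lborel (\<lambda>x. ennreal (w x)))"
    using fam by (auto simp: thorin_family_def w_def)
  note t = thorin_measureD[OF tp]
  note [measurable_cong] = t(1)
  note [measurable] = canonical_fun_measurable[OF tp tm]
  note edge = thorin_edge[OF tp nz, folded \<gamma>_def]
  have w [measurable]: "w \<in> borel_measurable borel" unfolding w_def[abs_def] by measurable
  have w0: "0 \<le> w x" for x by (simp add: w_def canonical_fun_nonneg)
  have T_eval: "emeasure T A = emeasure \<tau>p ((\<lambda>s. s - \<gamma>) -` A)" if "A \<in> sets borel" for A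
    unfolding T_def using that sets_eq_imp_space_eq[OF t(1)] by (subst emeasure_distr) auto
  interpret T: thorin_transform T
  proof
    show "sets T = sets borel" by (simp add: T_def)
    have "(\<lambda>s. s - \<gamma>) -` {..<0} = {..<\<gamma>}" by auto
    then show "emeasure T {..<0} = 0" using edge(2) by (simp add: T_eval)
    have "(\<lambda>s. s - \<gamma>) -` {..s} = {..\<gamma> + s}" for s by auto
    then show "emeasure T {..s} > 0" if "s > 0" for s using edge(3)[OF that] by (simp add: T_eval)
    fix x :: real assume x: "x > 0"
    have "(\<integral>\<^sup>+s. ennreal (exp (- (s * x))) \<partial>T) = (\<integral>\<^sup>+s. ennreal (exp (\<gamma> * x)) * ennreal (exp (- (s * x))) \<partial>\<tau>p)"
      unfolding T_def by (simp add: nn_integral_distr ennreal_mult'[symmetric] exp_add[symmetric] algebra_simps)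
    also have "\<dots> = ennreal (exp (\<gamma> * x)) * (\<integral>\<^sup>+s. ennreal (exp (- (s * x))) \<partial>\<tau>p)"
      by (rule nn_integral_cmult) measurable
    also have "\<dots> < \<infinity>" using thorin_measure_exp_finite[OF tp x] by (simp add: ennreal_mult_less_top)
    finally show "(\<integral>\<^sup>+s. ennreal (exp (- (s * x))) \<partial>T) < \<infinity>" .
  qed
  have L_eq: "T.L x = exp (\<gamma> * x) * canonical_fun \<tau>p \<tau>m x" if "x > 0" for x
  proof -
    have "T.L x = (LINT s|T. exp (- (s * x)))" by (rule T.L_def)
    also have "\<dots> = (LINT s|\<tau>p. exp (\<gamma> * x) * exp (- (s * x)))"
      unfolding T_def by (subst integral_distr) (auto simp: exp_add[symmetric] algebra_simps)
    finally show ?thesis using canonical_fun_pos[OF tp that] by simp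
  qed
  define g where "g = T.tilted_levy_density"
  define w1 where "w1 x = w x * indicator {1<..} x" for x
  have gw: "g x = exp (\<gamma> * x) * w1 x" for x
    by (auto simp: g_def T.tilted_levy_density_def w1_def w_def L_eq split: split_indicator)
  \<comment> \<open>Integrability of \<open>min 1 (x\<^sup>2)\<close> against the Levy measure is
    all that the decomposition needs to know about \<open>w\<close>.\<close>
  have int: "integrable lborel (\<lambda>x. w x * min 1 (x\<^sup>2))"
  proof (rule integrableI_nonneg)
    have "(\<integral>\<^sup>+x. ennreal (w x * min 1 (x\<^sup>2)) \<partial>lborel) = (\<integral>\<^sup>+x. ennreal (min 1 (x\<^sup>2)) \<partial>density lborel (\<lambda>x. ennreal (w x)))"
      using w0 by (subst nn_integral_density) (auto simp: ennreal_mult' simp flip: ennreal_mult')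
    then show "(\<integral>\<^sup>+x. ennreal (w x * min 1 (x\<^sup>2)) \<partial>lborel) < \<infinity>"
      using lm by (simp add: levy_measure_of_def)
  qed (auto simp: w0)
  obtain c v where v: "v \<ge> 0" and ch: "\<And>t. char \<mu> t = exp (\<i> * of_real (c * t) - of_real (v * t\<^sup>2 / 2)
        + (CLINT x|lborel. w x * (iexp (t * x) - 1 - \<i> * of_real (t * x * indicator {-1..1} x))))"
  proof -
    obtain c v where cv: "v \<ge> 0" "\<And>t. char \<mu> t = exp (\<i> * of_real (c * t) - of_real (v * t\<^sup>2 / 2)
             + (CLINT x|density lborel (\<lambda>x. ennreal (w x)). iexp (t * x) - 1 - \<i> * of_real (t * x * indicator {-1..1} x)))"
      using lm unfolding levy_measure_of_def by blast
    have "(CLINT x|density lborel (\<lambda>x. ennreal (w x)). iexp (t * x) - 1 - \<i> * of_real (t * x * indicator {-1..1} x)) =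
      (CLINT x|lborel. w x * (iexp (t * x) - 1 - \<i> * of_real (t * x * indicator {-1..1} x)))" for t
      using w0 by (subst integral_density) (auto simp: scaleR_conv_of_real)
    then show thesis using that[OF cv(1)] cv(2) by simp
  qed
  obtain Q where Q: "real_distribution Q" "integrable lborel w1"
    "\<And>\<theta>. \<theta> \<ge> 0 \<Longrightarrow> (\<integral>\<^sup>+x. ennreal (exp (\<theta> * x)) \<partial>Q) < \<infinity>"
    "\<And>f. f \<in> borel_measurable borel \<Longrightarrow> (\<integral>\<^sup>+x. f x \<partial>\<mu>) =
       (\<Sum>n. ennreal (exp (- (LINT x|lborel. w1 x)) / fact n) *
         (\<integral>\<^sup>+x. f x \<partial>conv_iter Q (density lborel (\<lambda>x. ennreal (w1 x))) n))"
    by (rule levy_large_jump_decomposition[OF mu v w w0 int ch w1_def]) (rule that)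
  have w10: "0 \<le> w1 x" for x by (simp add: w1_def w0)
  have [measurable]: "w1 \<in> borel_measurable borel" using Q(2) by auto
  interpret Q: real_distribution Q by (rule Q)
  have fin_mu: "(\<integral>\<^sup>+x. ennreal (exp (\<gamma> * x)) \<partial>\<mu>) < \<infinity>"
    using integ by (simp add: integrable_iff_bounded \<gamma>_def)
  \<comment> \<open>The single-jump term of the mixture is bounded by the exponential moment of
    \<mu>. It factors into the moment of \<open>Q\<close>, which is not 0, and the integral of
    \<open>g\<close>.\<close>
  have g_int: "integrable lborel g"
  proof (rule integrableI_nonneg)
    let ?D = "density lborel (\<lambda>x. ennreal (w1 x))"
    have "(\<integral>\<^sup>+x. ennreal (g x) \<partial>lborel) = (\<integral>\<^sup>+x. ennreal (exp (\<gamma> * x)) \<partial>?D)"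
      using w10 by (subst nn_integral_density) (auto simp: gw ennreal_mult mult.commute)
    moreover have "(\<integral>\<^sup>+x. ennreal (exp (\<gamma> * x)) \<partial>?D) < \<infinity>"
    proof -
      let ?a = "\<lambda>n. ennreal (exp (- (LINT x|lborel. w1 x)) / fact n) * (\<integral>\<^sup>+x. ennreal (exp (\<gamma> * x)) \<partial>conv_iter Q ?D n)"
      have "?a 1 \<le> (\<Sum>n. ?a n)" using sum_le_suminf[of ?a "{1}"] by simp
      also have "\<dots> = (\<integral>\<^sup>+x. ennreal (exp (\<gamma> * x)) \<partial>\<mu>)" by (rule Q(4)[symmetric]) measurable
      also note fin_mu
      finally have "?a 1 < \<infinity>" .
      then have "(\<integral>\<^sup>+x. ennreal (exp (\<gamma> * x)) \<partial>conv_iter Q ?D 1) < \<infinity>"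
        by (auto simp: ennreal_mult_less_top)
      then have *: "(\<integral>\<^sup>+x. ennreal (exp (\<gamma> * x)) \<partial>Q) * (\<integral>\<^sup>+x. ennreal (exp (\<gamma> * x)) \<partial>?D) < \<infinity>"
        by (subst (asm) nn_integral_exp_conv_iter)
          (auto simp: Q.finite_measure_axioms finite_measure_density_real Q(2))
      have "(\<integral>\<^sup>+x. ennreal (exp (\<gamma> * x)) \<partial>Q) \<noteq> 0"
      proof
        assume "(\<integral>\<^sup>+x. ennreal (exp (\<gamma> * x)) \<partial>Q) = 0"
        then have "AE x in Q. ennreal (exp (\<gamma> * x)) = 0" by (subst (asm) nn_integral_0_iff_AE) auto
        then have "AE x in Q. False" by simp
        then show False by simp
      qed
      with * show ?thesis by (auto simp: ennreal_mult_less_top)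
    qed
    ultimately show "(\<integral>\<^sup>+x. ennreal (g x) \<partial>lborel) < \<infinity>" by simp
  qed (auto simp: gw[abs_def] w10)
  have T_meas: "measure T {..s} = measure \<tau>p {0..\<gamma> + s}" if "s > 0" for s
  proof -
    have "(\<lambda>s. s - \<gamma>) -` {..s} = {..\<gamma> + s}" by auto
    then have "measure T {..s} = measure \<tau>p {..\<gamma> + s}" by (simp add: measure_def T_eval)
    also have "\<dots> = measure \<tau>p {0..\<gamma> + s}"
      using t(5) by (intro measure_eq_AE) (auto simp: t(1) elim!: eventually_mono)
    finally show ?thesis .
  qed
  obtain \<rho> where \<rho>: "\<And>l. l > 0 \<Longrightarrow> ((\<lambda>x. measure \<tau>p {0..\<gamma> + l * x} / measure \<tau>p {0..\<gamma> + x}) \<longlongrightarrow> l powr \<rho>) (at_right 0)"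
    using rv unfolding regularly_varying_at_0_def \<gamma>_def by blast
  \<comment> \<open>Any constant above the limit \<open>2 powr \<rho>\<close> of the doubling
    quotient would serve.\<close>
  define D where "D = 2 powr \<rho> + 1"
  have "\<forall>\<^sub>F x in at_right 0. measure \<tau>p {0..\<gamma> + 2 * x} / measure \<tau>p {0..\<gamma> + x} < D"
    using \<rho>[of 2] by (intro order_tendstoD(2)) (auto simp: D_def)
  then obtain s0 where s0: "s0 > 0" "\<And>x. 0 < x \<Longrightarrow> x < s0 \<Longrightarrow> measure \<tau>p {0..\<gamma> + 2 * x} / measure \<tau>p {0..\<gamma> + x} < D"
    by (auto simp: eventually_at_right_field)
  \<comment> \<open>Positivity of the mass near the edge is essential here: division by 0 gives 0,
    and a bound on the quotient would then say nothing about the numerator.\<close>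
  have doubling: "measure T {..2 * s} \<le> D * measure T {..s}" if "0 < s" "s < s0" for s
    using s0(2)[OF that] T.measure_T_pos[of s] that by (simp add: T_meas divide_less_eq)
  have "D \<ge> 0" by (simp add: D_def add_nonneg_nonneg)
  from T.subexponential_tilted_levy_density[OF s0(1) this doubling] g_int
  obtain C where "subexponential_density g C (T.L 1)" unfolding g_def by blast
  then interpret g: subexponential_density g C "T.L 1" .
  obtain M where M: "M > 0" "(\<integral>\<^sup>+x. ennreal (exp (\<gamma> * x)) \<partial>\<mu>) = ennreal M"
    "((\<lambda>x. exp (\<gamma> * x) * f x / g x) \<longlongrightarrow> M) at_top"
    by (rule g.compound_poisson_tail[OF edge(1) T.tilted_levy_density_antimono[folded g_def]
          Q(1,3) Q(2) w10 gw Q(4) dens f f0 anti]) auto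
  have LM: "(LINT y|\<mu>. exp (\<gamma> * y)) = M"
    using M(1,2) integ by (subst (asm) nn_integral_eq_integral) (auto simp: \<gamma>_def)
  have "((\<lambda>x. f x / (M * (canonical_fun \<tau>p \<tau>m x / \<bar>x\<bar>))) \<longlongrightarrow> 1) at_top"
  proof (rule Lim_transform_eventually)
    show "((\<lambda>x. exp (\<gamma> * x) * f x / g x / M) \<longlongrightarrow> 1) at_top"
      using tendsto_divide[OF M(3) tendsto_const[of M]] M(1) by simp
    show "\<forall>\<^sub>F x in at_top. exp (\<gamma> * x) * f x / g x / M = f x / (M * (canonical_fun \<tau>p \<tau>m x / \<bar>x\<bar>))"
      using eventually_gt_at_top[of 1]
      by eventually_elim (simp add: gw w1_def w_def)
  qed
  then show ?thesis
    unfolding LM[unfolded \<gamma>_def] by (intro asymp_equivI')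
qed

section \<open>Reflection\<close>

lemma distr_uminus_density_lborel:
  fixes h :: "real \<Rightarrow> ennreal"
  assumes [measurable]: "h \<in> borel_measurable borel"
  shows "distr (density lborel h) borel uminus = density lborel (\<lambda>x. h (- x))"
proof -
  have "density lborel (\<lambda>x. h (- x)) = density (distr lborel borel uminus) (\<lambda>x. h (- x))"
    by (simp add: lborel_distr_uminus)
  also have "\<dots> = distr (density lborel (\<lambda>x. h (- (- x)))) borel uminus"
    by (rule density_distr) auto
  finally show ?thesis by simp
qed

text \<open>The truncation set is symmetric, so reflection leaves the Gaussian variance unchanged
  and only reverses the sign of the drift.\<close>

lemma levy_measure_of_reflect:
  assumes mu [measurable_cong]: "sets \<mu> = sets borel" and lm: "levy_measure_of \<mu> \<nu>"
  shows "levy_measure_of (distr \<mu> borel uminus) (distr \<nu> borel uminus)"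
proof -
  have [measurable_cong]: "sets \<nu> = sets borel" and n0: "emeasure \<nu> {0} = 0"
    and nn: "(\<integral>\<^sup>+x. ennreal (min 1 (x\<^sup>2)) \<partial>\<nu>) < \<infinity>"
    using lm by (auto simp: levy_measure_of_def)
  obtain c v where v: "v \<ge> 0" and ch: "\<And>t. char \<mu> t =
        exp (\<i> * of_real (c * t) - of_real (v * t\<^sup>2 / 2)
             + (CLINT x|\<nu>. iexp (t * x) - 1 - \<i> * of_real (t * x * indicator {-1..1} x)))"
    using lm unfolding levy_measure_of_def by blast
  have "char (distr \<mu> borel uminus) t =
        exp (\<i> * of_real (- c * t) - of_real (v * t\<^sup>2 / 2)
             + (CLINT x|distr \<nu> borel uminus. iexp (t * x) - 1 - \<i> * of_real (t * x * indicator {-1..1} x)))" for t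
  proof -
    have "char (distr \<mu> borel uminus) t = char \<mu> (- t)"
      unfolding char_def by (subst integral_distr) auto
    moreover have "(CLINT x|distr \<nu> borel uminus. iexp (t * x) - 1 - \<i> * of_real (t * x * indicator {-1..1} x)) =
        (CLINT x|\<nu>. iexp (- t * x) - 1 - \<i> * of_real (- t * x * indicator {-1..1} x))"
      by (subst integral_distr) (auto intro!: Bochner_Integration.integral_cong split: split_indicator)
    ultimately show ?thesis unfolding ch by simp
  qed
  moreover have "(\<integral>\<^sup>+x. ennreal (min 1 (x\<^sup>2)) \<partial>distr \<nu> borel uminus) < \<infinity>"
    using nn by (subst nn_integral_distr) auto
  moreover have "emeasure (distr \<nu> borel uminus) {0} = 0"
  proof -
    have "uminus -` {0} \<inter> space \<nu> = {0 :: real}"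
      using sets_eq_imp_space_eq[of \<nu> borel] \<open>sets \<nu> = sets borel\<close> by auto
    then show ?thesis using n0 by (subst emeasure_distr) auto
  qed
  ultimately show ?thesis
    unfolding levy_measure_of_def using v by (intro conjI exI[of _ "- c"] exI[of _ v]) auto
qed

lemma thorin_family_reflect:
  assumes "sets \<mu> = sets borel" "thorin_family \<mu> \<tau>p \<tau>m"
  shows "thorin_family (distr \<mu> borel uminus) \<tau>m \<tau>p"
proof -
  have t: "thorin_measure \<tau>p" "thorin_measure \<tau>m"
    and lm: "levy_measure_of \<mu> (density lborel (\<lambda>x. ennreal (canonical_fun \<tau>p \<tau>m x / \<bar>x\<bar>)))"
    using assms(2) by (auto simp: thorin_family_def)
  note [measurable] = canonical_fun_measurable[OF t]
  from levy_measure_of_reflect[OF assms(1) lm] show ?thesis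
    unfolding thorin_family_def using t
    by (simp add: distr_uminus_density_lborel canonical_fun_uminus[of \<tau>m \<tau>p])
qed

theorem corollary3:
  fixes \<mu> \<tau>p \<tau>m :: "real measure" and f :: "real \<Rightarrow> real"
  assumes "\<mu> \<in> thorin_class"
    and "thorin_family \<mu> \<tau>p \<tau>m"
    and "tail_monotone_density \<mu> f"
  shows "(\<tau>p \<noteq> null_measure borel \<longrightarrow>
          integrable \<mu> (\<lambda>x. exp (thorin_edge \<tau>p * x)) \<longrightarrow>
          regularly_varying_at_0 (\<lambda>x. measure \<tau>p {0..thorin_edge \<tau>p + x}) \<longrightarrow>
          f \<sim>[at_top]
            (\<lambda>x. (LINT y|\<mu>. exp (thorin_edge \<tau>p * y)) * (canonical_fun \<tau>p \<tau>m x / \<bar>x\<bar>)))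
       \<and> (\<tau>m \<noteq> null_measure borel \<longrightarrow>
          integrable \<mu> (\<lambda>x. exp (- thorin_edge \<tau>m * x)) \<longrightarrow>
          regularly_varying_at_0 (\<lambda>x. measure \<tau>m {0..thorin_edge \<tau>m + x}) \<longrightarrow>
          f \<sim>[at_bot]
            (\<lambda>x. (LINT y|\<mu>. exp (- thorin_edge \<tau>m * y)) * (canonical_fun \<tau>p \<tau>m x / \<bar>x\<bar>)))"
proof (intro conjI impI)
  have mu: "real_distribution \<mu>" using assms(1) by (auto simp: thorin_class_def)
  interpret real_distribution \<mu> by (rule mu)
  obtain a b where f [measurable]: "f \<in> borel_measurable borel" and f0: "\<And>x. 0 \<le> f x"
    and dens: "\<mu> = density lborel (\<lambda>x. ennreal (f x))"
    and a: "antimono_on {a..} f" and b: "mono_on {..b} f"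
    using assms(3) unfolding tail_monotone_density_def by blast
  {
    assume "\<tau>p \<noteq> null_measure borel" "integrable \<mu> (\<lambda>x. exp (thorin_edge \<tau>p * x))"
      "regularly_varying_at_0 (\<lambda>x. measure \<tau>p {0..thorin_edge \<tau>p + x})"
    then show "f \<sim>[at_top] (\<lambda>x. (LINT y|\<mu>. exp (thorin_edge \<tau>p * y)) * (canonical_fun \<tau>p \<tau>m x / \<bar>x\<bar>))"
      by (rule thorin_right_tail[OF mu assms(2) f f0 dens a])
  next
    assume nz: "\<tau>m \<noteq> null_measure borel" and int: "integrable \<mu> (\<lambda>x. exp (- thorin_edge \<tau>m * x))"
      and rv: "regularly_varying_at_0 (\<lambda>x. measure \<tau>m {0..thorin_edge \<tau>m + x})"
    let ?\<mu> = "distr \<mu> borel uminus"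
    \<comment> \<open>Reflection exchanges the two Thorin measures and turns the exponent
      \<open>- thorin_edge \<tau>m * x\<close> into the one required on the right.\<close>
    have "(\<lambda>x. f (- x)) \<sim>[at_top]
        (\<lambda>x. (LINT y|?\<mu>. exp (thorin_edge \<tau>m * y)) * (canonical_fun \<tau>m \<tau>p x / \<bar>x\<bar>))"
    proof (rule thorin_right_tail[OF _ thorin_family_reflect[OF _ assms(2)] _ _ _ _ nz _ rv])
      show "real_distribution ?\<mu>" by (rule real_distribution_distr) simp
      show "?\<mu> = density lborel (\<lambda>x. ennreal (f (- x)))"
        by (subst (1) dens) (simp add: distr_uminus_density_lborel)
      show "antimono_on {- b..} (\<lambda>x. f (- x))"
        using b by (auto simp: monotone_on_def)
      show "integrable ?\<mu> (\<lambda>x. exp (thorin_edge \<tau>m * x))"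
        using int by (subst integrable_distr_eq) auto
    qed (auto simp: f0)
    moreover have "(LINT y|?\<mu>. exp (thorin_edge \<tau>m * y)) = (LINT y|\<mu>. exp (- thorin_edge \<tau>m * y))"
      by (subst integral_distr) auto
    ultimately have "(\<lambda>x. f (- x)) \<sim>[at_top]
        (\<lambda>x. (LINT y|\<mu>. exp (- thorin_edge \<tau>m * y)) * (canonical_fun \<tau>m \<tau>p x / \<bar>x\<bar>))"
      by simp
    from asymp_equiv_compose'[OF this filterlim_uminus_at_top_at_bot]
    show "f \<sim>[at_bot] (\<lambda>x. (LINT y|\<mu>. exp (- thorin_edge \<tau>m * y)) * (canonical_fun \<tau>p \<tau>m x / \<bar>x\<bar>))"
      by (simp add: canonical_fun_uminus[of \<tau>m \<tau>p])
  }
qed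

end
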